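(* Let $\mathcal T$ be a zonal integral operator on $\mathbb S^2$ with multipliers $(\mu_\ell)_{\ell\ge0}$, and assume there are constants $\beta,C_{\mathcal T},\delta>0$ with $|\mu_\ell|\le C_{\mathcal T}(1+\ell)^{-\beta}$ and $|1-\mu_\ell|\ge\delta$ for all $\ell\in\mathbb N_0$. Let $\{\mathcal Q_{N_n}\}_{n\ge1}$ be a family of positive quadrature rules on $\mathbb S^2$ satisfying the Marcinkiewicz–Zygmund condition $$(1-\eta_n)\|p\|_{L^2}^2\le\mathcal Q_{N_n}(|p|^2)\le(1+\eta_n)\|p\|_{L^2}^2\qquad\forall p\in\mathbb P_n,\qquad 0\le\eta_n<1 .$$ Fix $q\in\mathbb N_0$ and $\star\in\{G,N\}$, let $\varepsilon_G=0$, $\varepsilon_N=1$, $\gamma_\star=(q+\varepsilon_\star)\beta$, and let $r>1$. Then there is a constant $C$ independent of $n$, $f$ and $\eta_n$ such that for all $f\in H^r(\mathbb S^2)$, with $u=(I-\mathcal T)^{-1}f$, $$\|u-\mathcal S_q(\widetilde u_{n,\mathcal Q}^{\star})\|_{L^\infty(\mathbb S^2)}\le C\left\{n^{-(r+\gamma_\star-1)}+\rho_{\gamma_\star}(n)\left[1+\left(\frac{1+\eta_n}{1-\eta_n}\right)^2\right]^{1/2}n^{-r}\right\}\|f\|_{H^r(\mathbb S^2)},$$ where $\widetilde u_{n,\mathcal Q}^{G}$ and $\widetilde u_{n,\mathcal Q}^{N}$ are the Gram-corrected discrete Galerkin and product-integration Nyström solutions, and $\rho_\gamma(n)=n^{1-\gamma}$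 for $0\le\gamma<1$, $\rho_1(n)=(\log(n+1))^{1/2}$, $\rho_\gamma(n)=1$ for $\gamma>1$.
   Context: Functions on the unit sphere $\mathbb S^2\subset\mathbb R^3$ are real-valued; $\omega$ is surface measure with $\omega(\mathbb S^2)=4\pi$. $\{Y_{\ell,k}:\ell\in\mathbb N_0,\ 1\le k\le 2\ell+1\}$ is a real orthonormal basis of $L^2(\mathbb S^2)$ consisting of spherical harmonics ($Y_{\ell,k}$ of degree $\ell$), $\widehat v_{\ell,k}=\int_{\mathbb S^2}vY_{\ell,k}\,d\omega$, and $\mathbb P_n=\mathrm{span}\{Y_{\ell,k}:\ell\le n\}$. For $r\in\mathbb R$, $\|v\|_{H^r(\mathbb S^2)}^2=\sum_{\ell}(1+\ell(\ell+1))^r\sum_k|\widehat v_{\ell,k}|^2$; for $r>1$, $H^r(\mathbb S^2)\hookrightarrow C(\mathbb S^2)$. Zonal integral operator: $(\mathcal Tv)(x)=\int_{\mathbb S^2}\Phi(x\cdot y)v(y)\,d\omega(y)$ with real-valued $\Phi\in L^1(-1,1)$; then $\mathcal TY_{\ell,k}=\mu_\ell Y_{\ell,k}$ with $\mu_\ell=2\pi\int_{-1}^1\Phi(t)P_\ell(t)\,dt$, $P_\ell$ the Legendre polynomial. Equation and Sloan iteration: $u$ solves $(I-\mathcal T)u=f$. For an approximation $v$ to $u$: $\mathcal S_0(v)=v$, $\mathcal S_{q+1}(v)=f+\mathcal T\mathcal S_q(v)$. Positive quadrature rule: $\mathcal Q_{N_n}(g)=\sum_{j=1}^{N_n}w_{j,n}g(x_{j,n})$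 with $x_{j,n}\in\mathbb S^2$, $w_{j,n}>0$ (no polynomial exactness is assumed). Weighted least-squares projector: for $v\in C(\mathbb S^2)$, $\widetilde{\mathcal L}_{n,\mathcal Q}v$ is the unique minimizer over $p\in\mathbb P_n$ of $\sum_{j=1}^{N_n}w_{j,n}|v(x_{j,n})-p(x_{j,n})|^2$. Gram-corrected discrete Galerkin solution: $\widetilde u_{n,\mathcal Q}^G\in\mathbb P_n$ with $\mathcal Q_{N_n}\big(((I-\mathcal T)\widetilde u_{n,\mathcal Q}^G)\,p\big)=\mathcal Q_{N_n}(fp)$ for all $p\in\mathbb P_n$. Gram-corrected product-integration Nyström solution: $\widetilde u_{n,\mathcal Q}^N\in H^r(\mathbb S^2)$ with $(I-\mathcal T\widetilde{\mathcal L}_{n,\mathcal Q})\widetilde u_{n,\mathcal Q}^N=f$. Under the stated hypotheses both exist and are unique. *)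

theory Defs
  imports
    "HOL-Analysis.Analysis"
    "HOL-Probability.Essential_Supremum"
    "HOL-Computational_Algebra.Polynomial"
begin

section \<open>The sphere and its surface measure\<close>

abbreviation S2 :: "(real ^ 3) set" where
  "S2 \<equiv> sphere 0 1"

text \<open>Surface measure in polar coordinates: the measure of \<open>A \<subseteq> S2\<close> is three times the volume of the
  cone \<open>{t x | 0 < t \<le> 1, x \<in> A}\<close>, since \<open>vol = (\<integral> t\<^sup>2 dt over [0,1]) \<cdot> area\<close>. Here \<open>sgn x = x / norm x\<close>.
  The measure space has \<open>S2\<close> itself as its carrier, so that integrals over it only depend on values
  of the integrand on \<open>S2\<close>.\<close>

definition surface_measure :: "(real ^ 3) measure" where
  "surface_measure =
     scale_measure 3 (distr (restrict_space lborel (cball 0 1 - {0})) (restrict_space borel S2) sgn)"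

lemma space_surface_measure [simp]: "space surface_measure = S2"
  by (simp add: surface_measure_def space_scale_measure space_restrict_space)

lemma sets_surface_measure [measurable_cong, simp]:
  "sets surface_measure = sets (restrict_space borel S2)"
  by (simp add: surface_measure_def)

lemma measurable_sgn_S2:
  "(sgn :: real ^ 3 \<Rightarrow> _) \<in> restrict_space lborel (cball 0 1 - {0}) \<rightarrow>\<^sub>M restrict_space borel S2"
proof (rule measurable_restrict_space2)
  show "(sgn :: real ^ 3 \<Rightarrow> _) \<in> space (restrict_space lborel (cball 0 1 - {0})) \<rightarrow> S2"
    by (auto simp: norm_sgn space_restrict_space)
  have "(sgn :: real ^ 3 \<Rightarrow> _) \<in> borel_measurable borel"
    unfolding sgn_div_norm by measurable
  then show "(sgn :: real ^ 3 \<Rightarrow> _) \<in> borel_measurable (restrict_space lborel (cball 0 1 - {0}))"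
    by (intro measurable_restrict_space1) simp
qed

lemma emeasure_surface_measure_S2: "emeasure surface_measure S2 = ennreal (4 * pi)"
proof -
  let ?B = "cball 0 1 - {0} :: (real ^ 3) set"
  have S: "S2 \<in> sets (restrict_space borel S2)"
    by (metis sets.top space_restrict_space2 borel_closed closed_sphere sets_borel sets_restrict_space_iff
        Int_UNIV_right space_borel space_restrict_space inf_top_right)
  have vim: "sgn -` S2 \<inter> space (restrict_space lborel ?B) = ?B"
    by (auto simp: space_restrict_space norm_sgn)
  have "emeasure surface_measure S2 = 3 * emeasure (restrict_space lborel ?B) ?B"
    unfolding surface_measure_def emeasure_scale_measure
    using emeasure_distr[OF measurable_sgn_S2 S] vim by simp
  also have "emeasure (restrict_space lborel ?B) ?B = emeasure lborel ?B"
    by (subst emeasure_restrict_space) auto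
  also have "\<dots> = emeasure lborel (cball 0 1 :: (real ^ 3) set)"
    by (subst emeasure_Diff) auto
  also have "\<dots> = ennreal (4 / 3 * pi)"
    by (subst emeasure_cball) (auto simp: unit_ball_vol_3)
  also have "3 * \<dots> = ennreal (4 * pi)"
    by (simp flip: ennreal_numeral ennreal_mult)
  finally show ?thesis .
qed

section \<open>Spherical harmonics\<close>

definition laplacian :: "(real ^ 3 \<Rightarrow> real) \<Rightarrow> real ^ 3 \<Rightarrow> real" where
  "laplacian p x = (\<Sum>b\<in>Basis. (deriv ^^ 2) (\<lambda>t. p (x + t *\<^sub>R b)) 0)"

text \<open>Restrictions to the sphere of harmonic homogeneous polynomials of degree \<open>l\<close>.\<close>

definition spherical_harmonic :: "nat \<Rightarrow> (real ^ 3 \<Rightarrow> real) \<Rightarrow> bool" where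
  "spherical_harmonic l Y \<longleftrightarrow>
     (\<exists>p. real_polynomial_function p \<and> (\<forall>t x. p (t *\<^sub>R x) = t ^ l * p x) \<and>
          (\<forall>x. laplacian p x = 0) \<and> (\<forall>x\<in>S2. Y x = p x))"

definition l2_norm :: "(real ^ 3 \<Rightarrow> real) \<Rightarrow> real" where
  "l2_norm v = sqrt (LINT x|surface_measure. (v x)\<^sup>2)"

definition square_integrable :: "(real ^ 3 \<Rightarrow> real) \<Rightarrow> bool" where
  "square_integrable v \<longleftrightarrow>
     v \<in> borel_measurable surface_measure \<and> integrable surface_measure (\<lambda>x. (v x)\<^sup>2)"

definition fourier_coeff :: "(nat \<Rightarrow> nat \<Rightarrow> real ^ 3 \<Rightarrow> real) \<Rightarrow> (real ^ 3 \<Rightarrow> real) \<Rightarrow> nat \<Rightarrow> nat \<Rightarrow> real" where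
  "fourier_coeff Y v l k = (LINT x|surface_measure. v x * Y l k x)"

definition harmonic_onb :: "(nat \<Rightarrow> nat \<Rightarrow> real ^ 3 \<Rightarrow> real) \<Rightarrow> bool" where
  "harmonic_onb Y \<longleftrightarrow>
     (\<forall>l. \<forall>k\<in>{1..2*l+1}. spherical_harmonic l (Y l k)) \<and>
     (\<forall>l m. \<forall>k\<in>{1..2*l+1}. \<forall>j\<in>{1..2*m+1}.
        (LINT x|surface_measure. Y l k x * Y m j x) = (if l = m \<and> k = j then 1 else 0)) \<and>
     (\<forall>v. square_integrable v \<longrightarrow>
        (\<lambda>n. l2_norm (\<lambda>x. v x - (\<Sum>l\<le>n. \<Sum>k=1..2*l+1. fourier_coeff Y v l k * Y l k x)))
          \<longlonglongrightarrow> 0)"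

section \<open>Function spaces on the sphere\<close>

text \<open>A function on \<open>S2\<close> is represented by an extensional function (fixed to \<open>undefined\<close> off the
  sphere), so that equality of representatives is equality of functions on the sphere.\<close>

definition poly_space :: "(nat \<Rightarrow> nat \<Rightarrow> real ^ 3 \<Rightarrow> real) \<Rightarrow> nat \<Rightarrow> (real ^ 3 \<Rightarrow> real) set" where
  "poly_space Y n = {(\<lambda>x\<in>S2. \<Sum>l\<le>n. \<Sum>k=1..2*l+1. c l k * Y l k x) | c. True}"

definition sobolev_term :: "(nat \<Rightarrow> nat \<Rightarrow> real ^ 3 \<Rightarrow> real) \<Rightarrow> real \<Rightarrow> (real ^ 3 \<Rightarrow> real) \<Rightarrow> nat \<Rightarrow> real" where
  "sobolev_term Y r v l =
     (1 + real l * (real l + 1)) powr r * (\<Sum>k=1..2*l+1. \<bar>fourier_coeff Y v l k\<bar>\<^sup>2)"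

definition sobolev_norm :: "(nat \<Rightarrow> nat \<Rightarrow> real ^ 3 \<Rightarrow> real) \<Rightarrow> real \<Rightarrow> (real ^ 3 \<Rightarrow> real) \<Rightarrow> real" where
  "sobolev_norm Y r v = sqrt (\<Sum>l. sobolev_term Y r v l)"

text \<open>\<open>H\<^sup>r\<close> for \<open>r > 1\<close> only: each class is represented by its unique continuous
  representative, which exists by the Sobolev embedding into \<open>C(S2)\<close>. Point values, as used by the
  quadrature rules, refer to this representative.\<close>

definition sobolev_space :: "(nat \<Rightarrow> nat \<Rightarrow> real ^ 3 \<Rightarrow> real) \<Rightarrow> real \<Rightarrow> (real ^ 3 \<Rightarrow> real) set" where
  "sobolev_space Y r =
     {v \<in> extensional S2. continuous_on S2 v \<and> summable (sobolev_term Y r v)}"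

section \<open>Zonal operators\<close>

definition zonal_op :: "(real \<Rightarrow> real) \<Rightarrow> (real ^ 3 \<Rightarrow> real) \<Rightarrow> real ^ 3 \<Rightarrow> real" where
  "zonal_op \<Phi> v x = (LINT y|surface_measure. \<Phi> (x \<bullet> y) * v y)"

text \<open>Rodrigues' formula.\<close>

definition legendre :: "nat \<Rightarrow> real poly" where
  "legendre l = smult (1 / (2 ^ l * fact l)) ((pderiv ^^ l) ([:-1, 0, 1:] ^ l))"

definition multiplier :: "(real \<Rightarrow> real) \<Rightarrow> nat \<Rightarrow> real" where
  "multiplier \<Phi> l = 2 * pi * (LINT t:{-1<..<1}|lborel. \<Phi> t * poly (legendre l) t)"

definition exact_solution ::
    "(nat \<Rightarrow> nat \<Rightarrow> real ^ 3 \<Rightarrow> real) \<Rightarrow> real \<Rightarrow> (real \<Rightarrow> real) \<Rightarrow> (real ^ 3 \<Rightarrow> real) \<Rightarrow> real ^ 3 \<Rightarrow> real" where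
  "exact_solution Y r \<Phi> f =
     (THE u. u \<in> sobolev_space Y r \<and> (\<forall>x\<in>S2. u x - zonal_op \<Phi> u x = f x))"

primrec sloan :: "(real \<Rightarrow> real) \<Rightarrow> (real ^ 3 \<Rightarrow> real) \<Rightarrow> nat \<Rightarrow> (real ^ 3 \<Rightarrow> real) \<Rightarrow> real ^ 3 \<Rightarrow> real" where
  "sloan \<Phi> f 0 v = v"
| "sloan \<Phi> f (Suc q) v = (\<lambda>x. f x + zonal_op \<Phi> (sloan \<Phi> f q v) x)"

section \<open>Quadrature and the discrete schemes\<close>

definition positive_rule :: "nat \<Rightarrow> (nat \<Rightarrow> real) \<Rightarrow> (nat \<Rightarrow> real ^ 3) \<Rightarrow> bool" where
  "positive_rule N w x \<longleftrightarrow> (\<forall>j\<in>{1..N}. w j > 0 \<and> x j \<in> S2)"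

definition quad :: "nat \<Rightarrow> (nat \<Rightarrow> real) \<Rightarrow> (nat \<Rightarrow> real ^ 3) \<Rightarrow> (real ^ 3 \<Rightarrow> real) \<Rightarrow> real" where
  "quad N w x g = (\<Sum>j=1..N. w j * g (x j))"

definition mz_condition ::
    "(nat \<Rightarrow> nat \<Rightarrow> real ^ 3 \<Rightarrow> real) \<Rightarrow> nat \<Rightarrow> nat \<Rightarrow> (nat \<Rightarrow> real) \<Rightarrow> (nat \<Rightarrow> real ^ 3) \<Rightarrow> real \<Rightarrow> bool" where
  "mz_condition Y n N w x \<eta> \<longleftrightarrow>
     0 \<le> \<eta> \<and> \<eta> < 1 \<and>
     (\<forall>p\<in>poly_space Y n.
        (1 - \<eta>) * (l2_norm p)\<^sup>2 \<le> quad N w x (\<lambda>y. \<bar>p y\<bar>\<^sup>2) \<and>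
        quad N w x (\<lambda>y. \<bar>p y\<bar>\<^sup>2) \<le> (1 + \<eta>) * (l2_norm p)\<^sup>2)"

definition wls_proj ::
    "(nat \<Rightarrow> nat \<Rightarrow> real ^ 3 \<Rightarrow> real) \<Rightarrow> nat \<Rightarrow> nat \<Rightarrow> (nat \<Rightarrow> real) \<Rightarrow> (nat \<Rightarrow> real ^ 3)
      \<Rightarrow> (real ^ 3 \<Rightarrow> real) \<Rightarrow> real ^ 3 \<Rightarrow> real" where
  "wls_proj Y n N w x v =
     (THE p. is_arg_min (\<lambda>p. \<Sum>j=1..N. w j * \<bar>v (x j) - p (x j)\<bar>\<^sup>2) (\<lambda>p. p \<in> poly_space Y n) p)"

definition galerkin_solution ::
    "(nat \<Rightarrow> nat \<Rightarrow> real ^ 3 \<Rightarrow> real) \<Rightarrow> (real \<Rightarrow> real) \<Rightarrow> nat \<Rightarrow> nat \<Rightarrow> (nat \<Rightarrow> real) \<Rightarrow> (nat \<Rightarrow> real ^ 3)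
      \<Rightarrow> (real ^ 3 \<Rightarrow> real) \<Rightarrow> real ^ 3 \<Rightarrow> real" where
  "galerkin_solution Y \<Phi> n N w x f =
     (THE u. u \<in> poly_space Y n \<and>
        (\<forall>p\<in>poly_space Y n.
           quad N w x (\<lambda>y. (u y - zonal_op \<Phi> u y) * p y) = quad N w x (\<lambda>y. f y * p y)))"

definition nystrom_solution ::
    "(nat \<Rightarrow> nat \<Rightarrow> real ^ 3 \<Rightarrow> real) \<Rightarrow> real \<Rightarrow> (real \<Rightarrow> real) \<Rightarrow> nat \<Rightarrow> nat \<Rightarrow> (nat \<Rightarrow> real)
      \<Rightarrow> (nat \<Rightarrow> real ^ 3) \<Rightarrow> (real ^ 3 \<Rightarrow> real) \<Rightarrow> real ^ 3 \<Rightarrow> real" where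
  "nystrom_solution Y r \<Phi> n N w x f =
     (THE u. u \<in> sobolev_space Y r \<and>
        (\<forall>y\<in>S2. u y - zonal_op \<Phi> (wls_proj Y n N w x u) y = f y))"

datatype scheme = Galerkin | Nystrom

primrec scheme_solution ::
    "scheme \<Rightarrow> (nat \<Rightarrow> nat \<Rightarrow> real ^ 3 \<Rightarrow> real) \<Rightarrow> real \<Rightarrow> (real \<Rightarrow> real) \<Rightarrow> nat \<Rightarrow> nat \<Rightarrow> (nat \<Rightarrow> real)
      \<Rightarrow> (nat \<Rightarrow> real ^ 3) \<Rightarrow> (real ^ 3 \<Rightarrow> real) \<Rightarrow> real ^ 3 \<Rightarrow> real" where
  "scheme_solution Galerkin Y r \<Phi> n N w x f = galerkin_solution Y \<Phi> n N w x f"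
| "scheme_solution Nystrom Y r \<Phi> n N w x f = nystrom_solution Y r \<Phi> n N w x f"

primrec scheme_eps :: "scheme \<Rightarrow> real" where
  "scheme_eps Galerkin = 0"
| "scheme_eps Nystrom = 1"

text \<open>Only used for \<open>\<gamma> \<ge> 0\<close>.\<close>

definition rho :: "real \<Rightarrow> nat \<Rightarrow> real" where
  "rho \<gamma> n = (if \<gamma> < 1 then real n powr (1 - \<gamma>)
              else if \<gamma> = 1 then (ln (real n + 1)) powr (1/2)
              else 1)"

definition linf_norm :: "(real ^ 3 \<Rightarrow> real) \<Rightarrow> ereal" where
  "linf_norm v = esssup surface_measure (\<lambda>x. ereal \<bar>v x\<bar>)"

end

theory Submission
  imports Defs "HOL-Probability.Levy" "HOL-Library.Function_Algebras"
begin

text \<open>Both schemes are governed by the discrete projection \<open>p\<close> of \<open>f\<close>: the Galerkin solution is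
  \<open>(I - T)\<^sup>-\<^sup>1 p\<close>, the Nystroem solution is one Sloan step applied to it, and each Sloan step multiplies
  the error by \<open>T\<close>. Hence the error is \<open>T\<^sup>m (I - T)\<^sup>-\<^sup>1 (f - p)\<close> with \<open>m = q\<close> or \<open>m = q + 1\<close>, and \<open>T\<close> acts
  diagonally by Funk--Hecke. In degrees above \<open>n\<close> the coefficients of \<open>f - p\<close> are those of \<open>f\<close>, which gives the
  first term of the bound. Below \<open>n\<close> they are controlled by the discrete norm of the remainder of \<open>f\<close>, split
  into dyadic blocks of degrees; on polynomials of degree \<open>M > n\<close> the rule still satisfies an upper
  Marcinkiewicz--Zygmund bound, with constant growing like \<open>(M / n)\<^sup>2\<close>, and the blocks are summable because \<open>r > 1\<close>.

  The spans of the spherical harmonics are identified by counting: the \<open>(n + 1)\<^sup>2\<close> orthonormal functions of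
  degree at most \<open>n\<close> exhaust, by dimension, the restrictions of all polynomials of degree at most \<open>n\<close>.
  Rotation invariance of the kernels and the addition theorem follow from this.\<close>

section \<open>Surface measure\<close>

text \<open>The rules are controlled only up to degree \<open>n\<close>, while \<open>f\<close> has
  components of every degree. Bounding the discrete norm of its remainder by the sup norm would lose
  a full power of \<open>n\<close>: the remainder is of order n^(1-r) uniformly, but n^(-r) in L2.
  The upper bound beyond degree \<open>n\<close> recovers that power. The factor obtained is the
  square root of (1+\<eta>)/(1-\<eta>). The numerator measures how the nodes see the remainder, the
  denominator how coefficients are recovered from nodes. The function \<open>rho\<close> arises from
  Cauchy--Schwarz over the low degrees. The kernel is merely integrable, so approximating it by
  polynomials gives no pointwise control. The Funk--Hecke formula is instead deduced from the
  equality of two measures on the line, tested on characteristic functions. All solutions are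
  definite descriptions, so every closed form for them rests on an existence and uniqueness
  proof.\<close>

abbreviation "\<omega> \<equiv> surface_measure"

interpretation surface: finite_measure \<omega>
  by standard (simp add: emeasure_surface_measure_S2)

lemma measure_surface_S2: "measure \<omega> S2 = 4 * pi"
  by (simp add: measure_def emeasure_surface_measure_S2)

lemma borel_measurable_surface_continuous:
  fixes f :: "real ^ 3 \<Rightarrow> real"
  assumes "continuous_on S2 f" shows "f \<in> borel_measurable \<omega>"
  using borel_measurable_continuous_on_restrict[OF assms]
  by (simp cong: measurable_cong_sets)

lemma continuous_on_S2_bounded:
  fixes f :: "real ^ 3 \<Rightarrow> real"
  assumes "continuous_on S2 f"
  obtains B where "B > 0" "\<And>x. x \<in> S2 \<Longrightarrow> \<bar>f x\<bar> \<le> B"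
proof -
  have "bounded (f ` S2)"
    by (intro compact_imp_bounded compact_continuous_image assms compact_sphere)
  then obtain B where "B > 0" "\<And>y. y \<in> f ` S2 \<Longrightarrow> norm y \<le> B"
    using bounded_pos by metis
  then show ?thesis using that by fastforce
qed

lemma integrable_surface_continuous [intro]:
  fixes f :: "real ^ 3 \<Rightarrow> real"
  assumes "continuous_on S2 f" shows "integrable \<omega> f"
proof -
  obtain B where B: "\<And>x. x \<in> S2 \<Longrightarrow> \<bar>f x\<bar> \<le> B" by (rule continuous_on_S2_bounded[OF assms]) auto
  show ?thesis
    by (rule surface.integrable_const_bound[where B=B])
       (use B borel_measurable_surface_continuous[OF assms] in auto)
qed

lemma surface_distr:
  fixes f :: "real ^ 3 \<Rightarrow> real"
  assumes f: "f \<in> borel_measurable \<omega>" and nn: "\<And>x. x \<in> S2 \<Longrightarrow> 0 \<le> f x"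
  shows "(\<integral>\<^sup>+x. f x \<partial>\<omega>) = 3 * (\<integral>\<^sup>+y. ennreal (f (sgn y)) * indicator (cball 0 1 - {0}) y \<partial>lborel)"
proof -
  have f': "f \<in> borel_measurable (restrict_space borel S2)"
    using f by (simp cong: measurable_cong_sets)
  show ?thesis
    unfolding surface_measure_def
    by (subst nn_integral_scale_measure, use f' in simp)
       (subst nn_integral_distr[OF measurable_sgn_S2], use f' in simp,
        subst nn_integral_restrict_space, auto)
qed

section \<open>Rotation invariance of the surface measure\<close>

lemma lborel_distr_orthogonal:
  fixes h :: "real ^ 3 \<Rightarrow> real ^ 3"
  assumes h: "orthogonal_transformation h"
  shows "distr lborel borel h = lborel"
proof (rule lborel_eqI[symmetric])
  have hm: "h \<in> borel_measurable borel"
    using h by (intro borel_measurable_continuous_onI linear_continuous_on)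
      (simp add: linear_conv_bounded_linear[symmetric] orthogonal_transformation_linear)
  then show "sets (distr lborel borel h) = sets borel" by simp
  fix l u :: "real ^ 3" assume lu: "\<And>b. b \<in> Basis \<Longrightarrow> l \<bullet> b \<le> u \<bullet> b"
  let ?g = "inv h"
  have g: "orthogonal_transformation ?g" using h by (rule orthogonal_transformation_inv)
  have bij: "bij h" using h by (rule orthogonal_transformation_bij)
  have vim: "h -` box l u = ?g ` box l u" using bij by (simp add: bij_vimage_eq_inv_image)
  have box: "box l u \<in> lmeasurable" by simp
  have im: "?g ` box l u \<in> lmeasurable" "measure lebesgue (?g ` box l u) = measure lebesgue (box l u)"
    using measurable_orthogonal_image[OF g box] measure_orthogonal_image[OF g box] by auto
  have bs: "h -` box l u \<in> sets borel" using measurable_sets[OF hm, of "box l u"] by simp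
  have "emeasure (distr lborel borel h) (box l u) = emeasure lborel (h -` box l u)"
    using hm by (subst emeasure_distr) auto
  \<comment> \<open>The image formula for orthogonal maps concerns Lebesgue measure, with which
    \<open>lborel\<close> agrees on Borel sets.\<close>
  also have "\<dots> = emeasure lebesgue (h -` box l u)" using bs by simp
  also have "\<dots> = ennreal (measure lebesgue (h -` box l u))"
    unfolding vim by (rule emeasure_eq_measure2[OF im(1)])
  also have "\<dots> = ennreal (measure lebesgue (box l u))" unfolding vim im(2) ..
  also have "\<dots> = emeasure lebesgue (box l u)" by (rule emeasure_eq_measure2[OF box, symmetric])
  also have "\<dots> = emeasure lborel (box l u)" by simp
  finally show "emeasure (distr lborel borel h) (box l u) = (\<Prod>b\<in>Basis. (u - l) \<bullet> b)"
    using lu by (simp add: emeasure_lborel_box)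
qed

lemma continuous_on_S2_orthogonal:
  fixes f :: "real ^ 3 \<Rightarrow> real"
  assumes h: "orthogonal_transformation h" and f: "continuous_on S2 f"
  shows "continuous_on S2 (\<lambda>y. f (h y))"
proof (rule continuous_on_compose2[OF f])
  show "continuous_on S2 h"
    using h by (intro linear_continuous_on)
      (simp add: linear_conv_bounded_linear[symmetric] orthogonal_transformation_linear)
  show "h ` S2 \<subseteq> S2" using h by (auto simp: orthogonal_transformation_norm)
qed

text \<open>An orthogonal map commutes with \<open>sgn\<close> and preserves the punctured ball, so
  the invariance of volume descends to the sphere through the cone construction.\<close>

lemma nn_integral_surface_orthogonal:
  fixes f :: "real ^ 3 \<Rightarrow> real"
  assumes h: "orthogonal_transformation h" and f: "continuous_on S2 f" and nn: "\<And>x. x \<in> S2 \<Longrightarrow> 0 \<le> f x"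
  shows "(\<integral>\<^sup>+x. f (h x) \<partial>\<omega>) = (\<integral>\<^sup>+x. f x \<partial>\<omega>)"
proof -
  let ?B = "cball 0 1 - {0} :: (real ^ 3) set"
  have lin: "linear h" using h by (rule orthogonal_transformation_linear)
  have hm: "h \<in> borel_measurable borel"
    using lin by (intro borel_measurable_continuous_onI linear_continuous_on)
      (simp add: linear_conv_bounded_linear[symmetric])
  have sg: "sgn (h y) = h (sgn y)" for y
    using lin h by (simp add: sgn_div_norm orthogonal_transformation_norm linear_cmul)
  have "h y \<in> ?B \<longleftrightarrow> y \<in> ?B" for y
    using orthogonal_transformation_norm[OF h, of y] by (metis Diff_iff mem_cball_0 norm_eq_zero singleton_iff)
  then have indB: "indicator ?B (h y) = (indicator ?B y :: ennreal)" for y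
    by (simp only: indicator_def)
  have fs: "(\<lambda>y. ennreal (f (sgn y)) * indicator ?B y) \<in> borel_measurable borel"
  proof -
    have "(\<lambda>y. f (sgn y)) \<in> borel_measurable (restrict_space lborel ?B)"
      by (rule measurable_compose[OF measurable_sgn_S2])
         (rule borel_measurable_continuous_on_restrict[OF f])
    then have "(\<lambda>y. ennreal (f (sgn y))) \<in> borel_measurable (restrict_space lborel ?B)" by simp
    then show ?thesis
      by (subst (asm) borel_measurable_restrict_space_iff_ennreal) auto
  qed
  have "(\<integral>\<^sup>+x. f (h x) \<partial>\<omega>) = 3 * (\<integral>\<^sup>+y. ennreal (f (h (sgn y))) * indicator ?B y \<partial>lborel)"
    by (rule surface_distr) (use h f nn continuous_on_S2_orthogonal borel_measurable_surface_continuous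
        orthogonal_transformation_norm in \<open>auto simp: orthogonal_transformation_norm\<close>)
  also have "(\<integral>\<^sup>+y. ennreal (f (h (sgn y))) * indicator ?B y \<partial>lborel) =
     (\<integral>\<^sup>+y. ennreal (f (sgn (h y))) * indicator ?B (h y) \<partial>lborel)"
    by (simp add: sg indB)
  also have "\<dots> = (\<integral>\<^sup>+y. ennreal (f (sgn y)) * indicator ?B y \<partial>distr lborel borel h)"
    by (subst nn_integral_distr) (use hm fs in auto)
  also have "\<dots> = (\<integral>\<^sup>+y. ennreal (f (sgn y)) * indicator ?B y \<partial>lborel)"
    by (simp add: lborel_distr_orthogonal[OF h])
  also have "3 * \<dots> = (\<integral>\<^sup>+x. f x \<partial>\<omega>)"
    by (rule surface_distr[symmetric]) (use f nn borel_measurable_surface_continuous in auto)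
  finally show ?thesis .
qed

lemma integral_surface_orthogonal:
  fixes f :: "real ^ 3 \<Rightarrow> real"
  assumes h: "orthogonal_transformation h" and f: "continuous_on S2 f"
  shows "(LINT x|\<omega>. f (h x)) = (LINT x|\<omega>. f x)"
proof -
  obtain B where B: "\<And>x. x \<in> S2 \<Longrightarrow> \<bar>f x\<bar> \<le> B" by (rule continuous_on_S2_bounded[OF f]) auto
  \<comment> \<open>Shifting by the bound \<open>B\<close> makes the integrand nonnegative; the same
    constant drops out on both sides at the end.\<close>
  have c: "continuous_on S2 (\<lambda>x. f x + B)" by (intro continuous_intros f)
  have nn: "0 \<le> f x + B" if "x \<in> S2" for x using B[OF that] by linarith
  have c': "continuous_on S2 (\<lambda>x. f (h x) + B)"
    using continuous_on_S2_orthogonal[OF h c] by simp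
  have nn': "0 \<le> f (h x) + B" if "x \<in> S2" for x
    using nn[of "h x"] that h by (simp add: orthogonal_transformation_norm)
  have "(LINT x|\<omega>. f (h x) + B) = (LINT x|\<omega>. f x + B)"
    using nn_integral_surface_orthogonal[OF h c nn]
    by (subst (1 2) integral_eq_nn_integral)
       (use c c' nn nn' borel_measurable_surface_continuous in auto)
  then show ?thesis
    using integrable_surface_continuous[OF f]
      integrable_surface_continuous[OF continuous_on_S2_orthogonal[OF h f]]
    by simp
qed

text \<open>The open cone over \<open>U\<close> inside the unit ball is an open set containing
  \<open>a\<close> / 2, so it has positive volume.\<close>

lemma emeasure_surface_open:
  assumes U: "open U" and a: "a \<in> U" "a \<in> S2"
  shows "emeasure \<omega> (U \<inter> S2) > 0"
proof -
  let ?B = "cball 0 1 - {0} :: (real ^ 3) set"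
  have s: "U \<inter> S2 \<in> sets \<omega>" using U by (auto simp: sets_restrict_space)
  let ?V = "{y \<in> ball 0 1 - {0}. sgn y \<in> U}"
  have V: "open ?V"
  proof -
    have "continuous_on (ball 0 1 - {0} :: (real ^ 3) set) sgn"
      unfolding sgn_div_norm by (intro continuous_intros) auto
    then have "open ((ball 0 1 - {0}) \<inter> sgn -` U)"
      by (rule continuous_open_preimage) (use U in \<open>auto intro: open_delete\<close>)
    then show ?thesis by (auto simp: vimage_def Int_def)
  qed
  have "sgn ((1/2) *\<^sub>R a) = a" "norm ((1/2) *\<^sub>R a) = 1/2" "a \<noteq> 0"
    using a by (auto simp: sgn_div_norm)
  then have "(1/2) *\<^sub>R a \<in> ?V" using a by (simp only: mem_Collect_eq) simp
  then have "\<not> negligible ?V" using open_not_negligible[OF V] by blast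
  moreover have "emeasure lebesgue ?V = emeasure lborel ?V"
    using borel_open[OF V] by simp
  moreover have "?V \<in> sets lebesgue" using borel_open[OF V] by simp
  ultimately have pos: "emeasure lborel ?V > 0"
    unfolding negligible_iff_null_sets null_sets_def mem_Collect_eq[of ?V]
    by (metis (no_types, lifting) mem_Collect_eq zero_less_iff_neq_zero)
  have "emeasure lborel ?V \<le> emeasure lborel (sgn -` (U \<inter> S2) \<inter> ?B)"
  proof (rule emeasure_mono)
    show "?V \<subseteq> sgn -` (U \<inter> S2) \<inter> ?B" by (auto simp: norm_sgn)
    have "sgn -` (U \<inter> S2) \<inter> space (restrict_space lborel ?B) \<in> sets (restrict_space lborel ?B)"
      by (rule measurable_sets[OF measurable_sgn_S2]) (use s in simp)
    then show "sgn -` (U \<inter> S2) \<inter> ?B \<in> sets lborel"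
      by (subst (asm) sets_restrict_space_iff) (auto simp: space_restrict_space)
  qed
  also have "\<dots> = emeasure (restrict_space lborel ?B) (sgn -` (U \<inter> S2) \<inter> ?B)"
    by (rule emeasure_restrict_space[symmetric]) auto
  finally have "emeasure (restrict_space lborel ?B) (sgn -` (U \<inter> S2) \<inter> ?B) > 0"
    using pos by order
  then show ?thesis
    unfolding surface_measure_def using s
    by (simp add: emeasure_distr[OF measurable_sgn_S2] space_restrict_space ennreal_zero_less_mult_iff)
qed

text \<open>Turns L2 identities into identities at every point, which the schemes need because they
  sample functions at nodes. A nonzero value would persist on a relatively open set of positive
  measure.\<close>

lemma continuous_surface_integral_zero:
  fixes v :: "real ^ 3 \<Rightarrow> real"
  assumes c: "continuous_on S2 v" and z: "(LINT x|\<omega>. (v x)\<^sup>2) = 0" and a: "a \<in> S2"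
  shows "v a = 0"
proof (rule ccontr)
  assume na: "v a \<noteq> 0"
  have "AE x in \<omega>. (v x)\<^sup>2 = 0"
    using z by (subst (asm) integral_nonneg_eq_0_iff_AE)
      (use c in \<open>auto intro!: integrable_surface_continuous continuous_intros\<close>)
  then have ae: "AE x in \<omega>. v x = 0" by simp
  have "openin (top_of_set S2) (S2 \<inter> v -` (- {0}))"
    by (rule continuous_openin_preimage_gen[OF c]) auto
  then obtain U where U: "open U" "S2 \<inter> v -` (- {0}) = U \<inter> S2"
    by (metis openin_open Int_commute)
  have aU: "a \<in> U" using U(2) na a by blast
  have "emeasure \<omega> (U \<inter> S2) = 0"
  proof -
    have "U \<inter> S2 = {x \<in> space \<omega>. v x \<noteq> 0}" unfolding U(2)[symmetric] by auto
    moreover have "U \<inter> S2 \<in> sets \<omega>" using U(1) by (auto simp: sets_restrict_space)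
    ultimately show ?thesis using ae AE_iff_measurable[of "U \<inter> S2" \<omega> "\<lambda>x. v x = 0"] by simp
  qed
  then show False using emeasure_surface_open[OF U(1) aU a] by simp
qed

section \<open>Polynomials on the sphere\<close>

text \<open>The restriction e <= 1 is a normal form modulo the equation of the sphere and keeps the
  generators few enough for the dimension count. The rule \<open>cong\<close> makes membership
  depend on values on the sphere only.\<close>

inductive_set sph_poly :: "nat \<Rightarrow> (real ^ 3 \<Rightarrow> real) set" for n where
  mono: "a + b + e \<le> n \<Longrightarrow> e \<le> 1 \<Longrightarrow> (\<lambda>x. (x $ 1) ^ a * (x $ 2) ^ b * (x $ 3) ^ e) \<in> sph_poly n"
| add: "f \<in> sph_poly n \<Longrightarrow> g \<in> sph_poly n \<Longrightarrow> (\<lambda>x. f x + g x) \<in> sph_poly n"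
| scale: "f \<in> sph_poly n \<Longrightarrow> (\<lambda>x. c * f x) \<in> sph_poly n"
| cong: "f \<in> sph_poly n \<Longrightarrow> (\<And>x. x \<in> S2 \<Longrightarrow> g x = f x) \<Longrightarrow> g \<in> sph_poly n"

lemma sph_poly_mono: "f \<in> sph_poly n \<Longrightarrow> n \<le> m \<Longrightarrow> f \<in> sph_poly m"
  by (induction rule: sph_poly.induct) (auto intro: sph_poly.intros)

lemma sph_poly_const: "(\<lambda>x. c) \<in> sph_poly n"
  using sph_poly.scale[OF sph_poly.mono[of 0 0 0 n], of c] by simp

lemma sph_poly_diff:
  "f \<in> sph_poly n \<Longrightarrow> g \<in> sph_poly n \<Longrightarrow> (\<lambda>x. f x - g x) \<in> sph_poly n"
  using sph_poly.add[of f n "\<lambda>x. (-1) * g x"] sph_poly.scale[of g n "-1"] by simp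

lemma sph_poly_sum:
  "(\<And>i. i \<in> I \<Longrightarrow> f i \<in> sph_poly n) \<Longrightarrow> (\<lambda>x. \<Sum>i\<in>I. f i x) \<in> sph_poly n"
  by (induction I rule: infinite_finite_induct) (auto intro: sph_poly_const sph_poly.add)

lemma sph_poly_coord: "(\<lambda>x. x $ i) \<in> sph_poly 1"
  using sph_poly.mono[of 1 0 0 1] sph_poly.mono[of 0 1 0 1] sph_poly.mono[of 0 0 1 1] exhaust_3[of i]
  by auto

lemma sph_poly_continuous: "f \<in> sph_poly n \<Longrightarrow> continuous_on S2 f"
proof (induction rule: sph_poly.induct)
  case (cong f g)
  then show ?case using continuous_on_cong by (metis (no_types, lifting))
qed (intro continuous_intros; assumption?)+

lemma S2_coords: "x \<in> S2 \<Longrightarrow> (x $ 1)\<^sup>2 + (x $ 2)\<^sup>2 + (x $ 3)\<^sup>2 = 1"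
  by (simp add: norm_vec_def L2_set_def sum_3 real_sqrt_eq_1_iff)

lemma sph_poly_mult:
  assumes f: "f \<in> sph_poly n" and g: "g \<in> sph_poly m"
  shows "(\<lambda>x. f x * g x) \<in> sph_poly (n + m)"
  using f
proof (induction rule: sph_poly.induct)
  case (mono a b e)
  note m1 = mono
  from g show ?case
  proof (induction rule: sph_poly.induct)
    case (mono a' b' e')
    show ?case
    proof (cases "e + e' \<le> 1")
      case True
      have "(\<lambda>x. (x $ 1) ^ (a + a') * (x $ 2) ^ (b + b') * (x $ 3) ^ (e + e')) \<in> sph_poly (n + m)"
        by (rule sph_poly.mono) (use True mono m1 in auto)
      then show ?thesis by (simp add: power_add mult_ac)
    next
      case False
      \<comment> \<open>The product leaves the normal form only here. The square of the third
        coordinate is replaced by 1 minus the other two squares, which does not raise the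
        degree.\<close>
      then have e: "e = 1" "e' = 1" using mono m1 by auto
      let ?m = "\<lambda>i j (x :: real ^ 3). (x $ 1) ^ i * (x $ 2) ^ j * (x $ 3) ^ 0"
      have "(\<lambda>x. ?m (a + a') (b + b') x - ?m (a + a' + 2) (b + b') x - ?m (a + a') (b + b' + 2) x)
          \<in> sph_poly (n + m)"
        by (intro sph_poly_diff sph_poly.mono) (use e mono m1 in auto)
      then show ?thesis
      proof (rule sph_poly.cong)
        fix x :: "real ^ 3" assume "x \<in> S2"
        then have z: "x $ 3 * x $ 3 = 1 - x $ 1 * x $ 1 - x $ 2 * x $ 2"
          using S2_coords[of x] by (simp add: power2_eq_square)
        have "(x $ 1) ^ a * (x $ 2) ^ b * (x $ 3) ^ e * ((x $ 1) ^ a' * (x $ 2) ^ b' * (x $ 3) ^ e') =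
           (x $ 1) ^ a * (x $ 2) ^ b * ((x $ 1) ^ a' * (x $ 2) ^ b') * (x $ 3 * x $ 3)"
          by (simp add: e mult_ac)
        then show "(x $ 1) ^ a * (x $ 2) ^ b * (x $ 3) ^ e * ((x $ 1) ^ a' * (x $ 2) ^ b' * (x $ 3) ^ e') =
            ?m (a + a') (b + b') x - ?m (a + a' + 2) (b + b') x - ?m (a + a') (b + b' + 2) x"
          unfolding z by (simp add: power_add algebra_simps power2_eq_square)
      qed
    qed
  next
    case (add f g) then show ?case by (simp add: distrib_left sph_poly.add)
  next
    case (scale f c) then show ?case using sph_poly.scale[of _ "n + m" c] by (simp add: mult.left_commute)
  next
    case (cong f g) then show ?case by (auto intro: sph_poly.cong)
  qed
next
  case (add f g) then show ?case by (simp add: distrib_right sph_poly.add)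
next
  case (scale f c) then show ?case using sph_poly.scale[of _ "n + m" c] by (simp add: mult.assoc)
next
  case (cong f g) then show ?case by (auto intro: sph_poly.cong)
qed

lemma sph_poly_power: "f \<in> sph_poly n \<Longrightarrow> (\<lambda>x. f x ^ k) \<in> sph_poly (k * n)"
  by (induction k) (auto intro: sph_poly_const sph_poly_mult)

lemma sph_poly_inner: "(\<lambda>y. x \<bullet> y) \<in> sph_poly 1" for x :: "real ^ 3"
proof -
  have "(\<lambda>y. \<Sum>i\<in>UNIV. x $ i * y $ i) \<in> sph_poly 1"
    by (intro sph_poly_sum sph_poly.scale sph_poly_coord)
  then show ?thesis by (simp add: inner_vec_def)
qed

lemma sph_poly_linear:
  assumes "linear (h :: real ^ 3 \<Rightarrow> real)" shows "h \<in> sph_poly 1"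
proof -
  have "h = (\<lambda>y. adjoint h 1 \<bullet> y)"
  proof
    show "h y = adjoint h 1 \<bullet> y" for y
      using adjoint_works[OF assms, of y 1] by (simp add: inner_commute)
  qed
  then show ?thesis using sph_poly_inner by metis
qed

lemma sph_poly_poly: "degree p \<le> n \<Longrightarrow> (\<lambda>y. poly p (x \<bullet> y)) \<in> sph_poly n" for x :: "real ^ 3"
  unfolding poly_altdef
  by (intro sph_poly_sum sph_poly.scale)
     (rule sph_poly_mono[OF sph_poly_power[OF sph_poly_inner]], auto)

lemma sph_poly_orthogonal:
  assumes h: "orthogonal_transformation h" and f: "f \<in> sph_poly n"
  shows "(\<lambda>y. f (h y)) \<in> sph_poly n"
  using f
proof (induction rule: sph_poly.induct)
  case (mono a b e)
  have lin: "linear (\<lambda>y. h y $ i)" for i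
    using orthogonal_transformation_linear[OF h]
    by (auto simp: linear_iff)
  have "(\<lambda>y. (h y $ 1) ^ a * (h y $ 2) ^ b * (h y $ 3) ^ e) \<in> sph_poly (a * 1 + b * 1 + e * 1)"
    by (intro sph_poly_mult sph_poly_power sph_poly_linear lin)
  then show ?case by (rule sph_poly_mono) (use mono in simp)
next
  case (cong f g)
  then show ?case using h by (auto intro: sph_poly.cong simp: orthogonal_transformation_norm)
qed (auto intro: sph_poly.intros)

text \<open>The inductive notion of polynomial carries no degree; splitting into homogeneous parts
  recovers one. Letting the parts vanish beyond \<open>n\<close> allows sums and Cauchy products to
  be written over one common range.\<close>

lemma real_polynomial_function_graded:
  assumes "real_polynomial_function (p :: real ^ 3 \<Rightarrow> real)"
  shows "\<exists>n h. (\<forall>j>n. h j = (\<lambda>x. 0)) \<and> (\<forall>x. p x = (\<Sum>j\<le>n. h j x)) \<and>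
           (\<forall>j t x. h j (t *\<^sub>R x) = t ^ j * h j x) \<and> (\<forall>j. h j \<in> sph_poly j)"
  using assms
proof (induction rule: real_polynomial_function.induct)
  case (linear f)
  then have l: "linear f" by (simp add: bounded_linear.linear)
  show ?case
    by (rule exI[of _ 1], rule exI[of _ "\<lambda>j. if j = 1 then f else (\<lambda>x. 0)"])
       (use l sph_poly_linear[OF l] sph_poly_const in \<open>auto simp: linear_cmul\<close>)
next
  case (const c)
  show ?case
    by (rule exI[of _ 0], rule exI[of _ "\<lambda>j. if j = 0 then (\<lambda>x. c) else (\<lambda>x. 0)"])
       (use sph_poly_const in auto)
next
  case (add f g)
  then obtain n h n' h' where
    h: "\<forall>j>n. h j = (\<lambda>x. 0)" "\<forall>x. f x = (\<Sum>j\<le>n. h j x)"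
       "\<forall>j t x. h j (t *\<^sub>R x) = t ^ j * h j x" "\<forall>j. h j \<in> sph_poly j" and
    h': "\<forall>j>n'. h' j = (\<lambda>x. 0)" "\<forall>x. g x = (\<Sum>j\<le>n'. h' j x)"
       "\<forall>j t x. h' j (t *\<^sub>R x) = t ^ j * h' j x" "\<forall>j. h' j \<in> sph_poly j"
    by blast
  have "(\<Sum>j\<le>n. h j x) = (\<Sum>j\<le>max n n'. h j x)" for x
    by (rule sum.mono_neutral_left) (use h(1) in auto)
  moreover have "(\<Sum>j\<le>n'. h' j x) = (\<Sum>j\<le>max n n'. h' j x)" for x
    by (rule sum.mono_neutral_left) (use h'(1) in auto)
  ultimately show ?case
    by (intro exI[of _ "max n n'"] exI[of _ "\<lambda>j x. h j x + h' j x"])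
       (use h h' in \<open>auto simp: sum.distrib distrib_left intro: sph_poly.add\<close>)
next
  case (mult f g)
  then obtain n h n' h' where
    h: "\<forall>j>n. h j = (\<lambda>x. 0)" "\<forall>x. f x = (\<Sum>j\<le>n. h j x)"
       "\<forall>j t x. h j (t *\<^sub>R x) = t ^ j * h j x" "\<forall>j. h j \<in> sph_poly j" and
    h': "\<forall>j>n'. h' j = (\<lambda>x. 0)" "\<forall>x. g x = (\<Sum>j\<le>n'. h' j x)"
       "\<forall>j t x. h' j (t *\<^sub>R x) = t ^ j * h' j x" "\<forall>j. h' j \<in> sph_poly j"
    by blast
  let ?k = "\<lambda>j x. \<Sum>i\<le>j. h i x * h' (j - i) x"
  have "f x * g x = (\<Sum>j\<le>n + n'. ?k j x)" for x
  proof -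
    have "f x * g x = (\<Sum>(i,j)\<in>{..n} \<times> {..n'}. h i x * h' j x)"
      by (simp add: h(2) h'(2) sum_product sum.cartesian_product)
    \<comment> \<open>Pairs of the triangle outside the rectangle contribute nothing, because one of
      the two parts is zero there.\<close>
    also have "\<dots> = (\<Sum>(i,j)\<in>{(i,j). i + j \<le> n + n'}. h i x * h' j x)"
      by (rule sum.mono_neutral_left)
        (use h(1) h'(1) in \<open>auto intro: finite_subset[of _ "{..n+n'} \<times> {..n+n'}"],
          (metis linorder_not_le)+\<close>)
    also have "\<dots> = (\<Sum>j\<le>n + n'. ?k j x)"
      by (rule sum.triangle_reindex_eq)
    finally show ?thesis .
  qed
  moreover have "?k j = (\<lambda>x. 0)" if "j > n + n'" for j
  proof (intro ext sum.neutral ballI)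
    fix x i assume "i \<in> {..j}"
    then have "i > n \<or> j - i > n'" using that by auto
    then show "h i x * h' (j - i) x = 0" using h(1) h'(1) by auto
  qed
  moreover have "?k j (t *\<^sub>R x) = t ^ j * ?k j x" for j t x
    unfolding sum_distrib_left
  proof (rule sum.cong[OF refl])
    fix i assume "i \<in> {..j}"
    then have "t ^ j = t ^ i * t ^ (j - i)" by (simp flip: power_add)
    then show "h i (t *\<^sub>R x) * h' (j - i) (t *\<^sub>R x) = t ^ j * (h i x * h' (j - i) x)"
      by (simp add: h(3) h'(3))
  qed
  moreover have "?k j \<in> sph_poly j" for j
  proof (rule sph_poly_sum)
    fix i assume "i \<in> {..j}"
    then show "(\<lambda>x. h i x * h' (j - i) x) \<in> sph_poly j"
      using sph_poly_mult[of "h i" i "h' (j - i)" "j - i"] h(4) h'(4) by simp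
  qed
  ultimately show ?case by (intro exI[of _ "n + n'"] exI[of _ ?k]) simp
qed

text \<open>Along each ray both sides are polynomials in the scaling factor \<open>t\<close>, so
  homogeneity leaves only the part of \<open>p\<close> of degree \<open>l\<close>. The resulting
  degree bound feeds the dimension count.\<close>

lemma spherical_harmonic_sph_poly:
  assumes "spherical_harmonic l Y" shows "Y \<in> sph_poly l"
proof -
  obtain p where p: "real_polynomial_function p" "\<And>t x. p (t *\<^sub>R x) = t ^ l * p x" "\<And>x. x \<in> S2 \<Longrightarrow> Y x = p x"
    using assms unfolding spherical_harmonic_def by auto
  obtain n h where h: "\<forall>j>n. h j = (\<lambda>x. 0)" "\<And>x. p x = (\<Sum>j\<le>n. h j x)"
    "\<And>j t x. h j (t *\<^sub>R x) = t ^ j * h j x" "\<And>j. h j \<in> sph_poly j"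
    using real_polynomial_function_graded[OF p(1)] by auto
  have "p x = h l x" for x
  proof -
    have "poly (monom (p x) l) t = poly (\<Sum>j\<le>n. monom (h j x) j) t" for t
      using p(2)[of t x] h(2)[of "t *\<^sub>R x"] by (simp add: poly_sum poly_monom h(3) mult.commute)
    then have "monom (p x) l = (\<Sum>j\<le>n. monom (h j x) j)"
      using poly_eq_poly_eq_iff by blast
    then have "coeff (monom (p x) l) l = coeff (\<Sum>j\<le>n. monom (h j x) j) l" by simp
    also have "\<dots> = (\<Sum>j\<le>n. if j = l then h j x else 0)" by (simp add: coeff_sum)
    also have "\<dots> = h l x" using h(1) by (auto simp: not_le)
    finally show ?thesis by simp
  qed
  then show ?thesis using h(4)[of l] p(3) by (auto intro: sph_poly.cong)
qed

section \<open>Reproducing kernels\<close>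

definition ip :: "(real ^ 3 \<Rightarrow> real) \<Rightarrow> (real ^ 3 \<Rightarrow> real) \<Rightarrow> real" where
  "ip f g = (LINT x|\<omega>. f x * g x)"

lemma ip_commute: "ip f g = ip g f"
  by (simp add: ip_def mult.commute)

lemma ip_cong: "(\<And>x. x \<in> S2 \<Longrightarrow> f x = f' x) \<Longrightarrow> (\<And>x. x \<in> S2 \<Longrightarrow> g x = g' x) \<Longrightarrow> ip f g = ip f' g'"
  unfolding ip_def by (rule Bochner_Integration.integral_cong) auto

lemma ip_scale_right: "ip f (\<lambda>x. c * g x) = c * ip f g"
  unfolding ip_def by (simp add: mult.left_commute)

lemma ip_scale_left: "ip (\<lambda>x. c * g x) f = c * ip g f"
  using ip_scale_right ip_commute by metis

lemma ip_diff_right: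
  assumes "continuous_on S2 f" "continuous_on S2 g" "continuous_on S2 h"
  shows "ip f (\<lambda>x. g x - h x) = ip f g - ip f h"
  unfolding ip_def right_diff_distrib
  by (rule Bochner_Integration.integral_diff) (auto intro!: continuous_intros assms)

lemma ip_diff_left:
  assumes "continuous_on S2 f" "continuous_on S2 g" "continuous_on S2 h"
  shows "ip (\<lambda>x. g x - h x) f = ip g f - ip h f"
  using ip_diff_right[OF assms] by (simp add: ip_commute)

lemma ip_sum_right:
  assumes "continuous_on S2 f" "\<And>i. i \<in> I \<Longrightarrow> continuous_on S2 (g i)"
  shows "ip f (\<lambda>x. \<Sum>i\<in>I. g i x) = (\<Sum>i\<in>I. ip f (g i))"
  unfolding ip_def sum_distrib_left
  by (rule Bochner_Integration.integral_sum) (auto intro!: continuous_intros assms)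

lemma ip_sum_left:
  assumes "continuous_on S2 f" "\<And>i. i \<in> I \<Longrightarrow> continuous_on S2 (g i)"
  shows "ip (\<lambda>x. \<Sum>i\<in>I. g i x) f = (\<Sum>i\<in>I. ip (g i) f)"
  using ip_sum_right[OF assms] by (simp add: ip_commute)

lemma ip_zero_imp:
  assumes "continuous_on S2 f" "ip f f = 0" "x \<in> S2" shows "f x = 0"
  using continuous_surface_integral_zero[OF assms(1) _ assms(3)] assms(2)
  by (simp add: ip_def power2_eq_square)

lemma ip_nonneg: "0 \<le> ip f f"
  by (simp add: ip_def)

lemma l2_norm_ip: "(l2_norm f)\<^sup>2 = ip f f"
  using ip_nonneg[of f] unfolding l2_norm_def ip_def by (simp add: power2_eq_square)

lemma ip_orthogonal:
  assumes "orthogonal_transformation h" "continuous_on S2 f" "continuous_on S2 g"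
  shows "ip (\<lambda>y. f (h y)) (\<lambda>y. g (h y)) = ip f g"
  unfolding ip_def
  by (rule integral_surface_orthogonal[OF assms(1), where f = "\<lambda>x. f x * g x"])
     (intro continuous_intros assms)

section \<open>Dimension count for polynomials on the sphere\<close>

interpretation fs: vector_space "\<lambda>(c::real) (f :: real ^ 3 \<Rightarrow> real) x. c * f x"
  by standard (auto simp: fun_eq_iff algebra_simps)

lemma fs_sum_apply: "(\<Sum>i\<in>I. (f i :: real ^ 3 \<Rightarrow> real)) x = (\<Sum>i\<in>I. f i x)"
  by (induction I rule: infinite_finite_induct) auto

text \<open>On the sphere the third coordinate is needed to degree at most one, so polynomials of degree
  \<open>n\<close> restrict to a space of dimension at most \<open>(n+1)(n+2)/2 + n(n+1)/2 = (n+1)\<^sup>2\<close>.\<close>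

definition on_S2 :: "(real ^ 3 \<Rightarrow> real) \<Rightarrow> real ^ 3 \<Rightarrow> real" where
  "on_S2 f x = (if x \<in> S2 then f x else 0)"

text \<open>The square of pairs is folded into two triangles: pairs with i + j <= n give the
  monomials free of the third coordinate, the others, sent to (n - i, n - j) of total degree below
  n, those containing it once. The bound on the cardinality is then immediate.\<close>

definition sph_gens :: "nat \<Rightarrow> (real ^ 3 \<Rightarrow> real) set" where
  "sph_gens n = (\<lambda>(i,j). on_S2 (if i + j \<le> n then (\<lambda>x. (x $ 1) ^ i * (x $ 2) ^ j)
       else (\<lambda>x. (x $ 1) ^ (n - i) * (x $ 2) ^ (n - j) * x $ 3))) ` ({..n} \<times> {..n})"

lemma card_sph_gens: "finite (sph_gens n)" "card (sph_gens n) \<le> (n + 1)\<^sup>2"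
proof -
  show "finite (sph_gens n)" by (simp add: sph_gens_def)
  have "card (sph_gens n) \<le> card ({..n} \<times> {..n})" unfolding sph_gens_def by (rule card_image_le) simp
  then show "card (sph_gens n) \<le> (n + 1)\<^sup>2" by (simp add: card_cartesian_product power2_eq_square)
qed

lemma sph_poly_span: "f \<in> sph_poly n \<Longrightarrow> on_S2 f \<in> fs.span (sph_gens n)"
proof (induction rule: sph_poly.induct)
  case (mono a b e)
  show ?case
  proof (cases "e = 0")
    case True
    then have "on_S2 (\<lambda>x. (x $ 1) ^ a * (x $ 2) ^ b * (x $ 3) ^ e) \<in> sph_gens n"
      unfolding sph_gens_def using mono by (intro image_eqI[of _ _ "(a, b)"]) auto
    then show ?thesis by (rule fs.span_base)
  next
    case False
    then have "e = 1" using mono by simp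
    then have "on_S2 (\<lambda>x. (x $ 1) ^ a * (x $ 2) ^ b * (x $ 3) ^ e) \<in> sph_gens n"
      unfolding sph_gens_def using mono by (intro image_eqI[of _ _ "(n - a, n - b)"]) auto
    then show ?thesis by (rule fs.span_base)
  qed
next
  case (add f g)
  have "on_S2 (\<lambda>x. f x + g x) = on_S2 f + on_S2 g" by (auto simp: on_S2_def fun_eq_iff)
  then show ?case using fs.span_add[OF add.IH] by (simp only:)
next
  case (scale f c)
  have "on_S2 (\<lambda>x. c * f x) = (\<lambda>x. c * on_S2 f x)" by (auto simp: on_S2_def fun_eq_iff)
  then show ?case using fs.span_scale[OF scale.IH, of c] by simp
next
  case (cong f g)
  have "on_S2 g = on_S2 f" using cong by (auto simp: on_S2_def fun_eq_iff)
  then show ?case using cong by simp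
qed

definition idx :: "nat \<Rightarrow> (nat \<times> nat) set" where
  "idx n = Sigma {..n} (\<lambda>l. {1..2*l+1})"

lemma finite_idx [simp]: "finite (idx n)" by (simp add: idx_def)

lemma card_idx: "card (idx n) = (n + 1)\<^sup>2"
proof -
  have "(\<Sum>l\<le>n. 2 * l + 1) = (n + 1)\<^sup>2" by (induction n) (auto simp: power2_eq_square)
  then show ?thesis by (simp add: idx_def)
qed

lemma sum_idx: "(\<Sum>i\<in>idx n. f (fst i) (snd i)) = (\<Sum>l\<le>n. \<Sum>k=1..2*l+1. f l k)"
  unfolding idx_def by (subst sum.Sigma) (auto simp: case_prod_beta)

locale harmonic_basis =
  fixes Y :: "nat \<Rightarrow> nat \<Rightarrow> real ^ 3 \<Rightarrow> real"
  assumes onb: "harmonic_onb Y"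
begin

lemma Y_poly: "k \<in> {1..2*l+1} \<Longrightarrow> Y l k \<in> sph_poly l"
  using onb spherical_harmonic_sph_poly unfolding harmonic_onb_def by blast

lemma Y_continuous: "k \<in> {1..2*l+1} \<Longrightarrow> continuous_on S2 (Y l k)"
  using Y_poly sph_poly_continuous by blast

lemma Y_orthonormal:
  "k \<in> {1..2*l+1} \<Longrightarrow> j \<in> {1..2*m+1} \<Longrightarrow> ip (Y l k) (Y m j) = (if l = m \<and> k = j then 1 else 0)"
  using onb unfolding harmonic_onb_def ip_def by blast

definition YY :: "nat \<times> nat \<Rightarrow> real ^ 3 \<Rightarrow> real" where "YY i = Y (fst i) (snd i)"

lemma YY_poly: "i \<in> idx n \<Longrightarrow> YY i \<in> sph_poly n"
  unfolding YY_def idx_def by (auto intro!: sph_poly_mono[OF Y_poly])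

lemma YY_continuous: "i \<in> idx n \<Longrightarrow> continuous_on S2 (YY i)"
  using YY_poly sph_poly_continuous by blast

lemma YY_orthonormal: "i \<in> idx n \<Longrightarrow> j \<in> idx m \<Longrightarrow> ip (YY i) (YY j) = (if i = j then 1 else 0)"
  unfolding YY_def idx_def using Y_orthonormal by (auto simp: prod_eq_iff)

lemma ip_YY_sum:
  assumes "j \<in> idx m" shows "ip (YY j) (\<lambda>x. \<Sum>i\<in>idx n. c i * YY i x) = (if j \<in> idx n then c j else 0)"
proof -
  have "ip (YY j) (\<lambda>x. \<Sum>i\<in>idx n. c i * YY i x) = (\<Sum>i\<in>idx n. ip (YY j) (\<lambda>x. c i * YY i x))"
    by (rule ip_sum_right) (use YY_continuous[OF assms] YY_continuous in \<open>auto intro!: continuous_intros\<close>)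
  also have "\<dots> = (\<Sum>i\<in>idx n. if i = j then c i else 0)"
    by (rule sum.cong) (use YY_orthonormal[OF assms] in \<open>auto simp: ip_scale_right\<close>)
  also have "\<dots> = (if j \<in> idx n then c j else 0)" by (simp add: sum.delta')
  finally show ?thesis .
qed

text \<open>The (n + 1)^2 orthonormal functions are independent inside a space with at most that
  many generators; a function outside their span would give one independent vector too many. Passing
  to \<open>on_S2\<close> makes equality on the sphere an equality of vectors.\<close>

lemma sph_poly_expand_ex:
  assumes f: "f \<in> sph_poly n"
  shows "\<exists>c. \<forall>x\<in>S2. f x = (\<Sum>i\<in>idx n. c i * YY i x)"
proof -
  let ?\<Psi> = "\<lambda>i. on_S2 (YY i)"
  let ?B = "?\<Psi> ` idx n"
  have ipS: "ip (on_S2 f) (on_S2 g) = ip f g" for f g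
    by (rule ip_cong) (auto simp: on_S2_def)
  have inj: "inj_on ?\<Psi> (idx n)"
  proof (rule inj_onI)
    fix i j assume "i \<in> idx n" "j \<in> idx n" "?\<Psi> i = ?\<Psi> j"
    then show "i = j"
      using YY_orthonormal[of i n i n] YY_orthonormal[of i n j n] ipS[of "YY i" "YY i"] ipS[of "YY i" "YY j"]
      by (auto split: if_splits)
  qed
  have ind: "fs.independent ?B"
  proof (subst fs.dependent_finite, simp, safe)
    fix u i assume i: "i \<in> idx n" and nz: "u (?\<Psi> i) \<noteq> 0"
      and z: "(\<Sum>v\<in>?B. (\<lambda>x. u v * v x)) = 0"
    have "(\<Sum>j\<in>idx n. u (?\<Psi> j) * YY j x) = 0" if "x \<in> S2" for x
    proof -
      have "(\<Sum>j\<in>idx n. u (?\<Psi> j) * ?\<Psi> j x) = (\<Sum>v\<in>?B. (\<lambda>x. u v * v x)) x"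
        unfolding fs_sum_apply by (subst sum.reindex[OF inj]) simp
      then show ?thesis using that z by (simp add: on_S2_def)
    qed
    then have "ip (YY i) (\<lambda>x. \<Sum>j\<in>idx n. u (?\<Psi> j) * YY j x) = ip (YY i) (\<lambda>x. 0 * YY i x)"
      by (intro ip_cong) auto
    also have "\<dots> = 0" by (subst ip_scale_right) simp
    finally show False using nz i by (simp add: ip_YY_sum[OF i])
  qed
  have "on_S2 f \<in> fs.span ?B"
  proof (rule ccontr)
    assume n: "on_S2 f \<notin> fs.span ?B"
    then have "fs.independent (insert (on_S2 f) ?B)" using ind fs.independent_insertI by blast
    moreover have "insert (on_S2 f) ?B \<subseteq> fs.span (sph_gens n)"
      using f YY_poly sph_poly_span by blast
    ultimately have "card (insert (on_S2 f) ?B) \<le> card (sph_gens n)"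
      using fs.independent_span_bound[OF card_sph_gens(1)] by blast
    moreover have "on_S2 f \<notin> ?B" using n fs.span_base[of "on_S2 f" ?B] by argo
    ultimately show False
      using card_sph_gens(2)[of n] card_image[OF inj] card_idx[of n] by simp
  qed
  then obtain u where u: "on_S2 f = (\<Sum>v\<in>?B. (\<lambda>x. u v * v x))"
    by (auto simp: fs.span_finite)
  have "f x = (\<Sum>j\<in>idx n. u (?\<Psi> j) * YY j x)" if "x \<in> S2" for x
  proof -
    have "f x = on_S2 f x" using that by (simp add: on_S2_def)
    also have "\<dots> = (\<Sum>j\<in>idx n. u (?\<Psi> j) * ?\<Psi> j x)"
      unfolding u fs_sum_apply by (subst sum.reindex[OF inj]) simp
    finally show ?thesis using that by (simp add: on_S2_def)
  qed
  then show ?thesis by (intro exI[of _ "\<lambda>j. u (?\<Psi> j)"]) simp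
qed

lemma sph_poly_expand:
  assumes f: "f \<in> sph_poly n" and x: "x \<in> S2"
  shows "f x = (\<Sum>i\<in>idx n. ip (YY i) f * YY i x)"
proof -
  obtain c where c: "\<And>x. x \<in> S2 \<Longrightarrow> f x = (\<Sum>i\<in>idx n. c i * YY i x)"
    using sph_poly_expand_ex[OF f] by blast
  have "ip (YY j) f = c j" if "j \<in> idx n" for j
    using ip_YY_sum[OF that, of c n] that ip_cong[of "YY j" "YY j" f, OF refl c] by simp
  then show ?thesis using c[OF x] by simp
qed

definition ker :: "nat \<Rightarrow> real ^ 3 \<Rightarrow> real ^ 3 \<Rightarrow> real" where
  "ker n x y = (\<Sum>i\<in>idx n. YY i x * YY i y)"

lemma ker_commute: "ker n x y = ker n y x"
  by (simp add: ker_def mult.commute)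

lemma ker_poly: "ker n x \<in> sph_poly n"
  unfolding ker_def[abs_def] by (intro sph_poly_sum sph_poly.scale YY_poly)

lemma ker_continuous: "continuous_on S2 (ker n x)"
  using ker_poly sph_poly_continuous by blast

lemma ker_reproducing:
  assumes f: "f \<in> sph_poly n" and x: "x \<in> S2" shows "ip (ker n x) f = f x"
proof -
  have "ip (ker n x) f = (\<Sum>i\<in>idx n. ip (\<lambda>y. YY i x * YY i y) f)"
    unfolding ker_def[abs_def]
    by (rule ip_sum_left) (auto intro!: continuous_intros sph_poly_continuous[OF f] YY_continuous)
  also have "\<dots> = f x"
    unfolding sph_poly_expand[OF f x] ip_scale_left by (simp add: mult.commute)
  finally show ?thesis .
qed

text \<open>The polynomial space and the inner product are both invariant under \<open>h\<close>.
  The kernel is reproduced once in each variable, with \<open>h\<close> moved across the inner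
  product in between.\<close>

lemma ker_orthogonal:
  assumes h: "orthogonal_transformation h" and x: "x \<in> S2" and y: "y \<in> S2"
  shows "ker n (h x) (h y) = ker n x y"
proof -
  let ?g = "inv h"
  have g: "orthogonal_transformation ?g" using h by (rule orthogonal_transformation_inv)
  have gh: "?g (h z) = z" for z using h by (simp add: orthogonal_transformation_inj)
  have hx: "h x \<in> S2" using h x by (simp add: orthogonal_transformation_norm)
  have "ker n (h x) (h y) = ip (ker n y) (\<lambda>z. ker n (h x) (h z))"
    by (rule ker_reproducing[symmetric, OF sph_poly_orthogonal[OF h ker_poly] y])
  also have "\<dots> = ip (\<lambda>z. ker n (h x) (h z)) (\<lambda>z. ker n y (?g (h z)))"
    by (simp add: gh ip_commute)
  also have "\<dots> = ip (ker n (h x)) (\<lambda>z. ker n y (?g z))"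
    by (rule ip_orthogonal[OF h ker_continuous continuous_on_S2_orthogonal[OF g ker_continuous]])
  also have "\<dots> = ker n y (?g (h x))"
    by (rule ker_reproducing[OF sph_poly_orthogonal[OF g ker_poly] hx])
  also have "\<dots> = ker n x y" by (simp add: gh ker_commute)
  finally show ?thesis .
qed

end

text \<open>Householder reflection. For v = 0 the division by zero yields the identity, so that
  \<open>reflect_swap\<close> also covers equal points.\<close>

definition reflect :: "real ^ 3 \<Rightarrow> real ^ 3 \<Rightarrow> real ^ 3" where
  "reflect v z = z - (2 * (v \<bullet> z) / (v \<bullet> v)) *\<^sub>R v"

lemma reflect_orthogonal: "orthogonal_transformation (reflect v)"
proof (cases "v = 0")
  case True
  then have "reflect v = (\<lambda>z. z)" by (simp add: reflect_def fun_eq_iff)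
  then show ?thesis by (simp add: orthogonal_transformation_def linear_ident)
next
  case False
  have "linear (reflect v)"
    unfolding reflect_def by (rule linearI) (auto simp: algebra_simps inner_simps add_divide_distrib)
  moreover have "reflect v a \<bullet> reflect v b = a \<bullet> b" for a b
    using False by (simp add: reflect_def inner_simps field_simps inner_commute)
  ultimately show ?thesis by (simp add: orthogonal_transformation_def)
qed

lemma reflect_swap: "norm a = norm b \<Longrightarrow> reflect (a - b) a = b"
proof (cases "a = b")
  case False
  assume "norm a = norm b"
  then have e: "a \<bullet> a = b \<bullet> b" by (simp add: norm_eq)
  have "2 * ((a - b) \<bullet> a) = (a - b) \<bullet> (a - b)" by (simp add: inner_simps e inner_commute)
  moreover have "(a - b) \<bullet> (a - b) \<noteq> 0" using False by simp
  ultimately show ?thesis by (simp add: reflect_def)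
qed (simp add: reflect_def)

text \<open>The first reflection sends \<open>x\<close> to \<open>x'\<close>. The second corrects
  the image of \<open>y\<close>; it fixes \<open>x'\<close> because equal inner products make
  \<open>x'\<close> orthogonal to the vector that defines it.\<close>

lemma two_point_homogeneous:
  assumes "x \<in> S2" "y \<in> S2" "x' \<in> S2" "y' \<in> S2" and e: "x \<bullet> y = x' \<bullet> y'"
  obtains h where "orthogonal_transformation h" "h x = x'" "h y = y'"
proof -
  let ?h = "reflect (x - x')"
  let ?y = "?h y"
  let ?k = "reflect (?y - y')"
  have hx: "?h x = x'" by (rule reflect_swap) (use assms in simp)
  have "x' \<bullet> ?y = x \<bullet> y"
    using reflect_orthogonal[of "x - x'"] hx unfolding orthogonal_transformation_def by metis
  then have "(?y - y') \<bullet> x' = 0" using e by (simp add: inner_simps inner_commute)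
  then have kx: "?k x' = x'" by (simp add: reflect_def)
  have "norm ?y = norm y'"
    using orthogonal_transformation_norm[OF reflect_orthogonal] assms by simp
  then have ky: "?k ?y = y'" by (rule reflect_swap)
  have "orthogonal_transformation (?k \<circ> ?h)"
    using orthogonal_transformation_compose reflect_orthogonal by blast
  then show ?thesis using that[of "?k \<circ> ?h"] hx kx ky by simp
qed

context harmonic_basis
begin

lemma ker_eq:
  assumes "x \<in> S2" "y \<in> S2" "x' \<in> S2" "y' \<in> S2" "x \<bullet> y = x' \<bullet> y'"
  shows "ker n x y = ker n x' y'"
  using two_point_homogeneous[OF assms] ker_orthogonal assms by metis

text \<open>By invariance the diagonal is constant, and its integral counts the basis functions: the
  value is dimension over area.\<close>

lemma ker_diag:
  assumes x: "x \<in> S2" shows "ker n x x = (real n + 1)\<^sup>2 / (4 * pi)"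
proof -
  have "(LINT y|\<omega>. ker n y y) = (LINT y|\<omega>. ker n x x)"
    by (rule Bochner_Integration.integral_cong) (auto intro!: ker_eq x simp: dot_square_norm norm_eq_1[symmetric] x[simplified])
  also have "\<dots> = 4 * pi * ker n x x" by (simp add: measure_surface_S2)
  finally have "4 * pi * ker n x x = (LINT y|\<omega>. ker n y y)" ..
  also have "\<dots> = (\<Sum>i\<in>idx n. LINT y|\<omega>. YY i y * YY i y)"
    unfolding ker_def
    by (rule Bochner_Integration.integral_sum) (auto intro!: continuous_intros YY_continuous)
  also have "\<dots> = (\<Sum>i\<in>idx n. 1)"
    by (rule sum.cong) (use YY_orthonormal in \<open>auto simp: ip_def\<close>)
  also have "\<dots> = (real n + 1)\<^sup>2" by (simp add: card_idx)
  finally show ?thesis by (simp add: field_simps)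
qed

end

section \<open>Legendre polynomials and the addition theorem\<close>

definition moment :: "nat \<Rightarrow> real" where
  "moment m = (LINT y|\<omega>. (axis 1 1 \<bullet> y) ^ m)"

lemma moment_sphere:
  assumes "e \<in> S2" shows "(LINT y|\<omega>. (e \<bullet> y) ^ m) = moment m"
proof -
  have a: "axis 1 1 \<in> S2" by (simp add: norm_axis_1)
  let ?h = "reflect (axis 1 1 - e)"
  have h: "orthogonal_transformation ?h" "?h (axis 1 1) = e"
    using reflect_orthogonal reflect_swap[of "axis 1 1" e] a assms by auto
  have "moment m = (LINT y|\<omega>. (e \<bullet> ?h y) ^ m)"
    using h unfolding moment_def orthogonal_transformation_def by metis
  also have "\<dots> = (LINT y|\<omega>. (e \<bullet> y) ^ m)"
    by (rule integral_surface_orthogonal[OF h(1), where f = "\<lambda>y. (e \<bullet> y) ^ m"]) (intro continuous_intros)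
  finally show ?thesis ..
qed

lemma moment_scaled:
  assumes "a \<noteq> 0" shows "(LINT y|\<omega>. (a \<bullet> y) ^ m) = norm a ^ m * moment m"
proof -
  have "sgn a \<in> S2" using assms by (simp add: norm_sgn)
  then have "moment m = (LINT y|\<omega>. (sgn a \<bullet> y) ^ m)" by (rule moment_sphere[symmetric])
  moreover have "a \<bullet> y = norm a * (sgn a \<bullet> y)" for y
    using assms by (simp add: sgn_div_norm mult.assoc[symmetric])
  then have "(a \<bullet> y) ^ m = norm a ^ m * (sgn a \<bullet> y) ^ m" for y
    by (metis power_mult_distrib)
  ultimately show ?thesis by simp
qed

lemma moment_odd: "odd m \<Longrightarrow> moment m = 0"
proof -
  assume "odd m"
  have "(LINT y|\<omega>. (- axis 1 1 \<bullet> y) ^ m) = moment m"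
    by (rule moment_sphere) (simp add: norm_axis_1)
  then have "- moment m = moment m" using \<open>odd m\<close> by (simp add: moment_def)
  then show ?thesis by simp
qed

lemma moment_0: "moment 0 = 4 * pi"
  by (simp add: moment_def measure_surface_S2)

lemma coeff_one_plus_square: "coeff ([:1, 0, 1:] ^ h) 0 = (1::real)" "coeff ([:1, 0, 1:] ^ h) (Suc 0) = (0::real)"
  "coeff ([:1, 0, 1:] ^ h) 2 = real h"
  by (induction h) (auto simp: coeff_mult coeff_pCons numeral_2_eq_2 split: nat.split)

text \<open>Compare the coefficients of \<open>s\<^sup>2\<close> in
  \<open>\<integral> (y\<^sub>1 + s y\<^sub>k)\<^sup>2\<^sup>h = (1 + s\<^sup>2)\<^sup>h \<integral> y\<^sub>1\<^sup>2\<^sup>h\<close>.\<close>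

lemma mixed_moment:
  assumes k: "k \<noteq> 1" and h: "h > 0"
  shows "(LINT y|\<omega>. (y $ 1) ^ (2 * h - 2) * (y $ k)\<^sup>2) = moment (2 * h) / (2 * real h - 1)"
proof -
  let ?J = "\<lambda>j. LINT y|\<omega>. (y $ 1) ^ (2 * h - j) * (y $ k) ^ j"
  let ?p = "\<Sum>j\<le>2 * h. monom (real (2 * h choose j) * ?J j) j"
  have int: "integrable \<omega> (\<lambda>y. (y $ 1) ^ i * (y $ k) ^ j)" for i j
    by (intro integrable_surface_continuous continuous_intros)
  have "poly ?p s = poly (smult (moment (2 * h)) ([:1, 0, 1:] ^ h)) s" for s
  proof -
    let ?a = "axis 1 1 + s *\<^sub>R axis k 1 :: real ^ 3"
    have ay: "?a \<bullet> y = s * y $ k + y $ 1" for y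
      by (simp add: inner_simps inner_axis')
    have "?a \<bullet> ?a = 1 + s\<^sup>2"
      using k by (simp add: inner_simps inner_axis_axis power2_eq_square)
    then have na: "(norm ?a)\<^sup>2 = 1 + s\<^sup>2" by (simp only: power2_norm_eq_inner)
    then have nz: "?a \<noteq> 0" by (metis add_pos_nonneg norm_eq_zero power_zero_numeral zero_le_power2 zero_less_one less_irrefl)
    have "(LINT y|\<omega>. (?a \<bullet> y) ^ (2 * h)) = (1 + s\<^sup>2) ^ h * moment (2 * h)"
      unfolding moment_scaled[OF nz] power_mult[of "norm ?a"] na ..
    moreover have "(LINT y|\<omega>. (?a \<bullet> y) ^ (2 * h)) =
        (\<Sum>j\<le>2 * h. LINT y|\<omega>. real (2 * h choose j) * (s * y $ k) ^ j * (y $ 1) ^ (2 * h - j))"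
      unfolding ay binomial_ring
      by (rule Bochner_Integration.integral_sum) (intro integrable_surface_continuous continuous_intros)
    moreover have "\<dots> = poly ?p s"
      unfolding poly_sum poly_monom
    proof (rule sum.cong[OF refl])
      fix j
      have "(LINT y|\<omega>. real (2 * h choose j) * (s * y $ k) ^ j * (y $ 1) ^ (2 * h - j)) =
         (LINT y|\<omega>. (real (2 * h choose j) * s ^ j) * ((y $ 1) ^ (2 * h - j) * (y $ k) ^ j))"
        by (rule Bochner_Integration.integral_cong) (auto simp: power_mult_distrib)
      also have "\<dots> = (real (2 * h choose j) * s ^ j) * ?J j"
        by (rule integral_mult_right_zero)
      finally show "(LINT y|\<omega>. real (2 * h choose j) * (s * y $ k) ^ j * (y $ 1) ^ (2 * h - j)) =
         real (2 * h choose j) * ?J j * s ^ j" by (simp add: mult_ac)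
    qed
    ultimately show ?thesis by (simp add: power2_eq_square mult.commute)
  qed
  then have "?p = smult (moment (2 * h)) ([:1, 0, 1:] ^ h)" using poly_eq_poly_eq_iff by blast
  then have "coeff ?p 2 = moment (2 * h) * real h" by (simp add: coeff_one_plus_square)
  moreover have "coeff ?p 2 = (\<Sum>j\<le>2 * h. if j = 2 then real (2 * h choose j) * ?J j else 0)"
    by (simp add: coeff_sum)
  moreover have "\<dots> = real (2 * h choose 2) * ?J 2" using h by simp
  moreover have "real (2 * h choose 2) = real h * (2 * real h - 1)"
    using h by (simp add: choose_two of_nat_diff)
  ultimately have "real h * ((2 * real h - 1) * ?J 2) = real h * moment (2 * h)" by simp
  then have "(2 * real h - 1) * ?J 2 = moment (2 * h)" using h by simp
  moreover have "2 * real h - 1 > 0" using h by simp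
  ultimately show ?thesis by (simp add: field_simps)
qed

text \<open>Inserting 1 = y1^2 + y2^2 + y3^2 and evaluating the mixed moments gives (2h + 3) I(h +
  1) = (2h + 1) I(h), where I(h) is \<open>moment (2 * h)\<close>.\<close>

lemma moment_even: "moment (2 * h) = 4 * pi / (2 * real h + 1)"
proof (induction h)
  case 0 then show ?case by (simp add: moment_0)
next
  case (Suc h)
  let ?I = "moment (2 * Suc h)"
  have "moment (2 * h) = (LINT y|\<omega>. (y $ 1) ^ (2 * Suc h) + ((y $ 1) ^ (2 * Suc h - 2) * (y $ 2)\<^sup>2 + (y $ 1) ^ (2 * Suc h - 2) * (y $ 3)\<^sup>2))"
    unfolding moment_def
  proof (rule Bochner_Integration.integral_cong[OF refl])
    fix y :: "real ^ 3" assume "y \<in> space \<omega>"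
    then have "(y $ 1) ^ (2 * h) = (y $ 1) ^ (2 * h) * ((y $ 1)\<^sup>2 + (y $ 2)\<^sup>2 + (y $ 3)\<^sup>2)"
      using S2_coords by simp
    then show "(axis 1 1 \<bullet> y) ^ (2 * h) = (y $ 1) ^ (2 * Suc h) + ((y $ 1) ^ (2 * Suc h - 2) * (y $ 2)\<^sup>2 + (y $ 1) ^ (2 * Suc h - 2) * (y $ 3)\<^sup>2)"
      by (simp add: inner_axis' algebra_simps power2_eq_square)
  qed
  also have "\<dots> = (LINT y|\<omega>. (y $ 1) ^ (2 * Suc h)) + ((LINT y|\<omega>. (y $ 1) ^ (2 * Suc h - 2) * (y $ 2)\<^sup>2) +
      (LINT y|\<omega>. (y $ 1) ^ (2 * Suc h - 2) * (y $ 3)\<^sup>2))"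
    by (subst Bochner_Integration.integral_add;
        (subst Bochner_Integration.integral_add)?; (intro integrable_surface_continuous continuous_intros)?) simp
  also have "\<dots> = ?I + 2 * (?I / (2 * real (Suc h) - 1))"
    by (subst (1 2) mixed_moment) (auto simp: moment_def inner_axis')
  finally have "?I * (2 * real h + 3) = moment (2 * h) * (2 * real h + 1)"
    by (simp add: field_simps)
  then show ?case using Suc by (simp add: field_simps)
qed

section \<open>Polynomial integrals on the interval and Legendre polynomials\<close>

definition pint :: "real poly \<Rightarrow> real" where
  "pint p = (LINT t:{-1..1}|lborel. poly p t)"

lemma poly_set_integrable: "set_integrable lborel {-1..1} (\<lambda>t. poly p t :: real)"
  by (rule borel_integrable_atLeastAtMost') (intro continuous_intros)

lemma pint_add: "pint (p + q) = pint p + pint q"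
proof -
  have "poly (p + q) = (\<lambda>t. poly p t + poly q t)" by auto
  then show ?thesis
    unfolding pint_def by (simp only: set_integral_add(2)[OF poly_set_integrable poly_set_integrable])
qed

lemma pint_smult: "pint (smult c p) = c * pint p"
proof -
  have "poly (smult c p) = (\<lambda>t. c * poly p t)" by auto
  then show ?thesis unfolding pint_def by simp
qed

lemma pint_diff: "pint (p - q) = pint p - pint q"
  using pint_add[of p "smult (-1) q"] pint_smult[of "-1" q] by simp

lemma pint_0 [simp]: "pint 0 = 0"
  using pint_smult[of 0 0] by simp

lemma pint_sum: "pint (\<Sum>i\<in>I. p i) = (\<Sum>i\<in>I. pint (p i))"
  by (induction I rule: infinite_finite_induct) (auto simp: pint_add)

lemma pint_pderiv: "pint (pderiv p) = poly p 1 - poly p (-1)"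
proof -
  have "(LINT t|lborel. poly (pderiv p) t * indicator {-1..1} t) = poly p 1 - poly p (-1)"
    by (rule integral_FTC_Icc_real) (auto intro!: poly_DERIV continuous_intros)
  then show ?thesis by (simp add: pint_def set_lebesgue_integral_def mult.commute)
qed

lemma pint_monom: "pint (monom 1 m) = (if even m then 2 / (real m + 1) else 0)"
proof -
  have "pint (pderiv (monom (1 / (real m + 1)) (Suc m))) = (if even m then 2 / (real m + 1) else 0)"
    unfolding pint_pderiv by (auto simp: poly_monom)
  moreover have "pderiv (monom (1 / (real m + 1)) (Suc m)) = monom 1 m"
    by (simp add: pderiv_monom)
  ultimately show ?thesis by simp
qed

text \<open>Archimedes' hat-box theorem for polynomials: the height is uniformly distributed, with
  density 2 \<pi>. On monomials it is the comparison of \<open>moment\<close> with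
  \<open>pint_monom\<close>.\<close>

lemma archimedes_poly:
  assumes e: "e \<in> S2" shows "(LINT y|\<omega>. poly p (e \<bullet> y)) = 2 * pi * pint p"
proof -
  have "(LINT y|\<omega>. poly p (e \<bullet> y)) = (\<Sum>i\<le>degree p. LINT y|\<omega>. coeff p i * (e \<bullet> y) ^ i)"
    unfolding poly_altdef
    by (rule Bochner_Integration.integral_sum) (intro integrable_surface_continuous continuous_intros)
  also have "\<dots> = (\<Sum>i\<le>degree p. coeff p i * (2 * pi * pint (monom 1 i)))"
  proof (rule sum.cong[OF refl])
    fix i
    have "moment i = 2 * pi * pint (monom 1 i)"
      by (cases "even i") (auto simp: pint_monom moment_odd moment_even elim!: evenE)
    then show "(LINT y|\<omega>. coeff p i * (e \<bullet> y) ^ i) = coeff p i * (2 * pi * pint (monom 1 i))"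
      using moment_sphere[OF e, of i] by simp
  qed
  also have "\<dots> = 2 * pi * pint (\<Sum>i\<le>degree p. smult (coeff p i) (monom 1 i))"
    by (simp add: pint_sum pint_smult sum_distrib_left mult_ac del: smult_monom)
  also have "(\<Sum>i\<le>degree p. smult (coeff p i) (monom 1 i)) = p"
    by (simp add: smult_monom poly_as_sum_of_monoms)
  finally show ?thesis .
qed

text \<open>Each derivative costs at most one factor of \<open>p\<close>. For p = t^2 - 1 this
  removes the boundary terms in \<open>pint_rodrigues\<close>.\<close>

lemma power_dvd_pderiv_funpow:
  fixes p :: "real poly"
  assumes "k \<le> l" shows "p ^ (l - k) dvd (pderiv ^^ k) (p ^ l)"
  using assms
proof (induction k)
  case (Suc k)
  then obtain q where q: "(pderiv ^^ k) (p ^ l) = p ^ (l - k) * q" by (auto elim: dvdE)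
  obtain m where m: "l - k = Suc m" "l - Suc k = m" using Suc.prems by (metis Suc_diff_Suc Suc_le_lessD)
  have "(pderiv ^^ Suc k) (p ^ l) = p ^ m * (p * pderiv q + smult (real (Suc m)) (pderiv p * q))"
    unfolding q m funpow.simps o_apply pderiv_mult pderiv_power_Suc by (simp add: algebra_simps)
  then show ?case using m by (metis dvd_triv_left)
qed simp

text \<open>Repeated integration by parts: fewer than \<open>l\<close> derivatives leave a factor
  t^2 - 1, so no boundary term survives at 1 or -1, and all derivatives end up on
  \<open>q\<close>.\<close>

lemma pint_rodrigues:
  assumes "k \<le> l" "(pderiv ^^ k) q = 0"
  shows "pint ((pderiv ^^ k) ([:-1, 0, 1:] ^ l) * q) = 0"
  using assms
proof (induction k arbitrary: q)
  case (Suc k)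
  let ?A = "(pderiv ^^ k) ([:-1, 0, 1:] ^ l) :: real poly"
  have "[:-1, 0, 1:] dvd ([:-1, 0, 1:] :: real poly) ^ (l - k)"
    using Suc.prems by (intro dvd_power) auto
  then have "[:-1, 0, 1:] dvd ?A" using power_dvd_pderiv_funpow[of k l] Suc.prems
    by (meson Suc_leD dvd_trans)
  then have z: "poly ?A 1 = 0" "poly ?A (-1) = 0" by (auto elim!: dvdE)
  have "pint ((pderiv ^^ Suc k) ([:-1, 0, 1:] ^ l) * q) = pint (pderiv (?A * q)) - pint (?A * pderiv q)"
    by (simp add: pderiv_mult mult.commute flip: pint_diff)
  moreover have "pint (?A * pderiv q) = 0"
    using Suc.prems by (intro Suc.IH) (auto simp: funpow_swap1)
  ultimately show ?case by (simp add: pint_pderiv z)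
qed simp

lemma pderiv_funpow_eq_0: "degree q < l \<Longrightarrow> (pderiv ^^ l) q = (0 :: real poly)"
proof (induction l arbitrary: q)
  case (Suc l)
  show ?case
  proof (cases "degree q = 0")
    case True
    then have "pderiv q = 0" by (simp add: pderiv_eq_0_iff)
    moreover have "(pderiv ^^ l) 0 = (0 :: real poly)" by (induction l) auto
    ultimately show ?thesis by (simp only: funpow_Suc_right o_apply)
  next
    case False
    then have "(pderiv ^^ l) (pderiv q) = 0" using Suc by (intro Suc.IH) (simp add: degree_pderiv)
    then show ?thesis by (simp only: funpow_Suc_right o_apply)
  qed
qed simp

lemma pint_legendre: "degree q < l \<Longrightarrow> pint (legendre l * q) = 0"
  using pint_rodrigues[of l l q] pderiv_funpow_eq_0[of q l] by (simp add: legendre_def pint_smult)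

lemma degree_pderiv_funpow: "degree ((pderiv ^^ k) (p :: real poly)) = degree p - k"
  by (induction k) (auto simp: degree_pderiv)

lemma degree_legendre: "degree (legendre l) = l"
proof -
  have "degree ([:-1, 0, 1:] ^ l :: real poly) = 2 * l" by (simp add: degree_power_eq)
  then show ?thesis by (simp add: legendre_def degree_pderiv_funpow)
qed

text \<open>At the root only the term in which every derivative falls on the power survives. This
  gives the normalisation of Rodrigues' formula at 1.\<close>

lemma poly_pderiv_funpow_root_power:
  "poly ((pderiv ^^ k) ([:-a, 1:] ^ k * g)) a = fact k * poly g (a :: real)"
proof (induction k arbitrary: g)
  case (Suc k)
  have "pderiv ([:-a, 1:] ^ Suc k * g) = [:-a, 1:] ^ k * (smult (real (Suc k)) g + [:-a, 1:] * pderiv g)"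
    unfolding pderiv_mult pderiv_power_Suc
    by (simp add: pderiv_pCons algebra_simps one_pCons[symmetric] del: mult_pCons_left mult_pCons_right)
  then show ?case by (simp add: Suc.IH funpow_Suc_right del: funpow.simps mult_pCons_left mult_pCons_right) 
qed simp

lemma legendre_1: "poly (legendre l) 1 = 1"
proof -
  have "[:-1, 0, 1:] ^ l = [:-1, 1:] ^ l * ([:1, 1:] ^ l :: real poly)"
    by (simp flip: power_mult_distrib)
  then show ?thesis using poly_pderiv_funpow_root_power[of l 1 "[:1, 1:] ^ l"]
    by (simp add: legendre_def)
qed

lemma legendre_span:
  assumes "degree p \<le> n" shows "\<exists>c. p = (\<Sum>m\<le>n. smult (c m) (legendre m))"
  using assms
proof (induction n arbitrary: p)
  case 0
  then obtain a where "p = [:a:]" by (metis degree_eq_zeroE le_zero_eq)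
  then show ?case by (intro exI[of _ "\<lambda>_. a"]) (simp add: legendre_def)
next
  case (Suc n)
  let ?a = "coeff p (Suc n) / coeff (legendre (Suc n)) (Suc n)"
  let ?q = "p - smult ?a (legendre (Suc n))"
  have nz: "coeff (legendre (Suc n)) (Suc n) \<noteq> 0"
    using degree_legendre[of "Suc n"] by (metis degree_0 leading_coeff_0_iff nat.distinct(1))
  have "degree ?q \<le> n"
  proof (rule degree_le, intro allI impI)
    fix i assume i: "n < i"
    show "coeff ?q i = 0"
    proof (cases "i = Suc n")
      case False
      then show ?thesis using i Suc.prems degree_legendre[of "Suc n"] by (simp add: coeff_eq_0)
    qed (use nz in simp)
  qed
  then obtain c where c: "?q = (\<Sum>m\<le>n. smult (c m) (legendre m))" using Suc.IH by blast
  have "p = (\<Sum>m\<le>n. smult (c m) (legendre m)) + smult ?a (legendre (Suc n))"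
    unfolding c[symmetric] by simp
  then show ?case by (intro exI[of _ "\<lambda>m. if m = Suc n then ?a else c m"]) simp
qed

section \<open>Zonal form of the kernels and the addition theorem\<close>

abbreviation meridian_sum :: "(real ^ 3 \<Rightarrow> real) \<Rightarrow> real \<Rightarrow> real" where
  "meridian_sum f t \<equiv> f (vector [t, sqrt (1 - t\<^sup>2), 0]) + f (vector [t, - sqrt (1 - t\<^sup>2), 0])"

text \<open>On this great circle the second coordinate is a square root in \<open>t\<close>. Adding
  its two signs cancels the odd powers and leaves the even ones, which are polynomial; a factor of
  the third coordinate makes a term vanish.\<close>

lemma sph_poly_meridian:
  assumes "f \<in> sph_poly n"
  shows "\<exists>p. degree p \<le> n \<and> (\<forall>t\<in>{-1..1}. meridian_sum f t = poly p t)"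
  using assms
proof (induction rule: sph_poly.induct)
  case (mono a b e)
  show ?case
  proof (cases "e = 0 \<and> even b")
    case True
    then obtain c where b: "b = 2 * c" by (auto elim: evenE)
    let ?p = "smult 2 (monom 1 a * [:1, 0, -1:] ^ c) :: real poly"
    have "degree ?p \<le> a + 2 * c"
      by (rule order.trans[OF degree_smult_le] order.trans[OF degree_mult_le] add_mono)+
         (auto simp: degree_monom_eq degree_power_eq)
    moreover have "(sqrt (1 - t\<^sup>2)) ^ b = poly [:1, 0, -1:] t ^ c" "(- sqrt (1 - t\<^sup>2)) ^ b = poly [:1, 0, -1:] t ^ c"
      if "t \<in> {-1..1}" for t
      using that by (simp_all add: b power_mult abs_square_le_1 abs_le_iff power2_eq_square[of t, symmetric])
    ultimately show ?thesis using True b mono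
      by (intro exI[of _ ?p]) (auto simp: poly_monom vector_3)
  next
    case False
    then have "e = 1 \<or> e = 0 \<and> odd b" using mono by auto
    then show ?thesis by (intro exI[of _ 0]) (auto simp: vector_3)
  qed
next
  case (add f g)
  then obtain p q where "degree p \<le> n" "degree q \<le> n"
    "\<forall>t\<in>{-1..1}. meridian_sum f t = poly p t"
    "\<forall>t\<in>{-1..1}. meridian_sum g t = poly q t"
    by blast
  then show ?case by (intro exI[of _ "p + q"]) (auto intro: degree_add_le simp: algebra_simps)
next
  case (scale f c)
  then obtain p where "degree p \<le> n"
    "\<forall>t\<in>{-1..1}. meridian_sum f t = poly p t"
    by blast
  then show ?case
    by (intro exI[of _ "smult c p"]) (auto intro: order.trans[OF degree_smult_le] simp flip: distrib_left)
next
  case (cong f g)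
  have "vector [t, s, 0] \<in> S2" if "t \<in> {-1..1}" "s = sqrt (1 - t\<^sup>2) \<or> s = - sqrt (1 - t\<^sup>2)" for t s :: real
  proof -
    have "s\<^sup>2 = 1 - t\<^sup>2" using that by (auto simp: abs_square_le_1 abs_le_iff)
    then show ?thesis by (simp add: norm_vec_def L2_set_def sum_3 vector_3)
  qed
  then show ?case using cong by auto
qed

context harmonic_basis
begin

text \<open>Both meridian points have the same inner product with the pole, so invariance makes
  their kernel values equal and the meridian sum is twice the kernel.\<close>

lemma ker_zonal: "\<exists>p. degree p \<le> n \<and> (\<forall>x\<in>S2. \<forall>y\<in>S2. ker n x y = poly p (x \<bullet> y))"
proof -
  let ?e = "vector [1, 0, 0] :: real ^ 3"
  have e: "?e \<in> S2" by (simp add: norm_vec_def L2_set_def sum_3 vector_3)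
  obtain p where p: "degree p \<le> n" "\<And>t. t \<in> {-1..1} \<Longrightarrow>
      meridian_sum (ker n ?e) t = poly p t"
    using sph_poly_meridian[OF ker_poly[of n ?e]] by blast
  have "ker n x y = poly (smult (1/2) p) (x \<bullet> y)" if x: "x \<in> S2" and y: "y \<in> S2" for x y
  proof -
    let ?t = "x \<bullet> y"
    have t: "?t \<in> {-1..1}" using Cauchy_Schwarz_ineq2[of x y] x y by (auto simp: abs_le_iff)
    have *: "ker n x y = ker n ?e (vector [?t, s, 0])" if "s = sqrt (1 - ?t\<^sup>2) \<or> s = - sqrt (1 - ?t\<^sup>2)" for s
    proof (rule ker_eq[OF x y e])
      have "s\<^sup>2 = 1 - ?t\<^sup>2" using that t by (auto simp: abs_square_le_1 abs_le_iff)
      then show "vector [?t, s, 0] \<in> S2" by (simp add: norm_vec_def L2_set_def sum_3 vector_3)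
    qed (simp add: inner_vec_def sum_3 vector_3)
    have "2 * ker n x y = poly p ?t"
      using p(2)[OF t] *[of "sqrt (1 - ?t\<^sup>2)"] *[of "- sqrt (1 - ?t\<^sup>2)"] by simp
    then show ?thesis by simp
  qed
  then show ?thesis using p(1) by (intro exI[of _ "smult (1/2) p"]) simp
qed

definition zker :: "nat \<Rightarrow> real ^ 3 \<Rightarrow> real ^ 3 \<Rightarrow> real" where
  "zker l x y = (\<Sum>k=1..2*l+1. Y l k x * Y l k y)"

lemma ker_sum_zker: "ker n x y = (\<Sum>l\<le>n. zker l x y)"
  unfolding ker_def zker_def YY_def by (rule sum_idx)

lemma zker_0: "zker 0 x y = ker 0 x y"
  by (simp add: ker_sum_zker)

lemma zker_Suc: "zker (Suc l) x y = ker (Suc l) x y - ker l x y"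
  by (simp add: ker_sum_zker)

lemma zker_diag:
  assumes "x \<in> S2" shows "zker l x x = (2 * real l + 1) / (4 * pi)"
  by (cases l) (auto simp: zker_0 zker_Suc ker_diag[OF assms] field_simps power2_eq_square)

lemma zker_continuous: "continuous_on S2 (zker l x)"
  unfolding zker_def by (intro continuous_intros Y_continuous) auto

lemma zker_zonal: "\<exists>p. degree p \<le> l \<and> (\<forall>x\<in>S2. \<forall>y\<in>S2. zker l x y = poly p (x \<bullet> y))"
proof (cases l)
  case 0 then show ?thesis using ker_zonal[of 0] by (simp add: zker_0)
next
  case (Suc m)
  obtain p q where p: "degree p \<le> Suc m" "\<forall>x\<in>S2. \<forall>y\<in>S2. ker (Suc m) x y = poly p (x \<bullet> y)"
    and q: "degree q \<le> m" "\<forall>x\<in>S2. \<forall>y\<in>S2. ker m x y = poly q (x \<bullet> y)"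
    using ker_zonal by metis
  show ?thesis using p q Suc
    by (intro exI[of _ "p - q"]) (auto simp: zker_Suc intro: degree_diff_le)
qed

lemma ip_zker:
  assumes "continuous_on S2 f"
  shows "ip (zker l x) f = (\<Sum>k=1..2*l+1. Y l k x * ip (Y l k) f)"
  unfolding zker_def[abs_def] ip_scale_left[symmetric]
  by (rule ip_sum_left) (use assms in \<open>auto intro!: continuous_intros Y_continuous\<close>)

lemma ip_zker_Y:
  assumes j: "j \<in> {1..2*m+1}"
  shows "ip (zker l x) (Y m j) = (if m = l then Y m j x else 0)"
proof -
  have "ip (zker l x) (Y m j) = (\<Sum>k=1..2*l+1. Y l k x * ip (Y l k) (Y m j))"
    by (rule ip_zker[OF Y_continuous[OF j]])
  also have "\<dots> = (\<Sum>k=1..2*l+1. if k = j then (if m = l then Y m j x else 0) else 0)"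
    by (rule sum.cong) (use Y_orthonormal[OF _ j] in auto)
  also have "\<dots> = (if m = l then Y m j x else 0)"
    using j by (auto simp: sum.delta)
  finally show ?thesis .
qed

lemma ip_zker_low:
  assumes q: "q \<in> sph_poly n" and n: "n < l" shows "ip (zker l x) q = 0"
proof -
  have "ip (zker l x) q = ip (zker l x) (\<lambda>y. \<Sum>i\<in>idx n. ip (YY i) q * YY i y)"
    by (rule ip_cong) (use sph_poly_expand[OF q] in auto)
  also have "\<dots> = (\<Sum>i\<in>idx n. ip (YY i) q * ip (zker l x) (YY i))"
    unfolding ip_scale_right[symmetric]
    by (rule ip_sum_right) (auto intro!: continuous_intros YY_continuous zker_continuous)
  also have "\<dots> = 0"
  proof (rule sum.neutral, rule ballI)
    fix i assume "i \<in> idx n"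
    then have "snd i \<in> {1..2 * fst i + 1}" "fst i \<noteq> l" using n by (auto simp: idx_def)
    then show "ip (YY i) q * ip (zker l x) (YY i) = 0"
      using ip_zker_Y[of "snd i" "fst i" l x] by (simp add: YY_def)
  qed
  finally show ?thesis .
qed

text \<open>By Archimedes the profile polynomial of \<open>zker l\<close> is orthogonal on the
  interval to all lower degrees, hence a multiple of the Legendre polynomial. The diagonal value
  fixes the factor.\<close>

theorem addition_theorem:
  assumes x: "x \<in> S2" and y: "y \<in> S2"
  shows "zker l x y = (2 * real l + 1) / (4 * pi) * poly (legendre l) (x \<bullet> y)"
proof -
  obtain p where p: "degree p \<le> l" "\<And>x y. x \<in> S2 \<Longrightarrow> y \<in> S2 \<Longrightarrow> zker l x y = poly p (x \<bullet> y)"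
    using zker_zonal by blast
  \<comment> \<open>Matching the leading coefficients drops the degree of a nonzero \<open>r\<close>
    below \<open>l\<close>; \<open>r\<close> is then orthogonal to both terms of its definition,
    hence to itself.\<close>
  define c where "c = coeff p l / coeff (legendre l) l"
  define r where "r = p - smult c (legendre l)"
  have ort: "pint (p * q) = 0" if "degree q < l" for q
  proof -
    have "2 * pi * pint (p * q) = (LINT y|\<omega>. poly (p * q) (x \<bullet> y))"
      by (rule archimedes_poly[OF x, symmetric])
    also have "\<dots> = ip (zker l x) (\<lambda>y. poly q (x \<bullet> y))"
      unfolding ip_def by (rule Bochner_Integration.integral_cong) (use p(2)[OF x] in auto)
    also have "\<dots> = 0"
      by (rule ip_zker_low[OF sph_poly_poly[OF order_refl] that])
    finally show ?thesis by simp
  qed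
  have "coeff (legendre l) l \<noteq> 0"
    using degree_legendre[of l] legendre_1[of l] by (metis leading_coeff_0_iff poly_0 zero_neq_one)
  then have cr: "coeff r l = 0" by (simp add: r_def c_def)
  have dr: "degree r \<le> l"
    unfolding r_def by (rule degree_diff_le[OF p(1)]) (use degree_smult_le[of c "legendre l"] degree_legendre[of l] in simp)
  have "pint (r * r) = 0"
  proof (cases "r = 0")
    case False
    then have "degree r < l" using dr cr by (metis le_neq_implies_less leading_coeff_0_iff)
    then have "pint (p * r) = 0" "pint (legendre l * r) = 0"
      using ort pint_legendre by blast+
    moreover have "r * r = (p - smult c (legendre l)) * r" by (simp add: r_def)
    then have "r * r = p * r - smult c (legendre l * r)" by (simp add: left_diff_distrib)
    ultimately show ?thesis by (simp add: pint_diff pint_smult)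
  qed simp
  then have "ip (\<lambda>y. poly r (x \<bullet> y)) (\<lambda>y. poly r (x \<bullet> y)) = 0"
    using archimedes_poly[OF x, of "r * r"] by (simp add: ip_def)
  then have z: "poly r (x \<bullet> z) = 0" if "z \<in> S2" for z
    using ip_zero_imp[of "\<lambda>y. poly r (x \<bullet> y)" z] that by (simp add: continuous_intros)
  have pz: "zker l x z = c * poly (legendre l) (x \<bullet> z)" if "z \<in> S2" for z
    using z[OF that] p(2)[OF x that] by (simp add: r_def)
  have "x \<bullet> x = 1" using x by (simp add: norm_eq_1)
  then have "c = (2 * real l + 1) / (4 * pi)" using pz[OF x] by (simp add: legendre_1 zker_diag[OF x])
  then show ?thesis using pz[OF y] by simp
qed

lemma legendre_zker:
  assumes x: "x \<in> S2" and y: "y \<in> S2"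
  shows "poly (legendre l) (x \<bullet> y) = 4 * pi / (2 * real l + 1) * zker l x y"
proof -
  have "2 * real l + 1 > 0" by simp
  then show ?thesis by (simp add: addition_theorem[OF x y] del: distrib_left_numeral)
qed

lemma ip_legendre_Y:
  assumes x: "x \<in> S2" and j: "j \<in> {1..2*m+1}"
  shows "ip (\<lambda>y. poly (legendre l) (x \<bullet> y)) (Y m j) = (if m = l then 4 * pi / (2 * real l + 1) * Y m j x else 0)"
proof -
  have "ip (\<lambda>y. poly (legendre l) (x \<bullet> y)) (Y m j) = ip (\<lambda>y. 4 * pi / (2 * real l + 1) * zker l x y) (Y m j)"
    by (rule ip_cong[OF legendre_zker[OF x] refl])
  then show ?thesis by (simp only: ip_scale_left ip_zker_Y[OF j]) simp
qed

text \<open>The norm is read off on the sphere: \<open>ip_legendre_Y\<close> turns the square of a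
  Legendre polynomial into a multiple of the diagonal value of \<open>zker l\<close>.\<close>

lemma pint_legendre_legendre: "pint (legendre l * legendre m) = (if l = m then 2 / (2 * real l + 1) else 0)"
proof (cases l m rule: linorder_cases)
  case less
  then show ?thesis using pint_legendre[of "legendre l" m] by (simp add: degree_legendre mult.commute)
next
  case greater
  then show ?thesis using pint_legendre[of "legendre m" l] by (simp add: degree_legendre)
next
  case equal
  let ?e = "axis 1 1 :: real ^ 3" let ?c = "4 * pi / (2 * real l + 1)"
  have e: "?e \<in> S2" by (simp add: norm_axis_1)
  have "2 * pi * pint (legendre l * legendre l) = ip (\<lambda>y. poly (legendre l) (?e \<bullet> y)) (\<lambda>y. poly (legendre l) (?e \<bullet> y))"
    using archimedes_poly[OF e, of "legendre l * legendre l"] by (simp add: ip_def)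
  also have "\<dots> = ip (\<lambda>y. poly (legendre l) (?e \<bullet> y)) (\<lambda>y. ?c * zker l ?e y)"
    by (rule ip_cong[OF refl legendre_zker[OF e]])
  also have "\<dots> = ?c * ip (zker l ?e) (\<lambda>y. poly (legendre l) (?e \<bullet> y))"
    unfolding ip_scale_right by (subst ip_commute) (rule refl)
  also have "\<dots> = ?c * (\<Sum>k=1..2*l+1. Y l k ?e * ip (\<lambda>y. poly (legendre l) (?e \<bullet> y)) (Y l k))"
    by (subst ip_zker) (auto intro!: continuous_intros simp: ip_commute)
  also have "\<dots> = ?c * (?c * zker l ?e ?e)"
    unfolding zker_def sum_distrib_left by (intro sum.cong) (auto simp: ip_legendre_Y[OF e])
  also have "\<dots> = ?c" by (simp add: zker_diag[OF e])
  also have "\<dots> = 2 * pi * (2 / (2 * real l + 1))" by simp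
  finally have "pint (legendre l * legendre l) = 2 / (2 * real l + 1)"
    unfolding mult_cancel_left by simp
  then show ?thesis using equal by simp
qed

lemma funk_hecke_poly:
  assumes x: "x \<in> S2" and k: "k \<in> {1..2*l+1}"
  shows "(LINT y|\<omega>. poly p (x \<bullet> y) * Y l k y) = 2 * pi * pint (p * legendre l) * Y l k x"
proof -
  obtain n c where p: "p = (\<Sum>m\<le>n. smult (c m) (legendre m))"
    using legendre_span[of p "degree p"] by auto
  have "(LINT y|\<omega>. poly p (x \<bullet> y) * Y l k y) = ip (\<lambda>y. \<Sum>m\<le>n. c m * poly (legendre m) (x \<bullet> y)) (Y l k)"
    by (simp add: ip_def p poly_sum)
  also have "\<dots> = (\<Sum>m\<le>n. ip (\<lambda>y. c m * poly (legendre m) (x \<bullet> y)) (Y l k))"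
    by (rule ip_sum_left) (use k in \<open>auto intro!: continuous_intros Y_continuous\<close>)
  also have "\<dots> = (\<Sum>m\<le>n. 2 * pi * Y l k x * (c m * pint (legendre m * legendre l)))"
    by (rule sum.cong) (auto simp: ip_scale_left ip_legendre_Y[OF x k] pint_legendre_legendre)
  also have "\<dots> = 2 * pi * pint (p * legendre l) * Y l k x"
    by (simp add: p sum_distrib_right pint_sum pint_smult sum_distrib_left mult_ac)
  finally show ?thesis .
qed

end

section \<open>The Funk--Hecke formula\<close>

lemma measurable_inner_surface: "(\<lambda>y. a \<bullet> y) \<in> borel_measurable \<omega>" for a :: "real ^ 3"
  by (intro borel_measurable_surface_continuous continuous_intros)

lemma inner_S2_range: "x \<in> S2 \<Longrightarrow> y \<in> S2 \<Longrightarrow> x \<bullet> y \<in> {-1..1}" for x y :: "real ^ 3"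
  using Cauchy_Schwarz_ineq2[of x y] by (auto simp: abs_le_iff)

lemma continuous_on_compose_inner:
  fixes g :: "real \<Rightarrow> real" and x :: "real ^ 3"
  assumes "continuous_on {-1..1} g" "x \<in> S2"
  shows "continuous_on S2 (\<lambda>y. g (x \<bullet> y))"
  by (rule continuous_on_compose2[OF assms(1)])
     (use inner_S2_range[OF assms(2)] in \<open>auto intro!: continuous_intros\<close>)

lemma Weierstrass_poly:
  fixes g :: "real \<Rightarrow> real"
  assumes "continuous_on {-1..1} g" "e > 0"
  obtains p where "\<And>t. t \<in> {-1..1} \<Longrightarrow> \<bar>g t - poly p t\<bar> \<le> e"
proof -
  obtain f where f: "real_polynomial_function f" "\<And>t. t \<in> {-1..1} \<Longrightarrow> \<bar>g t - f t\<bar> < e"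
    using Stone_Weierstrass_real_polynomial_function[OF compact_Icc assms] by metis
  then obtain a n where "f = (\<lambda>x. \<Sum>i\<le>n. a i * x ^ i)"
    by (auto simp: real_polynomial_function_iff_sum)
  then have "f t = poly (\<Sum>i\<le>n. monom (a i) i) t" for t
    by (simp add: poly_sum poly_monom)
  then show ?thesis using that f(2) by (metis less_imp_le)
qed

text \<open>Even powers of the height along \<open>a\<close> dominate the indicator of the point,
  and their integrals tend to zero. This is needed because \<Phi> is only given on the open
  interval, which misses y = x and y = -x.\<close>

lemma surface_singleton: "a \<in> S2 \<Longrightarrow> emeasure \<omega> {a} = 0"
proof -
  assume a: "a \<in> S2"
  have s: "{a} \<in> sets \<omega>" using a by (auto simp: sets_restrict_space)
  have "measure \<omega> {a} \<le> 4 * pi / (2 * real j + 1)" for j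
  proof -
    have "measure \<omega> {a} = (LINT y|\<omega>. indicator {a} y)"
    proof -
      have "{a} \<inter> S2 = {a}" using a by auto
      then show ?thesis by simp
    qed
    also have "\<dots> \<le> (LINT y|\<omega>. (a \<bullet> y) ^ (2 * j))"
    proof (rule integral_mono)
      show "integrable \<omega> (indicat_real {a})"
        by (rule integrable_real_indicator[OF s]) (simp add: surface.emeasure_finite less_top[symmetric])
      show "indicat_real {a} y \<le> (a \<bullet> y) ^ (2 * j)" for y
        using a by (auto simp: indicator_def norm_eq_1)
    qed (intro integrable_surface_continuous continuous_intros)
    also have "\<dots> = 4 * pi / (2 * real j + 1)" by (simp add: moment_sphere[OF a] moment_even)
    finally show ?thesis .
  qed
  note le = this
  have "measure \<omega> {a} \<le> 0"
  proof (rule ccontr)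
    assume "\<not> ?thesis"
    then have m: "measure \<omega> {a} > 0" by simp
    obtain j where "4 * pi / measure \<omega> {a} < real j" using reals_Archimedean2 by blast
    then have "4 * pi < real j * measure \<omega> {a}" using m by (simp add: field_simps)
    moreover have "measure \<omega> {a} * (2 * real j + 1) \<le> 4 * pi" using le[of j] by (simp add: field_simps)
    moreover have "real j * measure \<omega> {a} \<ge> 0" using m by simp
    ultimately show False using m by (simp add: algebra_simps)
  qed
  then show ?thesis by (simp add: surface.emeasure_eq_measure measure_le_0_iff)
qed

lemma poly_bounded_unit_interval:
  obtains B where "\<And>t. t \<in> {-1..1} \<Longrightarrow> \<bar>poly v t\<bar> \<le> (B :: real)"
proof -
  have "compact (poly v ` {-1..1})" by (intro compact_continuous_image continuous_intros compact_Icc)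
  then show ?thesis
    using that compact_imp_bounded bounded_iff by (metis image_eqI real_norm_def)
qed

lemma set_integrable_mult_poly:
  assumes \<Phi>: "set_integrable lborel {-1<..<1} \<Phi>"
  shows "set_integrable lborel {-1<..<1} (\<lambda>t. \<Phi> t * poly v t :: real)"
proof -
  obtain B where B: "\<And>t. t \<in> {-1..1} \<Longrightarrow> \<bar>poly v t\<bar> \<le> B"
    by (rule poly_bounded_unit_interval[of v]) auto
  have vm: "poly v \<in> borel_measurable borel"
    by (intro borel_measurable_continuous_onI continuous_intros)
  show ?thesis unfolding set_integrable_def
  proof (rule Bochner_Integration.integrable_bound)
    show "integrable lborel (\<lambda>t. B * (indicator {-1<..<1} t *\<^sub>R \<Phi> t))"
      using \<Phi> by (simp add: set_integrable_def)
    show "AE t in lborel. norm (indicator {-1<..<1} t *\<^sub>R (\<Phi> t * poly v t))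
        \<le> norm (B * (indicator {-1<..<1} t *\<^sub>R \<Phi> t))"
    proof (rule AE_I2)
      fix t :: real
      show "norm (indicator {-1<..<1} t *\<^sub>R (\<Phi> t * poly v t))
        \<le> norm (B * (indicator {-1<..<1} t *\<^sub>R \<Phi> t))"
        using mult_left_mono[of "\<bar>poly v t\<bar>" "\<bar>B\<bar>" "\<bar>\<Phi> t\<bar>"] B[of t]
        by (auto simp: indicator_def abs_mult mult.commute)
    qed
    have "(\<lambda>t. (indicator {-1<..<1} t * \<Phi> t) * poly v t) \<in> borel_measurable lborel"
      using vm by (intro borel_measurable_times
          borel_measurable_integrable[OF \<Phi>[unfolded set_integrable_def real_scaleR_def]]) simp
    then show "(\<lambda>t. indicator {-1<..<1} t *\<^sub>R (\<Phi> t * poly v t)) \<in> borel_measurable lborel"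
      by (simp add: mult.assoc)
  qed
qed

text \<open>A weight \<open>W\<close> on the sphere together with the density \<open>v\<close> of
  its image under the height along \<open>x\<close>, the two being linked only by their moments.
  Positivity allows both to be normalised to probability laws, which can then be identified as
  measures.\<close>

locale zonal_weight =
  fixes x :: "real ^ 3" and W :: "real ^ 3 \<Rightarrow> real" and v :: "real poly"
  assumes x: "x \<in> S2" and W_cont: "continuous_on S2 W"
    and W_pos: "\<And>y. y \<in> S2 \<Longrightarrow> W y \<ge> 1"
    and v_nonneg: "\<And>t. t \<in> {-1..1} \<Longrightarrow> poly v t \<ge> 0"
    and moments: "\<And>p. (LINT y|\<omega>. poly p (x \<bullet> y) * W y) = pint (p * v)"
begin

definition "K = (LINT y|\<omega>. W y)"

lemma K_pint: "K = pint v"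
  using moments[of 1] by (simp add: K_def)

lemma K_pos: "K > 0"
proof -
  have "4 * pi = (LINT y|\<omega>. 1)" by (simp add: measure_surface_S2)
  also have "\<dots> \<le> K"
    unfolding K_def by (rule integral_mono) (use W_cont W_pos in auto)
  finally show ?thesis using pi_gt_zero by linarith
qed

lemma set_integrable_v:
  assumes "continuous_on {-1..1} (g :: real \<Rightarrow> real)"
  shows "set_integrable lborel {-1..1} (\<lambda>t. g t * poly v t)"
  by (rule borel_integrable_atLeastAtMost') (intro continuous_intros assms)

lemma integral_continuous_eq:
  assumes g: "continuous_on {-1..1} (g :: real \<Rightarrow> real)"
  shows "(LINT y|\<omega>. g (x \<bullet> y) * W y) = (LINT t:{-1..1}|lborel. g t * poly v t)"
proof -
  let ?A = "LINT y|\<omega>. g (x \<bullet> y) * W y" and ?B = "LINT t:{-1..1}|lborel. g t * poly v t"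
  have gW: "continuous_on S2 (\<lambda>y. g (x \<bullet> y) * W y)"
    by (intro continuous_intros continuous_on_compose_inner g x W_cont)
  have "\<bar>?A - ?B\<bar> \<le> e" if e: "e > 0" for e
  proof -
    \<comment> \<open>Either side moves by at most \<open>d * K\<close> when \<open>g\<close> is
      replaced by \<open>p\<close>, so each takes half of \<open>e\<close>.\<close>
    define d where "d = e / (2 * K)"
    have d: "d > 0" using e K_pos by (simp add: d_def)
    obtain p where p: "\<And>t. t \<in> {-1..1} \<Longrightarrow> \<bar>g t - poly p t\<bar> \<le> d"
      using Weierstrass_poly[OF g d] by blast
    have pW: "continuous_on S2 (\<lambda>y. poly p (x \<bullet> y) * W y)"
      by (intro continuous_intros W_cont)
    have "\<bar>?A - pint (p * v)\<bar> = \<bar>LINT y|\<omega>. g (x \<bullet> y) * W y - poly p (x \<bullet> y) * W y\<bar>"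
      using gW pW by (simp add: integrable_surface_continuous moments)
    also have "\<dots> \<le> (LINT y|\<omega>. d * W y)"
    proof (rule integral_abs_bound[THEN order.trans], rule integral_mono)
      fix y assume "y \<in> space \<omega>"
      then have y: "y \<in> S2" by simp
      have "\<bar>g (x \<bullet> y) * W y - poly p (x \<bullet> y) * W y\<bar> = \<bar>g (x \<bullet> y) - poly p (x \<bullet> y)\<bar> * W y"
        using W_pos[OF y] by (simp add: abs_mult flip: left_diff_distrib)
      also have "\<dots> \<le> d * W y"
        by (rule mult_right_mono) (use p inner_S2_range[OF x y] W_pos[OF y] in auto)
      finally show "\<bar>g (x \<bullet> y) * W y - poly p (x \<bullet> y) * W y\<bar> \<le> d * W y" .
    qed (use gW pW W_cont in \<open>auto intro!: integrable_surface_continuous continuous_intros\<close>)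
    also have "\<dots> = d * K" by (simp add: K_def)
    finally have 1: "\<bar>?A - pint (p * v)\<bar> \<le> d * K" .
    have pv: "set_integrable lborel {-1..1} (\<lambda>t. poly p t * poly v t)"
      by (rule set_integrable_v) (intro continuous_intros)
    have "\<bar>?B - pint (p * v)\<bar> = \<bar>LINT t:{-1..1}|lborel. g t * poly v t - poly p t * poly v t\<bar>"
      using set_integrable_v[OF g] pv by (simp add: set_integral_diff pint_def)
    also have "\<dots> \<le> (LINT t:{-1..1}|lborel. d * poly v t)"
    proof -
      have "\<bar>LINT t:{-1..1}|lborel. g t * poly v t - poly p t * poly v t\<bar> \<le>
          (LINT t:{-1..1}|lborel. \<bar>g t * poly v t - poly p t * poly v t\<bar>)"
        using set_integral_norm_bound[OF set_integral_diff(1)[OF set_integrable_v[OF g] pv]] by simp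
      also have "\<dots> \<le> (LINT t:{-1..1}|lborel. d * poly v t)"
      proof (rule set_integral_mono)
        show "set_integrable lborel {-1..1} (\<lambda>t. \<bar>g t * poly v t - poly p t * poly v t\<bar>)"
          by (rule set_integrable_abs[OF set_integral_diff(1)[OF set_integrable_v[OF g] pv]])
        show "set_integrable lborel {-1..1} (\<lambda>t. d * poly v t)"
          by (rule set_integrable_v) (intro continuous_intros)
        fix t :: real assume t: "t \<in> {-1..1}"
        have "\<bar>g t * poly v t - poly p t * poly v t\<bar> = \<bar>g t - poly p t\<bar> * poly v t"
          using v_nonneg[OF t] by (simp add: abs_mult flip: left_diff_distrib)
        also have "\<dots> \<le> d * poly v t"
          by (rule mult_right_mono) (use p[OF t] v_nonneg[OF t] in auto)
        finally show "\<bar>g t * poly v t - poly p t * poly v t\<bar> \<le> d * poly v t" .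
      qed
      finally show ?thesis .
    qed
    also have "\<dots> = d * K" by (simp add: K_pint pint_def)
    finally have "\<bar>?B - pint (p * v)\<bar> \<le> d * K" .
    moreover have "2 * (d * K) = e" using K_pos by (simp add: d_def)
    ultimately show ?thesis using 1 by linarith
  qed
  then have "\<bar>?A - ?B\<bar> \<le> 0" by (rule field_le_epsilon) simp
  then show ?thesis by simp
qed

definition "M1 = distr (density \<omega> (\<lambda>y. ennreal (W y / K))) borel (\<lambda>y. x \<bullet> y)"
definition "M2 = density lborel (\<lambda>t. ennreal (indicator {-1..1} t * poly v t / K))"

lemma integral_M1:
  assumes [measurable]: "g \<in> borel_measurable borel"
  shows "integral\<^sup>L M1 g = (LINT y|\<omega>. g (x \<bullet> y) * W y) / (K :: real)"
    "integrable M1 g \<longleftrightarrow> integrable \<omega> (\<lambda>y. g (x \<bullet> y) * W y)"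
proof -
  have m: "(\<lambda>y. x \<bullet> y) \<in> measurable (density \<omega> (\<lambda>y. ennreal (W y / K))) borel"
    using measurable_inner_surface by simp
  have gm: "(\<lambda>y. g (x \<bullet> y)) \<in> borel_measurable \<omega>"
    by (rule measurable_compose[OF measurable_inner_surface]) simp
  have WK: "(\<lambda>y. W y / K) \<in> borel_measurable \<omega>"
    by (intro borel_measurable_surface_continuous continuous_intros W_cont) (use K_pos in auto)
  have pos: "AE y in \<omega>. 0 \<le> W y / K"
    by (rule AE_I2) (use K_pos W_pos in \<open>fastforce intro: divide_nonneg_pos\<close>)
  have "integral\<^sup>L M1 g = (LINT y|\<omega>. (W y / K) *\<^sub>R g (x \<bullet> y))"
    unfolding M1_def by (subst integral_distr[OF m assms], subst integral_density[OF gm WK pos]) (rule refl)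
  also have "\<dots> = (LINT y|\<omega>. g (x \<bullet> y) * W y) / K"
    by (simp add: mult.commute flip: integral_divide_zero)
  finally show "integral\<^sup>L M1 g = (LINT y|\<omega>. g (x \<bullet> y) * W y) / K" .
  have "integrable M1 g \<longleftrightarrow> integrable \<omega> (\<lambda>y. (W y / K) *\<^sub>R g (x \<bullet> y))"
    unfolding M1_def by (subst integrable_distr_eq[OF m assms], subst integrable_density[OF gm WK pos]) (rule refl)
  also have "(\<lambda>y. (W y / K) *\<^sub>R g (x \<bullet> y)) = (\<lambda>y. (1 / K) * (g (x \<bullet> y) * W y))" by (auto simp: fun_eq_iff)
  also have "integrable \<omega> \<dots> \<longleftrightarrow> integrable \<omega> (\<lambda>y. g (x \<bullet> y) * W y)"
    using K_pos by (subst integrable_mult_left_iff) simp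
  finally show "integrable M1 g \<longleftrightarrow> integrable \<omega> (\<lambda>y. g (x \<bullet> y) * W y)" .
qed

lemma integral_M2:
  assumes [measurable]: "g \<in> borel_measurable borel"
  shows "integral\<^sup>L M2 g = (LINT t:{-1..1}|lborel. g t * poly v t) / (K :: real)"
    "integrable M2 g \<longleftrightarrow> set_integrable lborel {-1..1} (\<lambda>t. g t * poly v t)"
proof -
  have vm: "(\<lambda>t. indicator {-1..1} t * poly v t / K) \<in> borel_measurable lborel"
    by (intro borel_measurable_divide borel_measurable_times)
       (auto intro!: borel_measurable_continuous_onI continuous_intros)
  have pos: "AE t in lborel. 0 \<le> indicator {-1..1} t * poly v t / K"
    using K_pos v_nonneg by (auto simp: indicator_def)
  have gm: "g \<in> borel_measurable lborel" by simp
  have "integral\<^sup>L M2 g = (LINT t|lborel. (indicator {-1..1} t * poly v t / K) *\<^sub>R g t)"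
    unfolding M2_def by (rule integral_density[OF gm vm pos])
  also have "\<dots> = (LINT t:{-1..1}|lborel. g t * poly v t) / K"
    unfolding set_lebesgue_integral_def by (simp add: mult_ac flip: integral_divide_zero)
  finally show "integral\<^sup>L M2 g = (LINT t:{-1..1}|lborel. g t * poly v t) / K" .
  have "integrable M2 g \<longleftrightarrow> integrable lborel (\<lambda>t. (indicator {-1..1} t * poly v t / K) *\<^sub>R g t)"
    unfolding M2_def by (rule integrable_density[OF gm vm pos])
  also have "(\<lambda>t. (indicator {-1..1} t * poly v t / K) *\<^sub>R g t) =
      (\<lambda>t. (1 / K) * (indicator {-1..1} t *\<^sub>R (g t * poly v t)))" by (auto simp: fun_eq_iff)
  also have "integrable lborel \<dots> \<longleftrightarrow> set_integrable lborel {-1..1} (\<lambda>t. g t * poly v t)"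
    unfolding set_integrable_def using K_pos by (subst integrable_mult_left_iff) simp
  finally show "integrable M2 g \<longleftrightarrow> set_integrable lborel {-1..1} (\<lambda>t. g t * poly v t)" .
qed

lemma integrable_M:
  assumes "continuous_on UNIV (g :: real \<Rightarrow> real)"
  shows "integrable M1 g" "integrable M2 g" "integral\<^sup>L M1 g = integral\<^sup>L M2 g"
proof -
  have gm: "g \<in> borel_measurable borel" using assms by (rule borel_measurable_continuous_onI)
  have g: "continuous_on {-1..1} g" using assms continuous_on_subset by blast
  show "integrable M1 g" unfolding integral_M1(2)[OF gm]
    by (intro integrable_surface_continuous continuous_intros continuous_on_compose_inner g x W_cont)
  show "integrable M2 g" unfolding integral_M2(2)[OF gm] by (rule set_integrable_v[OF g])
  show "integral\<^sup>L M1 g = integral\<^sup>L M2 g"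
    unfolding integral_M1(1)[OF gm] integral_M2(1)[OF gm] integral_continuous_eq[OF g] ..
qed

lemma real_distribution_unit_integral:
  assumes "sets M = sets borel" "integrable M (\<lambda>_. 1 :: real)" "integral\<^sup>L M (\<lambda>_. 1 :: real) = 1"
  shows "real_distribution M"
proof -
  have "emeasure M (space M) \<noteq> \<infinity>" using assms(2) by (simp add: integrable_iff_bounded)
  moreover have "measure M (space M) = 1" using assms(3) by simp
  ultimately have "emeasure M (space M) = 1"
    by (simp add: emeasure_eq_ennreal_measure)
  then interpret prob_space M by (rule prob_spaceI)
  show ?thesis
    by unfold_locales (use assms(1) sets_eq_imp_space_eq[OF assms(1)] in auto)
qed

text \<open>Characteristic functions integrate only sine and cosine, which are continuous, so
  agreement on continuous functions suffices. Equality of the measures then reaches every integrable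
  function without approximating \<Phi>.\<close>

lemma M1_eq_M2: "M1 = M2"
proof (rule Levy_uniqueness)
  have 1: "integral\<^sup>L M1 (\<lambda>_. 1 :: real) = 1"
    using integral_M1(1)[of "\<lambda>_. 1"] K_pos by (simp add: K_def)
  show "real_distribution M1"
    by (rule real_distribution_unit_integral) (use 1 integrable_M[of "\<lambda>_. 1"] in \<open>auto simp: M1_def\<close>)
  show "real_distribution M2"
    by (rule real_distribution_unit_integral) (use 1 integrable_M[of "\<lambda>_. 1"] in \<open>auto simp: M2_def\<close>)
  have ch: "char M s = complex_of_real (LINT t|M. cos (s * t)) + \<i> * complex_of_real (LINT t|M. sin (s * t))"
    if "integrable M (\<lambda>t. cos (s * t))" "integrable M (\<lambda>t. sin (s * t))" for M s
  proof -
    have "char M s = (CLINT t|M. complex_of_real (cos (s * t)) + \<i> * complex_of_real (sin (s * t)))"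
      unfolding char_def exp_Euler cos_of_real sin_of_real ..
    also have "\<dots> = (CLINT t|M. complex_of_real (cos (s * t))) + (CLINT t|M. \<i> * complex_of_real (sin (s * t)))"
      by (rule Bochner_Integration.integral_add) (use that in simp_all)
    finally show ?thesis by simp
  qed
  show "char M1 = char M2"
  proof
    fix s :: real
    have "continuous_on UNIV (\<lambda>t. cos (s * t))" by (intro continuous_intros)
    moreover have "continuous_on UNIV (\<lambda>t. sin (s * t))" by (intro continuous_intros)
    ultimately show "char M1 s = char M2 s" by (simp add: ch integrable_M)
  qed
qed

lemma integral_L1:
  assumes \<Phi>: "set_integrable lborel {-1<..<1} \<Phi>"
  shows "integrable \<omega> (\<lambda>y. \<Phi> (x \<bullet> y) * W y)"
    "(LINT y|\<omega>. \<Phi> (x \<bullet> y) * W y) = (LINT t:{-1<..<1}|lborel. \<Phi> t * poly v t)"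
proof -
  \<comment> \<open>Only the restriction of \<Phi> to the open interval is known to be measurable,
    so the cutoff stands in for it.\<close>
  define \<Psi> where "\<Psi> t = indicator {-1<..<1} t * \<Phi> t" for t
  have \<Psi>i: "integrable lborel \<Psi>" using \<Phi> by (simp add: set_integrable_def \<Psi>_def[abs_def])
  then have \<Psi>m: "\<Psi> \<in> borel_measurable borel" by auto
  have vi: "(\<lambda>t. indicator {-1..1} t *\<^sub>R (\<Psi> t * poly v t)) = (\<lambda>t. indicator {-1<..<1} t *\<^sub>R (\<Phi> t * poly v t))"
    by (auto simp: \<Psi>_def indicator_def)
  have "set_integrable lborel {-1..1} (\<lambda>t. \<Psi> t * poly v t)"
    using set_integrable_mult_poly[OF \<Phi>, of v] unfolding set_integrable_def vi .
  then have "integrable M2 \<Psi>" by (simp add: integral_M2(2)[OF \<Psi>m])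
  then have i1: "integrable \<omega> (\<lambda>y. \<Psi> (x \<bullet> y) * W y)"
    by (simp add: M1_eq_M2[symmetric] integral_M1(2)[OF \<Psi>m])
  have "(LINT y|\<omega>. \<Psi> (x \<bullet> y) * W y) = (LINT t:{-1..1}|lborel. \<Psi> t * poly v t)"
    using M1_eq_M2 integral_M1(1)[OF \<Psi>m] integral_M2(1)[OF \<Psi>m] K_pos by simp
  also have "\<dots> = (LINT t:{-1<..<1}|lborel. \<Phi> t * poly v t)"
    unfolding set_lebesgue_integral_def vi ..
  finally have i2: "(LINT y|\<omega>. \<Psi> (x \<bullet> y) * W y) = (LINT t:{-1<..<1}|lborel. \<Phi> t * poly v t)" .
  \<comment> \<open>The cutoff changes nothing away from the two poles \<open>x\<close> and
    \<open>- x\<close>, which are null.\<close>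
  have eq: "\<Psi> (x \<bullet> y) * W y = \<Phi> (x \<bullet> y) * W y" if y: "y \<in> space \<omega>" "y \<notin> {x, - x}" for y
  proof -
    have "x \<bullet> y \<noteq> 1" "x \<bullet> y \<noteq> - 1"
    proof -
      have xx: "x \<bullet> x = 1" "y \<bullet> y = 1" using x y by (auto simp: norm_eq_1)
      have "(x - y) \<bullet> (x - y) = 2 - 2 * (x \<bullet> y)" "(x + y) \<bullet> (x + y) = 2 + 2 * (x \<bullet> y)"
        by (auto simp: inner_simps xx inner_commute)
      moreover have "x - y \<noteq> 0" "x + y \<noteq> 0" using y by (auto simp: add_eq_0_iff)
      ultimately show "x \<bullet> y \<noteq> 1" "x \<bullet> y \<noteq> - 1" by auto
    qed
    then have "x \<bullet> y \<in> {-1<..<1}" using inner_S2_range[OF x, of y] y by auto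
    then show ?thesis by (simp add: \<Psi>_def)
  qed
  have X: "countable {x, - x}" "\<And>z. z \<in> {x, - x} \<Longrightarrow> emeasure \<omega> {z} = 0" "\<And>z. z \<in> {x, - x} \<Longrightarrow> {z} \<in> sets \<omega>"
    using x by (auto intro!: surface_singleton simp: sets_restrict_space)
  show "integrable \<omega> (\<lambda>y. \<Phi> (x \<bullet> y) * W y)"
    using i1 integrable_discrete_difference[where X = "{x, - x}", OF X eq] by simp
  show "(LINT y|\<omega>. \<Phi> (x \<bullet> y) * W y) = (LINT t:{-1<..<1}|lborel. \<Phi> t * poly v t)"
    using i2 integral_discrete_difference[where X = "{x, - x}", OF X eq] by simp
qed

end

lemma zonal_weight_1: "x \<in> S2 \<Longrightarrow> zonal_weight x (\<lambda>_. 1) [:2 * pi:]"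
  by unfold_locales (auto simp: archimedes_poly pint_smult mult.commute[of _ "[:2 * pi:]"])

lemma integrable_mult_continuous:
  fixes g h :: "real ^ 3 \<Rightarrow> real"
  assumes i: "integrable \<omega> h" and g: "continuous_on S2 g"
  shows "integrable \<omega> (\<lambda>y. h y * g y)"
proof -
  obtain B where B: "\<And>y. y \<in> S2 \<Longrightarrow> \<bar>g y\<bar> \<le> B" by (rule continuous_on_S2_bounded[OF g]) auto
  show ?thesis
  proof (rule Bochner_Integration.integrable_bound)
    show "integrable \<omega> (\<lambda>y. B * h y)" using i by simp
    show "AE y in \<omega>. norm (h y * g y) \<le> norm (B * h y)"
    proof (rule AE_I2)
      fix y assume "y \<in> space \<omega>"
      then have "\<bar>g y\<bar> \<le> \<bar>B\<bar>" using B[of y] by simp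
      then show "norm (h y * g y) \<le> norm (B * h y)"
        by (simp add: abs_mult mult.commute[of "\<bar>B\<bar>"] mult_left_mono)
    qed
    show "(\<lambda>y. h y * g y) \<in> borel_measurable \<omega>"
      by (intro borel_measurable_times borel_measurable_integrable[OF i] borel_measurable_surface_continuous g)
  qed
qed

lemma integrable_zonal:
  fixes \<Phi> :: "real \<Rightarrow> real"
  assumes x: "x \<in> S2" and \<Phi>: "set_integrable lborel {-1<..<1} \<Phi>"
  shows "integrable \<omega> (\<lambda>y. \<Phi> (x \<bullet> y))"
proof -
  interpret zonal_weight x "\<lambda>_. 1" "[:2 * pi:]" using x by (rule zonal_weight_1)
  show ?thesis using integral_L1(1)[OF \<Phi>] by simp
qed

context harmonic_basis
begin

text \<open>Both sides are linear in the weight on the sphere, so the formula for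
  \<open>Y l k\<close> follows from those for two admissible weights whose difference is
  \<open>Y l k\<close> up to a multiple of the constant weight.\<close>

theorem funk_hecke:
  assumes x: "x \<in> S2" and k: "k \<in> {1..2*l+1}" and \<Phi>: "set_integrable lborel {-1<..<1} \<Phi>"
  shows "(LINT y|\<omega>. \<Phi> (x \<bullet> y) * Y l k y) = multiplier \<Phi> l * Y l k x"
proof -
  obtain B where B: "\<And>y. y \<in> S2 \<Longrightarrow> \<bar>Y l k y\<bar> \<le> B"
    by (rule continuous_on_S2_bounded[OF Y_continuous[OF k]]) auto
  obtain B' where B': "\<And>t. t \<in> {-1..1} \<Longrightarrow> \<bar>poly (legendre l) t\<bar> \<le> B'"
    by (rule poly_bounded_unit_interval[of "legendre l"]) auto
  \<comment> \<open>\<open>Y l k\<close> may change sign and is then no admissible weight. Adding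
    \<open>M\<close> makes the weight at least 1 and its density nonnegative; the contribution of
    \<open>M\<close> is removed at the end with the constant weight.\<close>
  define M where "M = B + \<bar>Y l k x\<bar> * B' + 1"
  have BB: "0 \<le> B" "0 \<le> \<bar>Y l k x\<bar> * B'" using B[OF x] B'[of 0] by auto
  let ?W = "\<lambda>y. Y l k y + M" and ?v = "smult (2 * pi * Y l k x) (legendre l) + [:2 * pi * M:]"
  have p: "pint (q * [:2 * pi * M:]) = 2 * pi * M * pint q" for q
    by (simp add: mult.commute[of q] pint_smult)
  interpret W: zonal_weight x ?W ?v
  proof
    show "x \<in> S2" by (rule x)
    show "continuous_on S2 ?W" by (intro continuous_intros Y_continuous k)
    show "1 \<le> ?W y" if "y \<in> S2" for y using B[OF that] BB by (simp add: M_def)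
    show "0 \<le> poly ?v t" if "t \<in> {-1..1}" for t
    proof -
      have "\<bar>Y l k x * poly (legendre l) t\<bar> \<le> \<bar>Y l k x\<bar> * B'"
        unfolding abs_mult by (intro mult_left_mono B' that) simp
      then have "0 \<le> Y l k x * poly (legendre l) t + M" using BB by (simp add: M_def)
      then have "0 \<le> 2 * pi * (Y l k x * poly (legendre l) t + M)" by simp
      then show ?thesis by (simp add: algebra_simps)
    qed
    fix q
    have "(LINT y|\<omega>. poly q (x \<bullet> y) * ?W y) = (LINT y|\<omega>. poly q (x \<bullet> y) * Y l k y) + M * (LINT y|\<omega>. poly q (x \<bullet> y))"
      unfolding distrib_left
      by (subst Bochner_Integration.integral_add)
         (auto intro!: integrable_surface_continuous continuous_intros Y_continuous k simp: mult.commute)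
    also have "\<dots> = 2 * pi * pint (q * legendre l) * Y l k x + M * (2 * pi * pint q)"
      by (simp only: funk_hecke_poly[OF x k] archimedes_poly[OF x])
    also have "\<dots> = pint (q * ?v)"
      unfolding distrib_left pint_add p by (simp add: pint_smult)
    finally show "(LINT y|\<omega>. poly q (x \<bullet> y) * ?W y) = pint (q * ?v)" .
  qed
  interpret U: zonal_weight x "\<lambda>_. 1" "[:2 * pi:]" using x by (rule zonal_weight_1)
  have PY: "integrable \<omega> (\<lambda>y. \<Phi> (x \<bullet> y) * Y l k y)"
    by (rule integrable_mult_continuous[OF integrable_zonal[OF x \<Phi>] Y_continuous[OF k]])
  have P1: "integrable \<omega> (\<lambda>y. \<Phi> (x \<bullet> y))" by (rule integrable_zonal[OF x \<Phi>])
  have LP: "set_integrable lborel {-1<..<1} (\<lambda>t. \<Phi> t * poly (legendre l) t)"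
    by (rule set_integrable_mult_poly[OF \<Phi>])
  let ?S = "\<lambda>f. LINT t:{-1<..<1}|lborel. f t"
  have "(LINT y|\<omega>. \<Phi> (x \<bullet> y) * ?W y) = (LINT y|\<omega>. \<Phi> (x \<bullet> y) * Y l k y) + M * (LINT y|\<omega>. \<Phi> (x \<bullet> y))"
    unfolding distrib_left using PY P1 by (simp add: mult.commute)
  moreover have "(LINT y|\<omega>. \<Phi> (x \<bullet> y)) = 2 * pi * ?S \<Phi>"
    using U.integral_L1(2)[OF \<Phi>] by (simp add: mult.commute)
  moreover have "(LINT y|\<omega>. \<Phi> (x \<bullet> y) * ?W y) = ?S (\<lambda>t. \<Phi> t * poly ?v t)"
    by (rule W.integral_L1(2)[OF \<Phi>])
  moreover have "?S (\<lambda>t. \<Phi> t * poly ?v t) =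
      ?S (\<lambda>t. (2 * pi * Y l k x) * (\<Phi> t * poly (legendre l) t) + (2 * pi * M) * \<Phi> t)"
    by (rule arg_cong[where f = ?S]) (auto simp: algebra_simps)
  moreover have "\<dots> = (2 * pi * Y l k x) * ?S (\<lambda>t. \<Phi> t * poly (legendre l) t) + (2 * pi * M) * ?S \<Phi>"
    by (subst set_integral_add(2)) (use LP \<Phi> in auto)
  ultimately show ?thesis by (simp add: multiplier_def)
qed

end

section \<open>Sobolev series\<close>

lemma ip_cauchy_schwarz:
  assumes f: "continuous_on S2 f" and g: "continuous_on S2 g"
  shows "(ip f g)\<^sup>2 \<le> ip f f * ip g g"
proof (cases "ip g g = 0")
  case True
  have "ip f g = ip f (\<lambda>x. 0 * g x)"
    using ip_zero_imp[OF g True] by (intro ip_cong) auto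
  also have "\<dots> = 0 * ip f g" by (rule ip_scale_right)
  finally show ?thesis using True by simp
next
  case False
  let ?t = "ip f g / ip g g"
  let ?h = "\<lambda>x. f x - ?t * g x"
  have tg: "continuous_on S2 (\<lambda>x. ?t * g x)" by (intro continuous_intros g)
  have hc: "continuous_on S2 ?h" by (intro continuous_intros f g)
  have "ip ?h g = 0"
    using False by (simp only: ip_diff_left[OF g f tg] ip_scale_left) simp
  then have "ip ?h ?h = ip f f - ?t * ip f g"
    by (simp only: ip_diff_right[OF hc f tg] ip_scale_right ip_diff_left[OF f f tg] ip_scale_left)
       (simp add: ip_commute)
  then have "ip f g * ip f g / ip g g \<le> ip f f" using ip_nonneg[of ?h] by simp
  moreover have "ip g g > 0" using False ip_nonneg[of g] by simp
  ultimately show ?thesis by (simp add: field_simps power2_eq_square)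
qed

text \<open>The value of \<open>zker l\<close> on the diagonal, that is, the sum of the squares of
  the harmonics of degree \<open>l\<close> at any point of the sphere.\<close>

definition kap :: "nat \<Rightarrow> real" where "kap l = (2 * real l + 1) / (4 * pi)"

lemma kap_pos: "kap l > 0" by (simp add: kap_def add_pos_nonneg)

lemma kap_le: "kap l \<le> 1 + real l"
proof -
  have "2 * real l + 1 \<le> (1 + real l) * (4 * pi)"
    using pi_gt3 mult_left_mono[of 2 "4 * pi" "1 + real l"] by (simp add: algebra_simps)
  then show ?thesis by (simp add: kap_def divide_le_eq)
qed

definition energy :: "(nat \<Rightarrow> nat \<Rightarrow> real) \<Rightarrow> nat \<Rightarrow> real" where
  "energy c l = (\<Sum>k=1..2*l+1. (c l k)\<^sup>2)"

lemma energy_nonneg: "energy c l \<ge> 0"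
  by (simp add: energy_def sum_nonneg)

lemma energy_scale: "energy (\<lambda>l k. a l * c l k) l = (a l)\<^sup>2 * energy c l"
  unfolding energy_def power_mult_distrib sum_distrib_left ..

definition lam :: "real \<Rightarrow> nat \<Rightarrow> real" where
  "lam r l = (1 + real l * (real l + 1)) powr r"

lemma lam_pos: "lam r l > 0"
proof -
  have "1 + real l * (real l + 1) > 0" by (simp add: add_pos_nonneg)
  then show ?thesis by (simp add: lam_def)
qed

text \<open>The first bound has constant one and serves the dyadic blocks; the second remains usable
  at degree zero and rests on (1 + l)^2 <= 2 (1 + l (l + 1)).\<close>

lemma lam_ge:
  assumes "r > 0" shows "real l powr (2 * r) \<le> lam r l" and "(1/2) powr r * (1 + real l) powr (2 * r) \<le> lam r l"
proof -
  have "real l powr (2 * r) = (real l ^ 2) powr r"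
    by (cases "l = 0") (use assms in \<open>simp_all add: powr_powr flip: powr_numeral\<close>)
  also have "\<dots> \<le> lam r l" unfolding lam_def
    by (rule powr_mono2) (use assms in \<open>auto simp: power2_eq_square algebra_simps\<close>)
  finally show "real l powr (2 * r) \<le> lam r l" .
  have "(1 + real l) powr (2 * r) = ((1 + real l) ^ 2) powr r"
    by (simp add: powr_powr flip: powr_numeral)
  then have "(1/2) powr r * (1 + real l) powr (2 * r) = ((1 + real l) ^ 2 / 2) powr r"
    by (simp add: powr_mult[symmetric])
  also have "\<dots> \<le> lam r l" unfolding lam_def
    by (rule powr_mono2) (use assms in \<open>auto simp: power2_eq_square algebra_simps\<close>)
  finally show "(1/2) powr r * (1 + real l) powr (2 * r) \<le> lam r l" .
qed

text \<open>The Sobolev condition is put on coefficient arrays, because T, its powers and the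
  resolvent act on them by factors that depend on the degree alone.\<close>

definition hr :: "real \<Rightarrow> (nat \<Rightarrow> nat \<Rightarrow> real) \<Rightarrow> bool" where
  "hr r c \<longleftrightarrow> summable (\<lambda>l. lam r l * energy c l)"

lemma energy_cong: "(\<And>k. k \<in> {1..2*l+1} \<Longrightarrow> c l k = d l k) \<Longrightarrow> energy c l = energy d l"
  unfolding energy_def by (rule sum.cong) auto

lemma hr_bounded:
  assumes c: "hr r c" and B: "\<And>l. energy d l \<le> B * energy c l" shows "hr r d"
  unfolding hr_def
proof (rule summable_comparison_test'[where N = 0])
  show "summable (\<lambda>l. B * (lam r l * energy c l))" using c by (simp add: hr_def)
  show "norm (lam r l * energy d l) \<le> B * (lam r l * energy c l)" for l
    using mult_left_mono[OF B[of l] less_imp_le[OF lam_pos[of r l]]] energy_nonneg[of d l] lam_pos[of r l]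
    by (simp add: abs_mult mult_ac)
qed

lemma hr_scale:
  assumes c: "hr r c" and a: "\<And>l. \<bar>a l\<bar> \<le> B" shows "hr r (\<lambda>l k. a l * c l k)"
proof (rule hr_bounded[OF c])
  fix l
  have "(a l)\<^sup>2 \<le> B\<^sup>2" using a[of l] by (metis abs_ge_zero order_trans power2_abs power_mono)
  then show "energy (\<lambda>l k. a l * c l k) l \<le> B\<^sup>2 * energy c l"
    unfolding energy_scale by (rule mult_right_mono) (rule energy_nonneg)
qed

lemma hr_finite: "(\<And>l k. l > n \<Longrightarrow> c l k = 0) \<Longrightarrow> hr r c"
  unfolding hr_def energy_def by (rule summable_finite[of "{..n}"]) auto

lemma energy_add: "energy (\<lambda>l k. c l k + d l k) l \<le> 2 * energy c l + 2 * energy d l"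
proof -
  have "(c l k + d l k)\<^sup>2 \<le> 2 * (c l k)\<^sup>2 + 2 * (d l k)\<^sup>2" for k
    using zero_le_power2[of "c l k - d l k"] by (simp add: power2_sum power2_diff)
  then have "energy (\<lambda>l k. c l k + d l k) l \<le> (\<Sum>k=1..2*l+1. 2 * (c l k)\<^sup>2 + 2 * (d l k)\<^sup>2)"
    unfolding energy_def by (intro sum_mono)
  then show ?thesis by (simp add: energy_def sum.distrib sum_distrib_left)
qed

lemma hr_add:
  assumes "hr r c" "hr r d" shows "hr r (\<lambda>l k. c l k + d l k)"
  unfolding hr_def
proof (rule summable_comparison_test'[where N = 0])
  show "summable (\<lambda>l. 2 * (lam r l * energy c l) + 2 * (lam r l * energy d l))"
    using assms by (intro summable_add) (auto simp: hr_def)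
  show "norm (lam r l * energy (\<lambda>l k. c l k + d l k) l) \<le> 2 * (lam r l * energy c l) + 2 * (lam r l * energy d l)" for l
    using mult_left_mono[OF energy_add[of c d l] less_imp_le[OF lam_pos[of r l]]] energy_nonneg[of "\<lambda>l k. c l k + d l k" l]
      lam_pos[of r l] by (simp add: abs_mult algebra_simps)
qed

lemma hr_uminus: "hr r c \<Longrightarrow> hr r (\<lambda>l k. - c l k)"
  by (simp add: hr_def energy_def)

lemma hr_diff: "hr r c \<Longrightarrow> hr r d \<Longrightarrow> hr r (\<lambda>l k. c l k - d l k)"
  using hr_add[of r c "\<lambda>l k. - d l k"] hr_uminus by simp

lemma sqrt_mult_le: "a > 0 \<Longrightarrow> b \<ge> 0 \<Longrightarrow> sqrt (a * b) \<le> a + b" for a b :: real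
  by (rule real_le_lsqrt) (auto simp: power2_eq_square algebra_simps)

context harmonic_basis
begin

definition comp :: "(nat \<Rightarrow> nat \<Rightarrow> real) \<Rightarrow> nat \<Rightarrow> real ^ 3 \<Rightarrow> real" where
  "comp c l x = (\<Sum>k=1..2*l+1. c l k * Y l k x)"

lemma comp_poly: "comp c l \<in> sph_poly l"
  unfolding comp_def[abs_def] by (intro sph_poly_sum sph_poly.scale Y_poly)

lemma comp_continuous: "continuous_on S2 (comp c l)"
  using comp_poly sph_poly_continuous by blast

text \<open>Cauchy--Schwarz over \<open>k\<close>. The squares of the harmonics of one degree add up
  to the constant \<open>kap l\<close>, so no maximum of a single \<open>Y l k\<close>
  enters.\<close>

lemma comp_bound:
  assumes x: "x \<in> S2" shows "\<bar>comp c l x\<bar> \<le> sqrt (kap l * energy c l)"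
proof -
  have "(comp c l x)\<^sup>2 \<le> (\<Sum>k=1..2*l+1. (c l k)\<^sup>2) * (\<Sum>k=1..2*l+1. (Y l k x)\<^sup>2)"
    unfolding comp_def by (rule Cauchy_Schwarz_ineq_sum)
  also have "(\<Sum>k=1..2*l+1. (Y l k x)\<^sup>2) = kap l"
    using zker_diag[OF x, of l] by (simp add: zker_def kap_def power2_eq_square)
  finally show ?thesis by (simp add: energy_def real_le_rsqrt mult.commute abs_le_square_iff[symmetric] flip: real_sqrt_abs)
qed

lemma ip_Y_comp:
  assumes k: "k \<in> {1..2*l+1}" shows "ip (Y l k) (comp c m) = (if m = l then c l k else 0)"
proof -
  have "ip (Y l k) (comp c m) = (\<Sum>j=1..2*m+1. c m j * ip (Y l k) (Y m j))"
    unfolding comp_def[abs_def] ip_scale_right[symmetric]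
    by (rule ip_sum_right) (use k in \<open>auto intro!: continuous_intros Y_continuous\<close>)
  also have "\<dots> = (\<Sum>j=1..2*m+1. if j = k then (if m = l then c l k else 0) else 0)"
    by (rule sum.cong) (use Y_orthonormal[OF k] in auto)
  also have "\<dots> = (if m = l then c l k else 0)" using k by auto
  finally show ?thesis .
qed

lemma ip_comp_comp: "ip (comp c l) (comp d m) = (if l = m then (\<Sum>k=1..2*l+1. c l k * d l k) else 0)"
proof -
  have "ip (comp c l) (comp d m) = (\<Sum>k=1..2*l+1. c l k * ip (Y l k) (comp d m))"
    unfolding comp_def[of c l, abs_def] ip_scale_left[symmetric]
    by (rule ip_sum_left) (auto intro!: continuous_intros Y_continuous comp_continuous)
  also have "\<dots> = (\<Sum>k=1..2*l+1. c l k * (if m = l then d l k else 0))"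
    by (rule sum.cong) (simp_all add: ip_Y_comp)
  finally show ?thesis by auto
qed

lemma ip_sum_comp:
  assumes "finite I" shows "ip (\<lambda>x. \<Sum>l\<in>I. comp c l x) (\<lambda>x. \<Sum>l\<in>I. comp c l x) = (\<Sum>l\<in>I. energy c l)"
proof -
  have "ip (\<lambda>x. \<Sum>l\<in>I. comp c l x) (\<lambda>x. \<Sum>l\<in>I. comp c l x) = (\<Sum>m\<in>I. \<Sum>l\<in>I. ip (comp c l) (comp c m))"
    by (subst ip_sum_right, intro continuous_intros comp_continuous, rule comp_continuous,
        subst ip_sum_left, rule comp_continuous, rule comp_continuous, rule refl)
  also have "\<dots> = (\<Sum>m\<in>I. energy c m)"
    unfolding ip_comp_comp energy_def using assms
    by (intro sum.cong[OF refl]) (simp add: power2_eq_square sum.delta del: sum.cl_ivl_Suc)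
  finally show ?thesis .
qed

lemma comp_add: "comp (\<lambda>l k. c l k + d l k) l x = comp c l x + comp d l x"
  by (simp add: comp_def sum.distrib distrib_right)

lemma comp_diff: "comp (\<lambda>l k. c l k - d l k) l x = comp c l x - comp d l x"
  by (simp add: comp_def sum_subtractf left_diff_distrib)

lemma comp_cong: "(\<And>k. k \<in> {1..2*l+1} \<Longrightarrow> c l k = d l k) \<Longrightarrow> comp c l x = comp d l x"
  unfolding comp_def by (rule sum.cong) auto

definition series :: "(nat \<Rightarrow> nat \<Rightarrow> real) \<Rightarrow> real ^ 3 \<Rightarrow> real" where
  "series c x = (\<Sum>l. comp c l x)"

lemma series_cong: "(\<And>l k. k \<in> {1..2*l+1} \<Longrightarrow> c l k = d l k) \<Longrightarrow> series c x = series d x"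
  unfolding series_def by (rule suminf_cong, rule comp_cong) simp

lemma sobolev_term_eq: "sobolev_term Y r v l = lam r l * energy (fourier_coeff Y v) l"
  by (simp add: sobolev_term_def lam_def energy_def)

lemma sobolev_space_iff:
  "v \<in> sobolev_space Y r \<longleftrightarrow> v \<in> extensional S2 \<and> continuous_on S2 v \<and> hr r (fourier_coeff Y v)"
proof -
  have "sobolev_term Y r v = (\<lambda>l. lam r l * energy (fourier_coeff Y v) l)"
    by (rule ext) (rule sobolev_term_eq)
  then show ?thesis by (simp add: sobolev_space_def hr_def)
qed

lemma fourier_coeff_ip: "fourier_coeff Y v l k = ip (Y l k) v"
  by (simp add: fourier_coeff_def ip_def mult.commute)

end

section \<open>Uniformly convergent series of spherical harmonics\<close>

locale sobolev_basis = harmonic_basis +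
  fixes r :: real
  assumes r: "r > 1"
begin

text \<open>The core of the Sobolev embedding: the terms are of order l^(1 - 2r), summable because r
  > 1.\<close>

lemma summable_kap_lam: "summable (\<lambda>l. kap l / lam r l)"
proof (rule summable_comparison_test'[where N = 0])
  have "summable (\<lambda>l. real l powr (1 - 2 * r))" using r by (simp add: summable_real_powr_iff)
  then have "summable (\<lambda>l. real (Suc l) powr (1 - 2 * r))" by (subst summable_Suc_iff)
  then show "summable (\<lambda>l. 2 powr r * real (Suc l) powr (1 - 2 * r))" by (rule summable_mult)
  fix l
  have "kap l / lam r l \<le> (1 + real l) / ((1/2) powr r * (1 + real l) powr (2 * r))"
    by (intro frac_le lam_ge kap_le) (use r in \<open>auto intro!: mult_pos_pos\<close>)
  also have "\<dots> = 2 powr r * real (Suc l) powr (1 - 2 * r)"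
    by (simp add: powr_diff powr_divide add.commute)
  finally show "norm (kap l / lam r l) \<le> 2 powr r * real (Suc l) powr (1 - 2 * r)"
    using kap_pos[of l] lam_pos[of r l] by simp
qed

lemma summable_comp_bound:
  assumes "hr r c" shows "summable (\<lambda>l. sqrt (kap l * energy c l))"
proof (rule summable_comparison_test'[where N = 0])
  show "summable (\<lambda>l. kap l / lam r l + lam r l * energy c l)"
    using summable_kap_lam assms unfolding hr_def by (rule summable_add)
  fix l
  have "sqrt (kap l * energy c l) = sqrt (kap l / lam r l * (lam r l * energy c l))"
    using lam_pos[of r l] by simp
  also have "\<dots> \<le> kap l / lam r l + lam r l * energy c l"
    by (rule sqrt_mult_le) (use kap_pos lam_pos energy_nonneg in \<open>auto simp: less_imp_le\<close>)
  finally show "norm (sqrt (kap l * energy c l)) \<le> kap l / lam r l + lam r l * energy c l"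
    using kap_pos[of l] energy_nonneg[of c l] by simp
qed

lemma summable_comp:
  assumes "hr r c" "x \<in> S2" shows "summable (\<lambda>l. comp c l x)"
  by (rule summable_comparison_test'[OF summable_comp_bound[OF assms(1)], where N = 0])
     (use comp_bound[OF assms(2)] in simp)

lemma series_sums: "hr r c \<Longrightarrow> x \<in> S2 \<Longrightarrow> (\<lambda>l. comp c l x) sums series c x"
  unfolding series_def by (rule summable_sums[OF summable_comp])

lemma series_continuous:
  assumes c: "hr r c" shows "continuous_on S2 (series c)"
proof -
  have "uniform_limit S2 (\<lambda>n x. \<Sum>i<n. comp c i x) (\<lambda>x. suminf (\<lambda>i. comp c i x)) sequentially"
    by (rule Weierstrass_m_test[OF _ summable_comp_bound[OF c]]) (use comp_bound in simp)
  then have "uniform_limit S2 (\<lambda>n x. \<Sum>i<n. comp c i x) (series c) sequentially"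
    by (simp add: series_def[abs_def])
  then show ?thesis
    by (rule uniform_limit_theorem[rotated]) (auto intro!: always_eventually continuous_intros comp_continuous)
qed

text \<open>The factor \<open>g\<close> is merely integrable because the zonal kernel is one of its
  instances. Domination comes from the summable uniform bounds on the components.\<close>

lemma integral_series_sums:
  assumes c: "hr r c" and g: "integrable \<omega> g"
  shows "(\<lambda>l. LINT y|\<omega>. g y * comp c l y) sums (LINT y|\<omega>. g y * series c y)"
proof -
  have i: "integrable \<omega> (\<lambda>y. g y * comp c l y)" for l
    by (rule integrable_mult_continuous[OF g comp_continuous])
  have b: "\<bar>g y * comp c l y\<bar> \<le> \<bar>g y\<bar> * sqrt (kap l * energy c l)" if "y \<in> S2" for l y
    unfolding abs_mult by (rule mult_left_mono[OF comp_bound[OF that]]) simp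
  have "(\<lambda>l. LINT y|\<omega>. g y * comp c l y) sums (LINT y|\<omega>. (\<Sum>l. g y * comp c l y))"
  proof (rule sums_integral[OF i])
    show "AE y in \<omega>. summable (\<lambda>l. norm (g y * comp c l y))"
    proof (rule AE_I2)
      fix y assume "y \<in> space \<omega>"
      then show "summable (\<lambda>l. norm (g y * comp c l y))"
        by (intro summable_comparison_test'[OF summable_mult[OF summable_comp_bound[OF c], of "\<bar>g y\<bar>"], where N = 0])
           (use b[of y] in simp)
    qed
    show "summable (\<lambda>l. LINT y|\<omega>. norm (g y * comp c l y))"
    proof (rule summable_comparison_test'[where N = 0])
      show "summable (\<lambda>l. (LINT y|\<omega>. \<bar>g y\<bar>) * sqrt (kap l * energy c l))"
        by (rule summable_mult[OF summable_comp_bound[OF c]])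
      fix l
      have "(LINT y|\<omega>. \<bar>g y * comp c l y\<bar>) \<le> (LINT y|\<omega>. \<bar>g y\<bar> * sqrt (kap l * energy c l))"
        by (rule integral_mono) (use i[of l] g b[of _ l] in auto)
      then show "norm (LINT y|\<omega>. norm (g y * comp c l y)) \<le> (LINT y|\<omega>. \<bar>g y\<bar>) * sqrt (kap l * energy c l)"
        by simp
    qed
  qed
  moreover have "(LINT y|\<omega>. (\<Sum>l. g y * comp c l y)) = (LINT y|\<omega>. g y * series c y)"
    by (rule Bochner_Integration.integral_cong[OF refl])
       (simp add: series_def suminf_mult summable_comp[OF c])
  ultimately show ?thesis by simp
qed

lemma fourier_coeff_series:
  assumes c: "hr r c" and k: "k \<in> {1..2*l+1}"
  shows "fourier_coeff Y (series c) l k = c l k"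
proof -
  have "(\<lambda>m. ip (Y l k) (comp c m)) sums ip (Y l k) (series c)"
    unfolding ip_def by (rule integral_series_sums[OF c]) (use Y_continuous[OF k] in auto)
  then have "(\<lambda>m. if m = l then c l k else 0) sums ip (Y l k) (series c)"
    by (simp add: ip_Y_comp[OF k])
  moreover have "(\<lambda>m. if m = l then c l k else 0) sums c l k"
    using sums_single[of l "\<lambda>_. c l k"] by simp
  ultimately show ?thesis using sums_unique2 by (metis fourier_coeff_ip)
qed

lemma series_eq_imp:
  assumes "hr r c" "hr r d" "\<And>x. x \<in> S2 \<Longrightarrow> series c x = series d x" "k \<in> {1..2*l+1}"
  shows "c l k = d l k"
proof -
  have "fourier_coeff Y (series c) l k = fourier_coeff Y (series d) l k"
    unfolding fourier_coeff_ip by (rule ip_cong) (use assms in auto)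
  then show ?thesis using assms fourier_coeff_series by metis
qed

text \<open>The difference has zero coefficients, so completeness makes its L2 norm vanish; being
  continuous, it vanishes at every point.\<close>

lemma sobolev_series:
  assumes v: "v \<in> sobolev_space Y r" and x: "x \<in> S2"
  shows "v x = series (fourier_coeff Y v) x"
proof -
  let ?c = "fourier_coeff Y v"
  let ?w = "\<lambda>x. v x - series ?c x"
  have vc: "continuous_on S2 v" and h: "hr r ?c" using v by (auto simp: sobolev_space_iff)
  have wc: "continuous_on S2 ?w" by (intro continuous_intros vc series_continuous h)
  have z: "fourier_coeff Y ?w l k = 0" if k: "k \<in> {1..2*l+1}" for l k
    using fourier_coeff_series[OF h k]
    by (simp add: fourier_coeff_ip ip_diff_right[OF Y_continuous[OF k] vc series_continuous[OF h]])
  have "square_integrable ?w"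
    unfolding square_integrable_def
    by (intro conjI borel_measurable_surface_continuous integrable_surface_continuous continuous_intros wc)
  then have "(\<lambda>n. l2_norm (\<lambda>x. ?w x - (\<Sum>l\<le>n. \<Sum>k=1..2*l+1. fourier_coeff Y ?w l k * Y l k x))) \<longlonglongrightarrow> 0"
    using onb unfolding harmonic_onb_def by blast
  moreover have "(\<Sum>l\<le>n. \<Sum>k=1..2*l+1. fourier_coeff Y ?w l k * Y l k x) = 0" for n x
    by (intro sum.neutral ballI) (use z in simp)
  ultimately have "(\<lambda>n. l2_norm ?w) \<longlonglongrightarrow> 0" by simp
  then have "l2_norm ?w = 0" by (simp add: LIMSEQ_const_iff)
  then have "ip ?w ?w = 0" using l2_norm_ip[of ?w] by simp
  then have "?w x = 0" using ip_zero_imp[OF wc] x by blast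
  then show ?thesis by simp
qed

lemma series_sobolev:
  assumes c: "hr r c" shows "restrict (series c) S2 \<in> sobolev_space Y r"
  unfolding sobolev_space_iff
proof (intro conjI)
  show "continuous_on S2 (restrict (series c) S2)"
    using series_continuous[OF c] continuous_on_cong[of S2 S2 "restrict (series c) S2" "series c"] by simp
  have "fourier_coeff Y (restrict (series c) S2) l k = c l k" if "k \<in> {1..2*l+1}" for l k
    unfolding fourier_coeff_series[OF c that, symmetric] fourier_coeff_ip by (rule ip_cong) auto
  then show "hr r (fourier_coeff Y (restrict (series c) S2))"
    using c by (intro hr_bounded[OF c, of _ 1]) (simp add: energy_def)
qed simp

lemma series_scale_add:
  assumes "hr r c" "hr r d" "x \<in> S2"
  shows "series (\<lambda>l k. c l k + d l k) x = series c x + series d x"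
    "series (\<lambda>l k. c l k - d l k) x = series c x - series d x"
  using suminf_add[OF summable_comp[OF assms(1,3)] summable_comp[OF assms(2,3)]]
    suminf_diff[OF summable_comp[OF assms(1,3)] summable_comp[OF assms(2,3)]]
  by (simp_all add: series_def comp_add comp_diff)

lemma zonal_op_series:
  assumes \<Phi>: "set_integrable lborel {-1<..<1} \<Phi>" and c: "hr r c" and x: "x \<in> S2"
  shows "zonal_op \<Phi> (series c) x = series (\<lambda>l k. multiplier \<Phi> l * c l k) x"
proof -
  have i: "integrable \<omega> (\<lambda>y. \<Phi> (x \<bullet> y))" by (rule integrable_zonal[OF x \<Phi>])
  have "(LINT y|\<omega>. \<Phi> (x \<bullet> y) * comp c l y) = comp (\<lambda>l k. multiplier \<Phi> l * c l k) l x" for l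
  proof -
    have "(LINT y|\<omega>. \<Phi> (x \<bullet> y) * comp c l y) = (LINT y|\<omega>. (\<Sum>k=1..2*l+1. c l k * (\<Phi> (x \<bullet> y) * Y l k y)))"
      by (simp add: comp_def sum_distrib_left mult.left_commute del: sum.cl_ivl_Suc)
    also have "\<dots> = (\<Sum>k=1..2*l+1. LINT y|\<omega>. c l k * (\<Phi> (x \<bullet> y) * Y l k y))"
      by (intro Bochner_Integration.integral_sum integrable_mult_right integrable_mult_continuous i Y_continuous)
    also have "\<dots> = comp (\<lambda>l k. multiplier \<Phi> l * c l k) l x"
      unfolding comp_def by (rule sum.cong) (simp_all add: funk_hecke[OF x _ \<Phi>])
    finally show ?thesis .
  qed
  then have "(\<lambda>l. comp (\<lambda>l k. multiplier \<Phi> l * c l k) l x) sums zonal_op \<Phi> (series c) x"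
    using integral_series_sums[OF c i] by (simp add: zonal_op_def)
  then show ?thesis by (simp add: series_def sums_unique)
qed

lemma zonal_op_cong: "(\<And>y. y \<in> S2 \<Longrightarrow> v y = w y) \<Longrightarrow> zonal_op \<Phi> v x = zonal_op \<Phi> w x"
  unfolding zonal_op_def by (rule Bochner_Integration.integral_cong) auto

end

section \<open>Quadrature and the discrete schemes\<close>

lemma quad_add: "quad N w x (\<lambda>y. f y + g y) = quad N w x f + quad N w x g"
  by (simp add: quad_def sum.distrib distrib_left)

lemma quad_scale: "quad N w x (\<lambda>y. c * f y) = c * quad N w x f"
  by (simp add: quad_def sum_distrib_left mult.left_commute)

lemma quad_diff: "quad N w x (\<lambda>y. f y - g y) = quad N w x f - quad N w x g"
  by (simp add: quad_def sum_subtractf right_diff_distrib)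

lemma quad_sum: "quad N w x (\<lambda>y. \<Sum>i\<in>I. f i y) = (\<Sum>i\<in>I. quad N w x (f i))"
  unfolding quad_def sum_distrib_left by (rule sum.swap)

context harmonic_basis
begin

lemma poly_space_iff: "p \<in> poly_space Y n \<longleftrightarrow> p \<in> extensional S2 \<and> p \<in> sph_poly n"
proof
  assume "p \<in> poly_space Y n"
  then obtain c where p: "p = (\<lambda>x\<in>S2. \<Sum>l\<le>n. \<Sum>k=1..2*l+1. c l k * Y l k x)"
    by (auto simp: poly_space_def)
  have "(\<lambda>x. \<Sum>l\<le>n. \<Sum>k=1..2*l+1. c l k * Y l k x) \<in> sph_poly n"
    by (intro sph_poly_sum sph_poly.scale) (auto intro: sph_poly_mono[OF Y_poly])
  then have "p \<in> sph_poly n" by (rule sph_poly.cong) (simp add: p)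
  then show "p \<in> extensional S2 \<and> p \<in> sph_poly n" by (simp add: p)
next
  assume p: "p \<in> extensional S2 \<and> p \<in> sph_poly n"
  have "p x = (\<Sum>l\<le>n. \<Sum>k=1..2*l+1. ip (Y l k) p * Y l k x)" if "x \<in> S2" for x
    using sph_poly_expand[of p n x] p that sum_idx[of "\<lambda>l k. ip (Y l k) p * Y l k x" n] by (simp add: YY_def)
  then have "p = (\<lambda>x\<in>S2. \<Sum>l\<le>n. \<Sum>k=1..2*l+1. ip (Y l k) p * Y l k x)"
    using p by (intro extensionalityI[of p S2]) auto
  then show "p \<in> poly_space Y n" unfolding poly_space_def by (intro CollectI exI) simp
qed

lemma restrict_poly_space: "q \<in> sph_poly n \<Longrightarrow> restrict q S2 \<in> poly_space Y n"
  unfolding poly_space_iff by (auto intro: sph_poly.cong)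

end

section \<open>Discrete least squares and regularity of the rules\<close>

locale quadrature = harmonic_basis +
  fixes n N :: nat and w :: "nat \<Rightarrow> real" and x :: "nat \<Rightarrow> real ^ 3" and \<eta> :: real
  assumes rule: "positive_rule N w x" and mz: "mz_condition Y n N w x \<eta>"
begin

abbreviation "Q \<equiv> quad N w x"

lemma node: "j \<in> {1..N} \<Longrightarrow> x j \<in> S2" and weight_pos: "j \<in> {1..N} \<Longrightarrow> w j > 0"
  using rule by (auto simp: positive_rule_def)

lemma eta: "0 \<le> \<eta>" "\<eta> < 1"
  using mz by (auto simp: mz_condition_def)

lemma Q_cong: "(\<And>y. y \<in> S2 \<Longrightarrow> f y = g y) \<Longrightarrow> Q f = Q g"
  unfolding quad_def by (rule sum.cong) (use node in auto)

lemma Q_mono: "(\<And>y. y \<in> S2 \<Longrightarrow> f y \<le> g y) \<Longrightarrow> Q f \<le> Q g"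
  unfolding quad_def by (rule sum_mono) (use node weight_pos in \<open>auto intro!: mult_left_mono less_imp_le\<close>)

lemma Q_nonneg: "(\<And>y. y \<in> S2 \<Longrightarrow> 0 \<le> f y) \<Longrightarrow> 0 \<le> Q f"
  using Q_mono[of "\<lambda>_. 0" f] by (simp add: quad_def)

lemma Q_square_zero:
  assumes "Q (\<lambda>y. (f y)\<^sup>2) = 0" shows "Q (\<lambda>y. g y * f y) = 0"
proof -
  have "w j * (f (x j))\<^sup>2 = 0" if "j \<in> {1..N}" for j
    using assms that sum_nonneg_eq_0_iff[of "{1..N}" "\<lambda>j. w j * (f (x j))\<^sup>2"] weight_pos
    by (auto simp: quad_def less_imp_le)
  then have "f (x j) = 0" if "j \<in> {1..N}" for j using that weight_pos[OF that] by fastforce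
  then show ?thesis by (simp add: quad_def)
qed

lemma mz_sph_poly:
  assumes q: "q \<in> sph_poly n"
  shows "(1 - \<eta>) * ip q q \<le> Q (\<lambda>y. (q y)\<^sup>2)" "Q (\<lambda>y. (q y)\<^sup>2) \<le> (1 + \<eta>) * ip q q"
proof -
  let ?q = "restrict q S2"
  have "ip ?q ?q = ip q q" by (rule ip_cong) auto
  moreover have "Q (\<lambda>y. \<bar>?q y\<bar>\<^sup>2) = Q (\<lambda>y. (q y)\<^sup>2)" by (rule Q_cong) simp
  ultimately show "(1 - \<eta>) * ip q q \<le> Q (\<lambda>y. (q y)\<^sup>2)" "Q (\<lambda>y. (q y)\<^sup>2) \<le> (1 + \<eta>) * ip q q"
    using mz restrict_poly_space[OF q] unfolding mz_condition_def l2_norm_ip by auto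
qed

text \<open>Regularity of the rule beyond degree \<open>n\<close>: with \<open>m = M + n\<close>, the kernel of degree \<open>m\<close> reproduces
  \<open>p \<cdot> ker n z\<close>, so \<open>p z \<cdot> ker n z z = \<integral> p \<cdot> ker n z \<cdot> ker m z\<close>. After Cauchy--Schwarz
  the nodes only enter through \<open>ker n\<close>, to which the Marcinkiewicz--Zygmund bound applies.\<close>

lemma quadrature_regularity:
  assumes p: "p \<in> sph_poly M"
  shows "Q (\<lambda>z. (p z)\<^sup>2) \<le> (1 + \<eta>) * ((real M + real n + 1) / (real n + 1))\<^sup>2 * ip p p"
proof -
  define a where "a = (real n + 1)\<^sup>2 / (4 * pi)"
  define b where "b = (real (M + n) + 1)\<^sup>2 / (4 * pi)"
  have a: "a > 0" by (simp add: a_def add_pos_nonneg)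
  have b: "b > 0" by (simp add: b_def add_pos_nonneg)
  have pc: "continuous_on S2 p" using p by (rule sph_poly_continuous)
  let ?G = "\<lambda>z y. p y * ker n z y"
  have G: "?G z \<in> sph_poly (M + n)" for z by (intro sph_poly_mult p ker_poly)
  have kk: "ip (ker m z) (ker m z) = (real m + 1)\<^sup>2 / (4 * pi)" if "z \<in> S2" for m z
    using ker_reproducing[OF ker_poly that] ker_diag[OF that] by simp
  have pw: "(a * p z)\<^sup>2 \<le> b * (LINT y|\<omega>. (p y)\<^sup>2 * (ker n z y)\<^sup>2)" if z: "z \<in> S2" for z
  proof -
    have "a * p z = ip (ker (M + n) z) (?G z)"
      using ker_reproducing[OF G z, of z] by (simp add: ker_diag[OF z] a_def)
    then have "(a * p z)\<^sup>2 \<le> ip (ker (M + n) z) (ker (M + n) z) * ip (?G z) (?G z)"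
      using ip_cauchy_schwarz[OF ker_continuous sph_poly_continuous[OF G], of "M + n" z z] by simp
    then show ?thesis
      unfolding kk[OF z] b_def[symmetric] by (simp add: ip_def power2_eq_square mult_ac)
  qed
  have "a\<^sup>2 * Q (\<lambda>z. (p z)\<^sup>2) = Q (\<lambda>z. (a * p z)\<^sup>2)"
    unfolding power_mult_distrib quad_scale ..
  also have "\<dots> \<le> Q (\<lambda>z. b * (LINT y|\<omega>. (p y)\<^sup>2 * (ker n z y)\<^sup>2))"
    by (rule Q_mono[OF pw])
  also have "\<dots> = b * Q (\<lambda>z. LINT y|\<omega>. (p y)\<^sup>2 * (ker n z y)\<^sup>2)"
    by (rule quad_scale)
  also have "\<dots> = b * (LINT y|\<omega>. Q (\<lambda>z. (p y)\<^sup>2 * (ker n z y)\<^sup>2))"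
    unfolding quad_def
    by (subst Bochner_Integration.integral_sum)
       (auto intro!: integrable_surface_continuous continuous_intros pc ker_continuous)
  also have "\<dots> \<le> b * (LINT y|\<omega>. (p y)\<^sup>2 * ((1 + \<eta>) * a))"
  proof (rule mult_left_mono[OF integral_mono])
    show "integrable \<omega> (\<lambda>y. Q (\<lambda>z. (p y)\<^sup>2 * (ker n z y)\<^sup>2))"
      unfolding quad_def by (intro integrable_surface_continuous continuous_intros pc ker_continuous)
    show "integrable \<omega> (\<lambda>y. (p y)\<^sup>2 * ((1 + \<eta>) * a))"
      by (intro integrable_surface_continuous continuous_intros pc)
    fix y assume "y \<in> space \<omega>"
    then have y: "y \<in> S2" by simp
    have "Q (\<lambda>z. (ker n z y)\<^sup>2) = Q (\<lambda>z. (ker n y z)\<^sup>2)" by (simp add: ker_commute)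
    also have "\<dots> \<le> (1 + \<eta>) * a"
      using mz_sph_poly(2)[OF ker_poly, of y] by (simp add: kk[OF y] a_def)
    finally show "Q (\<lambda>z. (p y)\<^sup>2 * (ker n z y)\<^sup>2) \<le> (p y)\<^sup>2 * ((1 + \<eta>) * a)"
      unfolding quad_scale by (rule mult_left_mono) simp
  qed (use b in simp)
  also have "\<dots> = a * (b * (1 + \<eta>) * ip p p)"
    unfolding ip_def power2_eq_square integral_mult_left_zero by (simp add: mult_ac)
  finally have "a * (a * Q (\<lambda>z. (p z)\<^sup>2)) \<le> a * (b * (1 + \<eta>) * ip p p)"
    by (simp add: power2_eq_square mult_ac)
  then have "a * Q (\<lambda>z. (p z)\<^sup>2) \<le> b * (1 + \<eta>) * ip p p" using a by simp
  then have "Q (\<lambda>z. (p z)\<^sup>2) \<le> (1 + \<eta>) * (b / a) * ip p p" using a by (simp add: field_simps)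
  also have "b / a = ((real M + real n + 1) / (real n + 1))\<^sup>2"
    by (simp add: a_def b_def power_divide)
  finally show ?thesis .
qed

text \<open>Gram--Schmidt for the discrete form, which may be degenerate on the functions
  \<open>b\<close>. Correcting along the residual \<open>b'\<close> of the new function preserves
  the orthogonality already reached on \<open>I\<close>.\<close>

lemma discrete_projection:
  assumes "finite I"
  shows "\<exists>c. \<forall>i\<in>I. Q (\<lambda>y. (v y - (\<Sum>j\<in>I. c j * b j y)) * b i y) = 0"
  using assms
proof (induction I arbitrary: v rule: finite_induct)
  case (insert a I)
  obtain c where c: "\<And>i. i \<in> I \<Longrightarrow> Q (\<lambda>y. (v y - (\<Sum>j\<in>I. c j * b j y)) * b i y) = 0"
    using insert.IH[of v] by blast
  obtain e where e: "\<And>i. i \<in> I \<Longrightarrow> Q (\<lambda>y. (b a y - (\<Sum>j\<in>I. e j * b j y)) * b i y) = 0"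
    using insert.IH[of "b a"] by blast
  define p where "p y = v y - (\<Sum>j\<in>I. c j * b j y)" for y
  define b' where "b' y = b a y - (\<Sum>j\<in>I. e j * b j y)" for y
  \<comment> \<open>If \<open>b'\<close> has discrete norm zero, division by zero gives t = 0;
    orthogonality to \<open>b'\<close> still holds because \<open>b'\<close> then vanishes at every
    node.\<close>
  define t where "t = Q (\<lambda>y. p y * b' y) / Q (\<lambda>y. (b' y)\<^sup>2)"
  let ?c = "\<lambda>j. if j = a then t else c j - t * e j"
  have res: "v y - (\<Sum>j\<in>insert a I. ?c j * b j y) = p y - t * b' y" for y
  proof -
    have "(\<Sum>j\<in>I. ?c j * b j y) = (\<Sum>j\<in>I. c j * b j y - t * (e j * b j y))"
      by (rule sum.cong) (use insert.hyps in \<open>auto simp: algebra_simps\<close>)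
    then show ?thesis using insert.hyps
      by (simp add: p_def b'_def sum_subtractf sum_distrib_left algebra_simps)
  qed
  have lin: "Q (\<lambda>y. (p y - t * b' y) * g y) = Q (\<lambda>y. p y * g y) - t * Q (\<lambda>y. b' y * g y)" for g
    by (simp only: left_diff_distrib quad_diff mult.assoc quad_scale)
  have I: "Q (\<lambda>y. (p y - t * b' y) * b i y) = 0" if "i \<in> I" for i
    unfolding lin using c[OF that] e[OF that] by (simp add: p_def b'_def)
  have "Q (\<lambda>y. (p y - t * b' y) * b' y) = 0"
    unfolding lin using Q_square_zero[of b' p] by (auto simp: t_def power2_eq_square)
  moreover have "Q (\<lambda>y. (p y - t * b' y) * b a y) =
      Q (\<lambda>y. (p y - t * b' y) * b' y) + (\<Sum>j\<in>I. e j * Q (\<lambda>y. (p y - t * b' y) * b j y))"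
    unfolding quad_scale[symmetric] quad_sum[symmetric] quad_add[symmetric]
  proof (rule arg_cong[where f = Q], rule ext)
    fix y
    have "b a y = b' y + (\<Sum>j\<in>I. e j * b j y)" by (simp add: b'_def)
    then show "(p y - t * b' y) * b a y = (p y - t * b' y) * b' y + (\<Sum>j\<in>I. e j * ((p y - t * b' y) * b j y))"
      by (simp only: distrib_left sum_distrib_left mult.left_commute)
  qed
  ultimately have "Q (\<lambda>y. (p y - t * b' y) * b a y) = 0" using I by simp
  then show ?case using I by (intro exI[of _ ?c]) (simp only: res, blast)
qed simp

text \<open>The projection is characterised by orthogonality, and only through its values on the
  sphere, so that Galerkin equations and least-squares minimisation reduce to the same
  relation.\<close>

definition normal_eq :: "(real ^ 3 \<Rightarrow> real) \<Rightarrow> (real ^ 3 \<Rightarrow> real) \<Rightarrow> bool" where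
  "normal_eq v p \<longleftrightarrow> p \<in> sph_poly n \<and> (\<forall>q\<in>sph_poly n. Q (\<lambda>y. (v y - p y) * q y) = 0)"

lemma normal_eq_exists: "\<exists>p. normal_eq v p"
proof -
  obtain c where c: "\<And>i. i \<in> idx n \<Longrightarrow> Q (\<lambda>y. (v y - (\<Sum>j\<in>idx n. c j * YY j y)) * YY i y) = 0"
    using discrete_projection[OF finite_idx] by blast
  let ?p = "\<lambda>y. \<Sum>j\<in>idx n. c j * YY j y"
  have "Q (\<lambda>y. (v y - ?p y) * q y) = 0" if q: "q \<in> sph_poly n" for q
  proof -
    have "Q (\<lambda>y. (v y - ?p y) * q y) = Q (\<lambda>y. \<Sum>i\<in>idx n. ip (YY i) q * ((v y - ?p y) * YY i y))"
      by (rule Q_cong, subst sph_poly_expand[OF q]) (simp_all add: sum_distrib_left mult_ac)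
    also have "\<dots> = 0" unfolding quad_sum quad_scale using c by simp
    finally show ?thesis .
  qed
  moreover have "?p \<in> sph_poly n" by (intro sph_poly_sum sph_poly.scale YY_poly)
  ultimately show ?thesis unfolding normal_eq_def by blast
qed

lemma sph_poly_Q_zero:
  assumes q: "q \<in> sph_poly n" and z: "Q (\<lambda>y. (q y)\<^sup>2) \<le> 0" and y: "y \<in> S2" shows "q y = 0"
proof -
  have "(1 - \<eta>) * ip q q \<le> 0" using mz_sph_poly(1)[OF q] z by linarith
  then have "ip q q = 0" using eta ip_nonneg[of q] by (simp add: mult_le_0_iff)
  then show ?thesis using ip_zero_imp[OF sph_poly_continuous[OF q]] y by blast
qed

lemma normal_eq_unique:
  assumes p: "normal_eq v p" and p': "normal_eq v p'" and y: "y \<in> S2" shows "p y = p' y"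
proof -
  let ?q = "\<lambda>y. p y - p' y"
  have q: "?q \<in> sph_poly n" using p p' by (auto simp: normal_eq_def intro: sph_poly_diff)
  have "Q (\<lambda>y. (?q y)\<^sup>2) = Q (\<lambda>y. (v y - p' y) * ?q y) - Q (\<lambda>y. (v y - p y) * ?q y)"
    unfolding quad_diff[symmetric] by (rule Q_cong) (simp add: power2_eq_square algebra_simps)
  also have "\<dots> = 0" using p p' q by (simp add: normal_eq_def)
  finally show ?thesis using sph_poly_Q_zero[OF q _ y] by simp
qed

text \<open>Pythagoras for the discrete form: a competitor exceeds the minimum by the squared
  discrete norm of its difference to \<open>p\<close>, and on degree \<open>n\<close> this norm is
  definite by the lower Marcinkiewicz--Zygmund bound.\<close>

lemma wls_proj_normal_eq:
  assumes p: "normal_eq v p" shows "wls_proj Y n N w x v = restrict p S2"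
proof -
  let ?f = "\<lambda>p. \<Sum>j=1..N. w j * \<bar>v (x j) - p (x j)\<bar>\<^sup>2"
  have f: "?f p = Q (\<lambda>y. (v y - p y)\<^sup>2)" for p by (simp add: quad_def)
  have pyth: "?f q = ?f (restrict p S2) + Q (\<lambda>y. (q y - p y)\<^sup>2)" if q: "q \<in> sph_poly n" for q
  proof -
    have d: "(\<lambda>y. q y - p y) \<in> sph_poly n" using p q by (auto simp: normal_eq_def intro: sph_poly_diff)
    have "Q (\<lambda>y. (v y - q y)\<^sup>2) = Q (\<lambda>y. (v y - p y)\<^sup>2 + (q y - p y)\<^sup>2 - 2 * ((v y - p y) * (q y - p y)))"
      by (rule Q_cong) (simp add: power2_eq_square algebra_simps)
    also have "\<dots> = Q (\<lambda>y. (v y - p y)\<^sup>2) + Q (\<lambda>y. (q y - p y)\<^sup>2)"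
      unfolding quad_diff quad_add quad_scale using p d by (simp add: normal_eq_def)
    also have "Q (\<lambda>y. (v y - p y)\<^sup>2) = Q (\<lambda>y. (v y - restrict p S2 y)\<^sup>2)" by (rule Q_cong) simp
    finally show ?thesis unfolding f .
  qed
  have pp: "restrict p S2 \<in> poly_space Y n" using p restrict_poly_space by (auto simp: normal_eq_def)
  show ?thesis unfolding wls_proj_def
  proof (rule the_equality)
    show "is_arg_min ?f (\<lambda>p. p \<in> poly_space Y n) (restrict p S2)"
      unfolding is_arg_min_linorder using pp pyth Q_nonneg[of "\<lambda>y. (_ y - p y)\<^sup>2"]
      by (auto simp: poly_space_iff)
    fix q assume "is_arg_min ?f (\<lambda>p. p \<in> poly_space Y n) q"
    then have q: "q \<in> poly_space Y n" and le: "?f q \<le> ?f (restrict p S2)"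
      using pp by (auto simp: is_arg_min_linorder)
    have qs: "q \<in> sph_poly n" using q by (simp add: poly_space_iff)
    have "Q (\<lambda>y. (q y - p y)\<^sup>2) \<le> 0" using le pyth[OF qs] by simp
    moreover have "(\<lambda>y. q y - p y) \<in> sph_poly n" using p qs by (auto simp: normal_eq_def intro: sph_poly_diff)
    ultimately have "q y = p y" if "y \<in> S2" for y using sph_poly_Q_zero[OF _ _ that] by fastforce
    then show "q = restrict p S2"
      using q by (intro extensionalityI[of q S2]) (auto simp: poly_space_iff)
  qed
qed

end

section \<open>The equation and the Sloan iteration on coefficients\<close>

locale zonal_equation = sobolev_basis +
  fixes \<Phi> :: "real \<Rightarrow> real" and \<beta> C\<^sub>T \<delta> :: real
  assumes \<Phi>: "set_integrable lborel {-1<..<1} \<Phi>"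
    and pos: "\<beta> > 0" "C\<^sub>T > 0" "\<delta> > 0"
    and decay: "\<And>l. \<bar>multiplier \<Phi> l\<bar> \<le> C\<^sub>T * (1 + real l) powr (- \<beta>)"
    and gap: "\<And>l. \<bar>1 - multiplier \<Phi> l\<bar> \<ge> \<delta>"
begin

abbreviation "\<mu> \<equiv> multiplier \<Phi>"

lemma mu_bound: "\<bar>\<mu> l\<bar> \<le> C\<^sub>T"
proof -
  have "(1 + real l) powr (- \<beta>) \<le> 1 powr (- \<beta>)"
    using pos by (intro powr_mono2') auto
  then have "C\<^sub>T * (1 + real l) powr (- \<beta>) \<le> C\<^sub>T * 1"
    by (intro mult_left_mono) (use pos in auto)
  then show ?thesis using decay[of l] by linarith
qed

lemma one_minus_mu: "1 - \<mu> l \<noteq> 0"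
  using gap[of l] pos by auto

text \<open>The action of the resolvent (I - T)^(-1) on coefficients.\<close>

definition res :: "(nat \<Rightarrow> nat \<Rightarrow> real) \<Rightarrow> nat \<Rightarrow> nat \<Rightarrow> real" where
  "res c l k = 1 / (1 - \<mu> l) * c l k"

lemma hr_res: "hr r c \<Longrightarrow> hr r (res c)"
proof -
  assume c: "hr r c"
  have "\<bar>1 / (1 - \<mu> l)\<bar> \<le> 1 / \<delta>" for l
    using gap[of l] pos one_minus_mu[of l] by (simp add: divide_simps)
  from hr_scale[OF c this] show ?thesis by (simp add: res_def[abs_def])
qed

lemma hr_mu: "hr r c \<Longrightarrow> hr r (\<lambda>l k. \<mu> l * c l k)"
  using hr_scale mu_bound by blast

lemma hr_mu_power: "hr r c \<Longrightarrow> hr r (\<lambda>l k. \<mu> l ^ q * c l k)"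
proof (induction q)
  case (Suc q)
  then show ?case using hr_mu[OF Suc.IH[OF Suc.prems]] by (simp add: mult.assoc)
qed simp

lemma res_minus: "res c l k - \<mu> l * res c l k = c l k"
proof -
  have "res c l k - \<mu> l * res c l k = (1 - \<mu> l) * (1 / (1 - \<mu> l)) * c l k"
    unfolding res_def by (simp only: left_diff_distrib mult_1 mult.assoc)
  then show ?thesis using one_minus_mu[of l] by simp
qed

lemma res_unique: "d - \<mu> l * d = c l k \<Longrightarrow> d = res c l k"
  using one_minus_mu[of l] by (simp add: res_def field_simps)

lemma zonal_series:
  assumes "hr r c" "x \<in> S2" shows "zonal_op \<Phi> (series c) x = series (\<lambda>l k. \<mu> l * c l k) x"
  by (rule zonal_op_series[OF \<Phi> assms])

lemma zonal_restrict: "zonal_op \<Phi> (restrict v S2) y = zonal_op \<Phi> v y"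
  by (rule zonal_op_cong) simp

lemma series_minus_zonal:
  assumes "hr r c" "x \<in> S2"
  shows "series c x - zonal_op \<Phi> (series c) x = series (\<lambda>l k. c l k - \<mu> l * c l k) x"
  unfolding zonal_series[OF assms] series_scale_add(2)[OF assms(1) hr_mu[OF assms(1)] assms(2)] ..

text \<open>I - T multiplies the coefficients by \<open>1 - \<mu> l\<close>, which never vanishes,
  so existence and uniqueness both come from comparing coefficients.\<close>

lemma exact_solution_series:
  assumes f: "f \<in> sobolev_space Y r" and x: "x \<in> S2"
  shows "exact_solution Y r \<Phi> f x = series (res (fourier_coeff Y f)) x"
proof -
  let ?c = "fourier_coeff Y f" let ?u = "restrict (series (res ?c)) S2"
  have c: "hr r ?c" using f by (simp add: sobolev_space_iff)
  have "exact_solution Y r \<Phi> f = ?u"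
    unfolding exact_solution_def
  proof (rule the_equality)
    have "?u x - zonal_op \<Phi> ?u x = f x" if "x \<in> S2" for x
      using that series_minus_zonal[OF hr_res[OF c] that] sobolev_series[OF f that]
      by (simp add: res_minus zonal_restrict)
    then show "?u \<in> sobolev_space Y r \<and> (\<forall>x\<in>S2. ?u x - zonal_op \<Phi> ?u x = f x)"
      using series_sobolev[OF hr_res[OF c]] by blast
    fix u assume u: "u \<in> sobolev_space Y r \<and> (\<forall>x\<in>S2. u x - zonal_op \<Phi> u x = f x)"
    let ?d = "fourier_coeff Y u"
    have d: "hr r ?d" and us: "\<And>x. x \<in> S2 \<Longrightarrow> u x = series ?d x"
      using u sobolev_series by (auto simp: sobolev_space_iff)
    have "series (\<lambda>l k. ?d l k - \<mu> l * ?d l k) x = series ?c x" if "x \<in> S2" for x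
    proof -
      have "u x - zonal_op \<Phi> u x = f x" using u that by blast
      then show ?thesis
        using us[OF that] series_minus_zonal[OF d that] sobolev_series[OF f that]
          zonal_op_cong[of u "series ?d" \<Phi> x, OF us] by simp
    qed
    then have "?d l k - \<mu> l * ?d l k = ?c l k" if "k \<in> {1..2*l+1}" for l k
      using series_eq_imp[OF hr_diff[OF d hr_mu[OF d]] c _ that] by simp
    then have "?d l k = res ?c l k" if "k \<in> {1..2*l+1}" for l k
      using res_unique that by blast
    then have "u x = ?u x" if "x \<in> S2" for x
      using us[OF that] series_cong[of ?d "res ?c" x] that by simp
    then show "u = ?u" using u by (intro extensionalityI[of u S2]) (auto simp: sobolev_space_iff)
  qed
  then show ?thesis using x by simp
qed

text \<open>The exact solution is a fixed point of the Sloan step, so a step multiplies the error by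
  T. Writing the iterate as solution minus error keeps it a series to which
  \<open>zonal_series\<close> applies.\<close>

lemma sloan_error_series:
  assumes f: "f \<in> sobolev_space Y r" and e: "hr r e" and v: "\<And>y. y \<in> S2 \<Longrightarrow> v y = series e y"
    and y: "y \<in> S2"
  shows "series (res (fourier_coeff Y f)) y - sloan \<Phi> f q v y =
    series (\<lambda>l k. \<mu> l ^ q * (res (fourier_coeff Y f) l k - e l k)) y"
  using y
proof (induction q arbitrary: y)
  case 0
  have c: "hr r (fourier_coeff Y f)" using f by (simp add: sobolev_space_iff)
  show ?case using series_scale_add(2)[OF hr_res[OF c] e 0] v[OF 0] by simp
next
  case (Suc q)
  let ?c = "fourier_coeff Y f" let ?u = "res ?c"
  let ?a = "\<lambda>l k. \<mu> l ^ q * (?u l k - e l k)"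
  let ?h = "\<lambda>l k. ?u l k - ?a l k"
  have c: "hr r ?c" using f by (simp add: sobolev_space_iff)
  have u: "hr r ?u" by (rule hr_res[OF c])
  have a: "hr r ?a" by (intro hr_mu_power hr_diff u e)
  have h: "hr r ?h" by (intro hr_diff u a)
  have "sloan \<Phi> f q v y = series ?h y" if "y \<in> S2" for y
    using Suc.IH[OF that] series_scale_add(2)[OF u a that] by simp
  then have "zonal_op \<Phi> (sloan \<Phi> f q v) y = series (\<lambda>l k. \<mu> l * ?h l k) y"
    using zonal_op_cong[of "sloan \<Phi> f q v" "series ?h" \<Phi> y] zonal_series[OF h Suc.prems] by simp
  then have "series ?u y - sloan \<Phi> f (Suc q) v y = series ?u y - series ?c y - series (\<lambda>l k. \<mu> l * ?h l k) y"
    using sobolev_series[OF f Suc.prems] by simp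
  also have "\<dots> = series (\<lambda>l k. ?u l k - ?c l k - \<mu> l * ?h l k) y"
    using series_scale_add(2)[OF u c Suc.prems] series_scale_add(2)[OF hr_diff[OF u c] hr_mu[OF h] Suc.prems] by simp
  also have "(\<lambda>l k. ?u l k - ?c l k - \<mu> l * ?h l k) = (\<lambda>l k. \<mu> l ^ Suc q * (?u l k - e l k))"
  proof (intro ext)
    fix l k
    have "?c l k = ?u l k - \<mu> l * ?u l k" by (simp add: res_minus)
    then show "?u l k - ?c l k - \<mu> l * ?h l k = \<mu> l ^ Suc q * (?u l k - e l k)"
      by (simp add: algebra_simps)
  qed
  finally show ?case .
qed

lemma series_finite: "(\<And>l k. l > n \<Longrightarrow> c l k = 0) \<Longrightarrow> series c y = (\<Sum>l\<le>n. comp c l y)"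
  unfolding series_def by (rule suminf_finite) (auto simp: comp_def)

lemma series_finite_poly: "(\<And>l k. l > n \<Longrightarrow> c l k = 0) \<Longrightarrow> series c \<in> sph_poly n"
proof -
  assume c: "\<And>l k. l > n \<Longrightarrow> c l k = 0"
  have "series c = (\<lambda>y. \<Sum>l\<le>n. comp c l y)" by (rule ext) (rule series_finite[OF c])
  then show ?thesis by (auto intro!: sph_poly_sum sph_poly_mono[OF comp_poly])
qed

text \<open>The explicit cutoff makes the array finite for every \<open>p\<close>, so it lies in all
  Sobolev classes, and above degree \<open>n\<close> the coefficients of \<open>f\<close> are left
  unchanged when it is subtracted.\<close>

definition coeffs :: "nat \<Rightarrow> (real ^ 3 \<Rightarrow> real) \<Rightarrow> nat \<Rightarrow> nat \<Rightarrow> real" where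
  "coeffs n p l k = (if l \<le> n then ip (Y l k) p else 0)"

lemma coeffs_zero: "l > n \<Longrightarrow> coeffs n p l k = 0"
  by (simp add: coeffs_def)

lemma hr_coeffs: "hr r (coeffs n p)"
  by (rule hr_finite) (rule coeffs_zero)

lemma series_coeffs:
  assumes p: "p \<in> sph_poly n" and y: "y \<in> S2" shows "series (coeffs n p) y = p y"
proof -
  have "series (coeffs n p) y = (\<Sum>l\<le>n. comp (coeffs n p) l y)" by (rule series_finite) (rule coeffs_zero)
  also have "\<dots> = (\<Sum>l\<le>n. \<Sum>k=1..2*l+1. ip (Y l k) p * Y l k y)"
    by (simp add: comp_def coeffs_def)
  also have "\<dots> = p y"
    using sph_poly_expand[OF p y] sum_idx[of "\<lambda>l k. ip (Y l k) p * Y l k y" n] by (simp add: YY_def)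
  finally show ?thesis .
qed

end

section \<open>Closed forms of the two schemes\<close>

locale discrete_scheme = zonal_equation Y r \<Phi> \<beta> C\<^sub>T \<delta> + quadrature Y n N w x \<eta>
  for Y r \<Phi> \<beta> C\<^sub>T \<delta> n N w x \<eta> +
  fixes f :: "real ^ 3 \<Rightarrow> real" and p :: "real ^ 3 \<Rightarrow> real"
  assumes f: "f \<in> sobolev_space Y r" and p: "normal_eq f p"
begin

abbreviation "cf \<equiv> fourier_coeff Y f"
abbreviation "cp \<equiv> coeffs n p"

lemma hr_cf: "hr r cf" using f by (simp add: sobolev_space_iff)

lemma p_poly: "p \<in> sph_poly n" using p by (simp add: normal_eq_def)

lemma res_cp_zero: "l > n \<Longrightarrow> res cp l k = 0"
  by (simp add: res_def coeffs_zero)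

lemma res_cp_poly: "series (res cp) \<in> sph_poly n"
  by (rule series_finite_poly) (rule res_cp_zero)

text \<open>Common core of both uniqueness proofs: the discrete projection of \<open>f\<close> is
  unique on the sphere, and \<open>res\<close> inverts the diagonal action of I - T.\<close>

lemma galerkin_unique:
  assumes d: "\<And>l k. l > n \<Longrightarrow> d l k = 0" and N: "normal_eq f (series (\<lambda>l k. d l k - \<mu> l * d l k))"
    and k: "k \<in> {1..2*l+1}"
  shows "d l k = res cp l k"
proof -
  have hd: "hr r d" by (rule hr_finite) (rule d)
  have "series (\<lambda>l k. d l k - \<mu> l * d l k) y = series cp y" if "y \<in> S2" for y
    using normal_eq_unique[OF N p that] series_coeffs[OF p_poly that] by simp
  then have "d l k - \<mu> l * d l k = cp l k"
    using series_eq_imp[OF hr_diff[OF hd hr_mu[OF hd]] hr_coeffs _ k] by simp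
  then show ?thesis by (rule res_unique)
qed

text \<open>T preserves polynomials of degree \<open>n\<close>, so the Galerkin equations say that
  (I - T) u is the discrete projection \<open>p\<close> of \<open>f\<close>.\<close>

lemma galerkin_series: "galerkin_solution Y \<Phi> n N w x f = restrict (series (res cp)) S2"
  unfolding galerkin_solution_def
proof (rule the_equality)
  let ?u = "restrict (series (res cp)) S2"
  have up: "?u y - zonal_op \<Phi> ?u y = p y" if "y \<in> S2" for y
    using series_minus_zonal[OF hr_res[OF hr_coeffs] that] series_coeffs[OF p_poly that] that
    by (simp add: zonal_restrict res_minus)
  have "Q (\<lambda>y. (?u y - zonal_op \<Phi> ?u y) * q y) = Q (\<lambda>y. f y * q y)" if "q \<in> poly_space Y n" for q
  proof -
    have "Q (\<lambda>y. (?u y - zonal_op \<Phi> ?u y) * q y) = Q (\<lambda>y. p y * q y)"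
      by (rule Q_cong) (use up in simp)
    moreover have "Q (\<lambda>y. (f y - p y) * q y) = 0"
      using p that by (simp add: normal_eq_def poly_space_iff)
    ultimately show ?thesis by (simp add: left_diff_distrib quad_diff)
  qed
  then show "?u \<in> poly_space Y n \<and> (\<forall>q\<in>poly_space Y n. Q (\<lambda>y. (?u y - zonal_op \<Phi> ?u y) * q y) = Q (\<lambda>y. f y * q y))"
    using restrict_poly_space[OF res_cp_poly] by blast
  fix u assume u: "u \<in> poly_space Y n \<and> (\<forall>q\<in>poly_space Y n. Q (\<lambda>y. (u y - zonal_op \<Phi> u y) * q y) = Q (\<lambda>y. f y * q y))"
  let ?d = "coeffs n u"
  have us: "u y = series ?d y" if "y \<in> S2" for y
    using u that series_coeffs by (simp add: poly_space_iff)
  let ?g = "series (\<lambda>l k. ?d l k - \<mu> l * ?d l k)"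
  have ug: "u y - zonal_op \<Phi> u y = ?g y" if "y \<in> S2" for y
    using series_minus_zonal[OF hr_coeffs that] us[OF that] zonal_op_cong[of u "series ?d" \<Phi> y, OF us] by simp
  have "normal_eq f ?g"
    unfolding normal_eq_def
  proof (intro conjI ballI)
    show "?g \<in> sph_poly n" by (rule series_finite_poly) (simp add: coeffs_zero)
    fix q assume q: "q \<in> sph_poly n"
    have "Q (\<lambda>y. (u y - zonal_op \<Phi> u y) * restrict q S2 y) = Q (\<lambda>y. f y * restrict q S2 y)"
      using u restrict_poly_space[OF q] by blast
    moreover have "Q (\<lambda>y. (u y - zonal_op \<Phi> u y) * restrict q S2 y) = Q (\<lambda>y. ?g y * q y)"
      by (rule Q_cong) (use ug in simp)
    moreover have "Q (\<lambda>y. f y * restrict q S2 y) = Q (\<lambda>y. f y * q y)"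
      by (rule Q_cong) simp
    ultimately show "Q (\<lambda>y. (f y - ?g y) * q y) = 0" by (simp add: left_diff_distrib quad_diff)
  qed
  then have "?d l k = res cp l k" if "k \<in> {1..2*l+1}" for l k
    using galerkin_unique[of ?d, OF coeffs_zero _ that] by simp
  then have "u y = ?u y" if "y \<in> S2" for y
    using us[OF that] series_cong[of ?d "res cp" y] that by simp
  then show "u = ?u" using u by (intro extensionalityI[of u S2]) (auto simp: poly_space_iff)
qed

text \<open>With e = (I - T)^(-1) p, the candidate u = f + T e satisfies u - e = f - p. Hence e is
  the discrete projection of u, and u solves the Nystroem equation.\<close>

lemma nystrom_series:
  "nystrom_solution Y r \<Phi> n N w x f = restrict (series (\<lambda>l k. cf l k + \<mu> l * res cp l k)) S2"
  unfolding nystrom_solution_def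
proof (rule the_equality)
  let ?g = "\<lambda>l k. cf l k + \<mu> l * res cp l k"
  let ?u = "restrict (series ?g) S2"
  have e: "hr r (res cp)" by (rule hr_res[OF hr_coeffs])
  have g: "hr r ?g" by (intro hr_add hr_cf hr_mu e)
  have gy: "series ?g y = f y + zonal_op \<Phi> (series (res cp)) y" if "y \<in> S2" for y
    using series_scale_add(1)[OF hr_cf hr_mu[OF e] that] zonal_series[OF e that] sobolev_series[OF f that] by simp
  have ep: "series (res cp) y - zonal_op \<Phi> (series (res cp)) y = p y" if "y \<in> S2" for y
    using series_minus_zonal[OF e that] series_coeffs[OF p_poly that] by (simp add: res_minus)
  have "normal_eq ?u (series (res cp))"
    unfolding normal_eq_def
  proof (intro conjI ballI res_cp_poly)
    fix q assume q: "q \<in> sph_poly n"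
    have "Q (\<lambda>y. (?u y - series (res cp) y) * q y) = Q (\<lambda>y. (f y - p y) * q y)"
    proof (rule Q_cong)
      fix y assume y: "y \<in> S2"
      have "?u y - series (res cp) y = f y - p y" using y gy[OF y] ep[OF y] by simp
      then show "(?u y - series (res cp) y) * q y = (f y - p y) * q y" by simp
    qed
    then show "Q (\<lambda>y. (?u y - series (res cp) y) * q y) = 0" using p q by (simp add: normal_eq_def)
  qed
  then have "wls_proj Y n N w x ?u = restrict (series (res cp)) S2" by (rule wls_proj_normal_eq)
  then have "?u y - zonal_op \<Phi> (wls_proj Y n N w x ?u) y = f y" if "y \<in> S2" for y
    using gy[OF that] that by (simp add: zonal_restrict)
  then show "?u \<in> sobolev_space Y r \<and> (\<forall>y\<in>S2. ?u y - zonal_op \<Phi> (wls_proj Y n N w x ?u) y = f y)"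
    using series_sobolev[OF g] by blast
  fix u assume u: "u \<in> sobolev_space Y r \<and> (\<forall>y\<in>S2. u y - zonal_op \<Phi> (wls_proj Y n N w x u) y = f y)"
  obtain P where P: "normal_eq u P" using normal_eq_exists by blast
  then have Pp: "P \<in> sph_poly n" by (simp add: normal_eq_def)
  let ?d = "coeffs n P"
  have Ps: "P y = series ?d y" if "y \<in> S2" for y using series_coeffs[OF Pp that] by simp
  have T: "zonal_op \<Phi> (wls_proj Y n N w x u) y = zonal_op \<Phi> (series ?d) y" for y
    unfolding wls_proj_normal_eq[OF P] using Ps by (intro zonal_op_cong) simp
  have uy: "u y = f y + zonal_op \<Phi> (series ?d) y" if "y \<in> S2" for y
    using u that T[of y] by (metis add.commute diff_add_cancel)
  \<comment> \<open>Conversely, with \<open>P\<close> the projection of a solution \<open>u\<close>,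
    the difference f - (I - T) P equals u - P, so (I - T) P is the projection of
    \<open>f\<close>.\<close>
  let ?h = "series (\<lambda>l k. ?d l k - \<mu> l * ?d l k)"
  have "normal_eq f ?h"
    unfolding normal_eq_def
  proof (intro conjI ballI)
    show "?h \<in> sph_poly n" by (rule series_finite_poly) (simp add: coeffs_zero)
    fix q assume q: "q \<in> sph_poly n"
    have "Q (\<lambda>y. (f y - ?h y) * q y) = Q (\<lambda>y. (u y - P y) * q y)"
    proof (rule Q_cong)
      fix y assume y: "y \<in> S2"
      have "f y - ?h y = u y - P y"
        using series_minus_zonal[OF hr_coeffs y, of n P] uy[OF y] Ps[OF y] by simp
      then show "(f y - ?h y) * q y = (u y - P y) * q y" by simp
    qed
    then show "Q (\<lambda>y. (f y - ?h y) * q y) = 0" using P q by (simp add: normal_eq_def)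
  qed
  then have "?d l k = res cp l k" if "k \<in> {1..2*l+1}" for l k
    using galerkin_unique[of ?d, OF coeffs_zero _ that] by simp
  then have "series ?d y = series (res cp) y" for y by (rule series_cong)
  then have "u y = ?u y" if "y \<in> S2" for y
    using uy[OF that] gy[OF that] zonal_op_cong[of "series ?d" "series (res cp)" \<Phi> y] that by simp
  then show "u = ?u" using u by (intro extensionalityI[of u S2]) (auto simp: sobolev_space_iff)
qed

definition sloan_steps :: "scheme \<Rightarrow> nat \<Rightarrow> nat" where
  "sloan_steps s q = (case s of Galerkin \<Rightarrow> q | Nystrom \<Rightarrow> Suc q)"

lemma error_series:
  assumes y: "y \<in> S2"
  shows "exact_solution Y r \<Phi> f y - sloan \<Phi> f q (scheme_solution s Y r \<Phi> n N w x f) y =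
    series (\<lambda>l k. \<mu> l ^ sloan_steps s q * res (\<lambda>l k. cf l k - cp l k) l k) y"
proof (cases s)
  case Galerkin
  have "exact_solution Y r \<Phi> f y - sloan \<Phi> f q (galerkin_solution Y \<Phi> n N w x f) y =
    series (\<lambda>l k. \<mu> l ^ q * (res cf l k - res cp l k)) y"
    unfolding exact_solution_series[OF f y] galerkin_series
    by (rule sloan_error_series[OF f hr_res[OF hr_coeffs] _ y]) simp
  then show ?thesis using Galerkin by (simp add: sloan_steps_def res_def right_diff_distrib)
next
  case Nystrom
  have "exact_solution Y r \<Phi> f y - sloan \<Phi> f q (nystrom_solution Y r \<Phi> n N w x f) y =
    series (\<lambda>l k. \<mu> l ^ q * (res cf l k - (cf l k + \<mu> l * res cp l k))) y"
    unfolding exact_solution_series[OF f y] nystrom_series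
    by (rule sloan_error_series[OF f _ _ y]) (auto intro!: hr_add hr_cf hr_mu hr_res hr_coeffs)
  \<comment> \<open>Since f = u - T u for the exact solution u, the Nystroem error u - (f + T e) is
    T (u - e). This is the additional step counted by \<open>scheme_eps\<close>.\<close>
  also have "(\<lambda>l k. \<mu> l ^ q * (res cf l k - (cf l k + \<mu> l * res cp l k))) =
      (\<lambda>l k. \<mu> l ^ Suc q * res (\<lambda>l k. cf l k - cp l k) l k)"
  proof (intro ext)
    fix l k
    have "res cf l k - (cf l k + \<mu> l * res cp l k) = \<mu> l * (res cf l k - res cp l k)"
      using res_minus[of cf l k] by (simp only: right_diff_distrib)
    moreover have "res (\<lambda>l k. cf l k - cp l k) l k = res cf l k - res cp l k"
      by (simp add: res_def right_diff_distrib)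
    ultimately show "\<mu> l ^ q * (res cf l k - (cf l k + \<mu> l * res cp l k)) = \<mu> l ^ Suc q * res (\<lambda>l k. cf l k - cp l k) l k"
      by (simp only: power_Suc mult.assoc mult.left_commute)
  qed
  finally show ?thesis using Nystrom by (simp add: sloan_steps_def)
qed

end

section \<open>Error estimates\<close>

lemma powr_le_increment:
  fixes a t :: real
  assumes a: "a < 0" "a \<noteq> -1" and t: "t > 1"
  shows "t powr a \<le> t powr (a + 1) / (a + 1) - (t - 1) powr (a + 1) / (a + 1)"
proof -
  \<comment> \<open>On [t - 1, t] the decreasing power is smallest at the right end. The exponent -1
    has a logarithmic primitive and is treated in \<open>sum_inverse_le_ln\<close>.\<close>
  have "\<exists>z>t - 1. z < t \<and> t powr (a + 1) / (a + 1) - (t - 1) powr (a + 1) / (a + 1) = (t - (t - 1)) * (z powr a)"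
  proof (rule MVT2)
    fix z assume "t - 1 \<le> z" "z \<le> t"
    then show "((\<lambda>z. z powr (a + 1) / (a + 1)) has_real_derivative z powr a) (at z)"
      using t a by (auto intro!: derivative_eq_intros)
  qed simp
  then obtain z where "t - 1 < z" "z < t"
    "t powr (a + 1) / (a + 1) - (t - 1) powr (a + 1) / (a + 1) = z powr a" by auto
  moreover have "t powr a \<le> z powr a" if "t - 1 < z" "z < t" for z
    using that t a by (intro powr_mono2') auto
  ultimately show ?thesis by simp
qed

lemma sum_powr_le_increment:
  fixes a :: real
  assumes a: "a < 0" "a \<noteq> -1" and n: "n \<ge> 1"
  shows "n \<le> M \<Longrightarrow> (\<Sum>m\<in>{n<..M}. real m powr a) \<le> real M powr (a + 1) / (a + 1) - real n powr (a + 1) / (a + 1)"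
proof (induction M rule: dec_induct)
  case (step M)
  have "{n<..Suc M} = insert (Suc M) {n<..M}" using step by auto
  then have "(\<Sum>m\<in>{n<..Suc M}. real m powr a) = real (Suc M) powr a + (\<Sum>m\<in>{n<..M}. real m powr a)" by simp
  also have "real (Suc M) powr a \<le> real (Suc M) powr (a + 1) / (a + 1) - real M powr (a + 1) / (a + 1)"
    using powr_le_increment[OF a, of "real (Suc M)"] step n by simp
  finally show ?case using step.IH by linarith
qed simp

lemma sum_powr_tail:
  fixes s :: real
  assumes s: "s > 1" and n: "n \<ge> 1"
  shows "(\<Sum>m\<in>{n<..M}. real m powr (- s)) \<le> real n powr (1 - s) / (s - 1)"
proof (cases "n \<le> M")
  case True
  have "(\<Sum>m\<in>{n<..M}. real m powr (- s)) \<le> real M powr (- s + 1) / (- s + 1) - real n powr (- s + 1) / (- s + 1)"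
    using sum_powr_le_increment[of "- s" n M] s n True by simp
  also have "\<dots> = (real n powr (1 - s) - real M powr (1 - s)) / (s - 1)"
    using minus_divide_divide[of "real M powr (1 - s) - real n powr (1 - s)" "1 - s"]
    by (simp add: diff_divide_distrib)
  also have "\<dots> \<le> real n powr (1 - s) / (s - 1)"
    using s by (intro divide_right_mono) auto
  finally show ?thesis .
qed (use s in simp)

lemma sum_powr_head:
  fixes a :: real
  assumes a: "a < 0" "a \<noteq> -1" and M: "M \<ge> 1"
  shows "(\<Sum>m=1..M. real m powr a) \<le> 1 + real M powr (a + 1) / (a + 1) - 1 / (a + 1)"
proof -
  have "{1..M} = insert 1 {1<..M}" using M by auto
  then have "(\<Sum>m=1..M. real m powr a) = 1 + (\<Sum>m\<in>{1<..M}. real m powr a)" by simp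
  then show ?thesis using sum_powr_le_increment[OF a, of 1 M] M by simp
qed

lemma sum_inverse_le_ln: "M \<ge> 1 \<Longrightarrow> (\<Sum>m=1..M. real m powr (-1)) \<le> 1 + ln (real M)"
proof (induction M rule: dec_induct)
  case (step M)
  have "ln (real M / real (Suc M)) \<le> real M / real (Suc M) - 1"
    using step by (intro ln_le_minus_one) auto
  also have "real M / real (Suc M) - 1 = - (real (Suc M) powr (-1))"
    by (simp add: powr_minus field_simps)
  finally have "real (Suc M) powr (-1) \<le> ln (real (Suc M)) - ln (real M)"
    using step by (simp add: ln_div)
  then show ?case using step.IH by simp
qed simp

text \<open>Origin of \<open>rho\<close>: the sum is of order n^(2 - 2\<gamma>), log (n + 1) or 1,
  according to whether the exponent 1 - 2\<gamma> lies above, at or below -1, and these are the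
  squares of the three cases.\<close>

lemma sum_powr_rho:
  assumes \<gamma>: "\<gamma> \<ge> 0"
  shows "\<exists>C\<ge>0. \<forall>n\<ge>1. (\<Sum>l\<le>n. (1 + real l) powr (1 - 2 * \<gamma>)) \<le> C * (rho \<gamma> n)\<^sup>2"
proof -
  let ?a = "1 - 2 * \<gamma>"
  have shift: "(\<Sum>l\<le>n. (1 + real l) powr ?a) = (\<Sum>m=1..Suc n. real m powr ?a)" for n
    using sum.shift_bounds_cl_Suc_ivl[of "\<lambda>m. real m powr ?a" 0 n] by (simp add: atMost_atLeast0 add.commute)
  consider "\<gamma> < 1" | "\<gamma> = 1" | "\<gamma> > 1" by linarith
  then show ?thesis
  proof cases
    case 1
    \<comment> \<open>One constant for two cases: nondecreasing terms are bounded by the largest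
      one, with factor 1, and decreasing terms by the integral, with factor
      \<open>1 / (?a + 1)\<close>.\<close>
    define D where "D = max 1 (1 / (?a + 1))"
    have "(\<Sum>l\<le>n. (1 + real l) powr ?a) \<le> (D * 2 powr (2 - 2 * \<gamma>)) * (rho \<gamma> n)\<^sup>2" if n: "n \<ge> 1" for n
    proof -
      have "(\<Sum>m=1..Suc n. real m powr ?a) \<le> D * real (Suc n) powr (?a + 1)"
      proof (cases "?a \<ge> 0")
        case True
        have "(\<Sum>m=1..Suc n. real m powr ?a) \<le> (\<Sum>m=1..Suc n. real (Suc n) powr ?a)"
          using True by (intro sum_mono powr_mono2) auto
        also have "\<dots> = real (Suc n) * real (Suc n) powr ?a" by simp
        also have "\<dots> = 1 * real (Suc n) powr (?a + 1)"
          using powr_mult_base[of "real (Suc n)" ?a] by (simp only: add.commute[of ?a] mult_1 of_nat_0_le_iff)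
        also have "\<dots> \<le> D * real (Suc n) powr (?a + 1)"
          by (rule mult_right_mono) (auto simp: D_def)
        finally show ?thesis .
      next
        case False
        then have "(\<Sum>m=1..Suc n. real m powr ?a) \<le> 1 + real (Suc n) powr (?a + 1) / (?a + 1) - 1 / (?a + 1)"
          using 1 by (intro sum_powr_head) auto
        moreover have "1 / (?a + 1) \<ge> 1" using False 1 by (simp add: le_divide_eq)
        ultimately have "(\<Sum>m=1..Suc n. real m powr ?a) \<le> 1 / (?a + 1) * real (Suc n) powr (?a + 1)" by simp
        also have "\<dots> \<le> D * real (Suc n) powr (?a + 1)"
          by (rule mult_right_mono) (auto simp: D_def)
        finally show ?thesis .
      qed
      also have "\<dots> \<le> D * (2 * real n) powr (?a + 1)"
        using 1 n by (intro mult_left_mono powr_mono2) (auto simp: D_def)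
      also have "\<dots> = (D * 2 powr (2 - 2 * \<gamma>)) * (real n powr (1 - \<gamma>))\<^sup>2"
      proof -
        have "(real n powr (1 - \<gamma>))\<^sup>2 = real n powr (2 - 2 * \<gamma>)"
          by (simp add: power2_eq_square flip: powr_add)
        then show ?thesis by (simp add: powr_mult)
      qed
      finally show ?thesis unfolding shift using 1 by (simp add: rho_def)
    qed
    moreover have "D * 2 powr (2 - 2 * \<gamma>) \<ge> 0" by (simp add: D_def)
    ultimately show ?thesis by blast
  next
    case 2
    \<comment> \<open>For n >= 1 the logarithm is at least ln 2, so \<open>1 / ln 2\<close> times it
      absorbs the additive 1.\<close>
    have "(\<Sum>l\<le>n. (1 + real l) powr ?a) \<le> (1 / ln 2 + 1) * (rho \<gamma> n)\<^sup>2" if n: "n \<ge> 1" for n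
    proof -
      have l: "ln 2 \<le> ln (real n + 1)" using n by simp
      then have pos: "ln (real n + 1) > 0" using ln_gt_zero[of "2::real"] by linarith
      have "1 \<le> ln (real n + 1) / ln 2" using l by simp
      moreover have "(\<Sum>l\<le>n. (1 + real l) powr ?a) \<le> 1 + ln (real n + 1)"
        unfolding shift using sum_inverse_le_ln[of "Suc n"] 2 by (simp add: add.commute)
      moreover have "(1 / ln 2 + 1) * ln (real n + 1) = ln (real n + 1) / ln 2 + ln (real n + 1)"
        by (simp only: distrib_right mult_1 times_divide_eq_left)
      ultimately have "(\<Sum>l\<le>n. (1 + real l) powr ?a) \<le> (1 / ln 2 + 1) * ln (real n + 1)"
        by linarith
      moreover have "(rho \<gamma> n)\<^sup>2 = ln (real n + 1)"
        using 2 pos by (simp add: rho_def powr_half_sqrt)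
      ultimately show ?thesis by simp
    qed
    then show ?thesis by (intro exI[of _ "1 / ln 2 + 1"]) simp
  next
    case 3
    have "(\<Sum>l\<le>n. (1 + real l) powr ?a) \<le> (1 + 1 / (2 * \<gamma> - 2)) * (rho \<gamma> n)\<^sup>2" for n
    proof -
      have "(\<Sum>l\<le>n. (1 + real l) powr ?a) \<le> 1 + real (Suc n) powr (?a + 1) / (?a + 1) - 1 / (?a + 1)"
        unfolding shift using 3 by (intro sum_powr_head) auto
      moreover have "real (Suc n) powr (?a + 1) / (?a + 1) \<le> 0"
        using 3 by (intro divide_nonneg_neg) auto
      moreover have "1 / (?a + 1) = - (1 / (2 * \<gamma> - 2))"
      proof -
        have "?a + 1 = - (2 * \<gamma> - 2)" by simp
        then show ?thesis by (simp only: minus_divide_right)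
      qed
      moreover have "rho \<gamma> n = 1" using 3 by (simp add: rho_def)
      ultimately show ?thesis by simp
    qed
    then show ?thesis using 3 by (intro exI[of _ "1 + 1 / (2 * \<gamma> - 2)"]) simp
  qed
qed

lemma sum_sqrt_cauchy_schwarz:
  assumes "\<And>i. i \<in> I \<Longrightarrow> 0 \<le> a i" "\<And>i. i \<in> I \<Longrightarrow> 0 \<le> b i"
  shows "(\<Sum>i\<in>I. sqrt (a i) * sqrt (b i)) \<le> sqrt (\<Sum>i\<in>I. a i) * sqrt (\<Sum>i\<in>I. b i)"
proof -
  have "(\<Sum>i\<in>I. sqrt (a i) * sqrt (b i))\<^sup>2 \<le> (\<Sum>i\<in>I. (sqrt (a i))\<^sup>2) * (\<Sum>i\<in>I. (sqrt (b i))\<^sup>2)"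
    by (rule Cauchy_Schwarz_ineq_sum)
  also have "\<dots> = (\<Sum>i\<in>I. a i) * (\<Sum>i\<in>I. b i)" using assms by simp
  finally show ?thesis by (metis real_le_rsqrt real_sqrt_mult)
qed

lemma sum_dyadic_blocks:
  fixes h :: "nat \<Rightarrow> real"
  shows "(\<Sum>j<J. \<Sum>l\<in>{2 ^ j * n<..2 ^ Suc j * n}. h l) = (\<Sum>l\<in>{n<..2 ^ J * n}. h l)"
proof (induction J)
  case (Suc J)
  have "{n<..b} = {n<..a} \<union> {a<..b}" if "n \<le> a" "a \<le> b" for a b using that by auto
  from this[of "2 ^ J * n" "2 ^ Suc J * n"]
  have "{n<..2 ^ Suc J * n} = {n<..2 ^ J * n} \<union> {2 ^ J * n<..2 ^ Suc J * n}" by simp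
  then have "(\<Sum>l\<in>{n<..2 ^ Suc J * n}. h l) = (\<Sum>l\<in>{n<..2 ^ J * n}. h l) + (\<Sum>l\<in>{2 ^ J * n<..2 ^ Suc J * n}. h l)"
    by (simp only:) (rule sum.union_disjoint, auto)
  then show ?case using Suc by simp
qed simp

lemma linf_norm_le:
  assumes g: "continuous_on S2 g" "\<And>y. y \<in> S2 \<Longrightarrow> v y = g y" and b: "\<And>y. y \<in> S2 \<Longrightarrow> \<bar>g y\<bar> \<le> B"
  shows "linf_norm v \<le> ereal B"
  unfolding linf_norm_def
proof (rule esssup_I)
  have "v \<in> borel_measurable \<omega> \<longleftrightarrow> g \<in> borel_measurable \<omega>"
    by (rule measurable_cong) (use g(2) in simp)
  then have "v \<in> borel_measurable \<omega>" using borel_measurable_surface_continuous[OF g(1)] by simp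
  then show "(\<lambda>x. ereal \<bar>v x\<bar>) \<in> borel_measurable \<omega>" by measurable
  show "AE x in \<omega>. ereal \<bar>v x\<bar> \<le> ereal B" by (rule AE_I2) (use g(2) b in simp)
qed

section \<open>Discrete size of the remainder of the right-hand side\<close>

context discrete_scheme
begin

definition "F = sobolev_norm Y r f"

lemma summable_F: "summable (\<lambda>l. lam r l * energy cf l)"
  using hr_cf by (simp add: hr_def)

lemma F_square: "F\<^sup>2 = (\<Sum>l. lam r l * energy cf l)"
proof -
  have "sobolev_term Y r f = (\<lambda>l. lam r l * energy cf l)"
    by (rule ext) (rule sobolev_term_eq)
  moreover have "0 \<le> (\<Sum>l. lam r l * energy cf l)"
    by (rule suminf_nonneg[OF summable_F]) (simp add: energy_nonneg less_imp_le[OF lam_pos])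
  ultimately show ?thesis by (simp add: F_def sobolev_norm_def)
qed

lemma F_nonneg: "F \<ge> 0"
proof -
  have "0 \<le> (\<Sum>l. sobolev_term Y r f l)"
    using F_square zero_le_power2[of F] by (simp add: sobolev_term_eq)
  then show ?thesis by (simp add: F_def sobolev_norm_def)
qed

lemma sum_le_F:
  assumes "finite I" shows "(\<Sum>l\<in>I. lam r l * energy cf l) \<le> F\<^sup>2"
  unfolding F_square
  by (rule sum_le_suminf[OF summable_F assms]) (simp add: energy_nonneg less_imp_le[OF lam_pos])

text \<open>The ratio between successive dyadic blocks: the regularity constant grows by 4, while
  the Sobolev weight gains 4^(-r).\<close>

definition "\<theta> = 4 powr (1 - r)"

lemma theta: "0 < \<theta>" "\<theta> < 1"
  using r powr_less_mono[of "1 - r" 0 4] by (auto simp: \<theta>_def)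

lemma block_bound:
  assumes n: "n \<ge> 1"
  shows "Q (\<lambda>y. (\<Sum>l\<in>{2 ^ j * n<..2 ^ Suc j * n}. comp cf l y)\<^sup>2) \<le>
    16 * (1 + \<eta>) * real n powr (- 2 * r) * \<theta> ^ j * (\<Sum>l\<in>{2 ^ j * n<..2 ^ Suc j * n}. lam r l * energy cf l)"
proof -
  let ?I = "{2 ^ j * n<..2 ^ Suc j * n}" let ?M = "2 ^ Suc j * n"
  let ?E = "\<Sum>l\<in>?I. energy cf l" and ?L = "\<Sum>l\<in>?I. lam r l * energy cf l"
  have "(\<lambda>y. \<Sum>l\<in>?I. comp cf l y) \<in> sph_poly ?M"
    by (intro sph_poly_sum) (auto intro: sph_poly_mono[OF comp_poly])
  then have "Q (\<lambda>y. (\<Sum>l\<in>?I. comp cf l y)\<^sup>2) \<le> (1 + \<eta>) * ((real ?M + real n + 1) / (real n + 1))\<^sup>2 * ?E"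
    using quadrature_regularity[of "\<lambda>y. \<Sum>l\<in>?I. comp cf l y" ?M] ip_sum_comp[of ?I cf] by simp
  also have "\<dots> \<le> (1 + \<eta>) * (16 * 4 ^ j) * (real (2 ^ j * n) powr (- 2 * r) * ?L)"
  proof (intro mult_mono)
    \<comment> \<open>The quotient is at most 2^(j + 1) + 1, hence at most 2^(j + 2), whose square
      is \<open>16 * 4 ^ j\<close>.\<close>
    have "real ?M + real n + 1 \<le> 2 ^ (j + 2) * (real n + 1)"
    proof -
      have M: "real ?M = 2 * (2 ^ j * real n)" and e: "2 ^ (j + 2) * (real n + 1) = 4 * (2 ^ j * real n) + 4 * 2 ^ j"
        by (simp_all add: algebra_simps)
      have "(1::real) \<le> 2 ^ j" by simp
      then have "1 * (real n + 1) \<le> 2 ^ j * (real n + 1)" by (intro mult_right_mono) auto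
      then have 1: "real n + 1 \<le> 2 ^ j * real n + 2 ^ j" by (simp only: distrib_left mult_1 mult_1_right)
      have 2: "0 \<le> (2::real) ^ j" and 3: "0 \<le> (2::real) ^ j * real n" by simp_all
      show ?thesis unfolding M e using 1 2 3 by linarith
    qed
    then have "(real ?M + real n + 1) / (real n + 1) \<le> 2 ^ (j + 2)"
      by (simp add: divide_le_eq add_pos_nonneg)
    then have "((real ?M + real n + 1) / (real n + 1))\<^sup>2 \<le> (2 ^ (j + 2))\<^sup>2"
      by (intro power_mono) auto
    also have "(2 ^ (j + 2))\<^sup>2 = (16 * 4 ^ j :: real)"
      by (simp add: power_mult_distrib power_add flip: power_mult) (simp add: mult.commute[of j] power_mult)
    finally show "((real ?M + real n + 1) / (real n + 1))\<^sup>2 \<le> 16 * 4 ^ j" .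
    have N: "real (2 ^ j * n) > 0" using n by simp
    have "energy cf l \<le> real (2 ^ j * n) powr (- 2 * r) * (lam r l * energy cf l)" if "l \<in> ?I" for l
    proof -
      have "2 ^ j * n \<le> l" using that by simp
      then have "real (2 ^ j * n) \<le> real l" by (simp only: of_nat_le_iff)
      then have "real (2 ^ j * n) powr (2 * r) \<le> real l powr (2 * r)"
        by (rule powr_mono2[rotated 2]) (use r in auto)
      also have "\<dots> \<le> lam r l" using r by (intro lam_ge(1)) simp
      finally have "real (2 ^ j * n) powr (- 2 * r) * real (2 ^ j * n) powr (2 * r)
          \<le> real (2 ^ j * n) powr (- 2 * r) * lam r l" by (rule mult_left_mono) simp
      then have "1 \<le> real (2 ^ j * n) powr (- 2 * r) * lam r l"
        unfolding powr_add[symmetric] using n by (simp split: if_splits)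
      from mult_right_mono[OF this energy_nonneg[of cf l]] show ?thesis by (simp add: mult.assoc)
    qed
    then show "?E \<le> real (2 ^ j * n) powr (- 2 * r) * ?L"
      unfolding sum_distrib_left by (intro sum_mono)
  qed (use eta energy_nonneg in \<open>auto intro!: sum_nonneg\<close>)
  also have "4 ^ j * real (2 ^ j * n) powr (- 2 * r) = real n powr (- 2 * r) * \<theta> ^ j"
  proof -
    have "\<theta> ^ j = 4 powr ((1 - r) * real j)" by (simp add: \<theta>_def powr_powr flip: powr_realpow)
    also have "\<dots> = 4 powr real j * 4 powr (- (r * real j))" by (simp add: algebra_simps flip: powr_add)
    also have "4 powr (- (r * real j)) = (2 powr 2) powr (- (r * real j))" by simp
    also have "\<dots> = 2 powr (real j * (- 2 * r))" unfolding powr_powr by (simp add: mult_ac)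
    also have "\<dots> = (2 ^ j) powr (- 2 * r)" by (simp add: powr_powr flip: powr_realpow)
    finally show ?thesis by (simp add: powr_mult powr_realpow mult_ac)
  qed
  then have "(1 + \<eta>) * (16 * 4 ^ j) * (real (2 ^ j * n) powr (- 2 * r) * ?L) =
      16 * (1 + \<eta>) * real n powr (- 2 * r) * \<theta> ^ j * ?L"
    by (simp only: mult.assoc mult.left_commute[of _ 16] mult.left_commute[of "1 + \<eta>"])
       (simp add: mult.assoc[symmetric])
  finally show ?thesis .
qed

abbreviation "g \<equiv> \<lambda>y. series cf y - (\<Sum>l\<le>n. comp cf l y)"

abbreviation "tail J y \<equiv> \<Sum>l\<in>{n<..2 ^ J * n}. comp cf l y"

text \<open>Cauchy--Schwarz with weights \<theta>^j: they sum to at most 1 / (1 - \<theta>), and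
  dividing by them cancels the decay in \<open>block_bound\<close>. The block energies then add up
  to at most the square of \<open>F\<close>, uniformly in \<open>J\<close>.\<close>

lemma partial_remainder_bound:
  assumes n: "n \<ge> 1"
  shows "Q (\<lambda>y. (tail J y)\<^sup>2) \<le> 16 / (1 - \<theta>) * (1 + \<eta>) * real n powr (- 2 * r) * F\<^sup>2"
proof -
  let ?I = "\<lambda>j. {2 ^ j * n<..2 ^ Suc j * n}"
  let ?g = "\<lambda>j y. \<Sum>l\<in>?I j. comp cf l y"
  let ?L = "\<lambda>j. \<Sum>l\<in>?I j. lam r l * energy cf l"
  let ?K = "16 * (1 + \<eta>) * real n powr (- 2 * r)"
  have geo: "(\<Sum>j<J. \<theta> ^ j) \<le> 1 / (1 - \<theta>)"
  proof -
    have "(\<Sum>j<J. \<theta> ^ j) = (1 - \<theta> ^ J) / (1 - \<theta>)"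
      using theta sum_gp_strict[of \<theta> J] by simp
    also have "\<dots> \<le> 1 / (1 - \<theta>)" using theta by (intro divide_right_mono) auto
    finally show ?thesis .
  qed
  have h: "(x / sqrt t)\<^sup>2 = inverse t * x\<^sup>2" if "t > 0" for x t :: real
    using that by (simp add: power_divide) (simp add: divide_inverse mult.commute)
  have h2: "inverse t * (a * t * b) = a * b" if "t > 0" for t a b :: real
    using that by simp
  have pw: "(tail J y)\<^sup>2 \<le> 1 / (1 - \<theta>) * (\<Sum>j<J. inverse (\<theta> ^ j) * (?g j y)\<^sup>2)" for y
  proof -
    have "(tail J y) = (\<Sum>j<J. sqrt (\<theta> ^ j) * (?g j y / sqrt (\<theta> ^ j)))"
      unfolding sum_dyadic_blocks[symmetric] using theta by simp
    then have "(tail J y)\<^sup>2 \<le> (\<Sum>j<J. (sqrt (\<theta> ^ j))\<^sup>2) * (\<Sum>j<J. (?g j y / sqrt (\<theta> ^ j))\<^sup>2)"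
      using Cauchy_Schwarz_ineq_sum[of "\<lambda>j. sqrt (\<theta> ^ j)" "\<lambda>j. ?g j y / sqrt (\<theta> ^ j)" "{..<J}"] by simp
    also have "\<dots> = (\<Sum>j<J. \<theta> ^ j) * (\<Sum>j<J. inverse (\<theta> ^ j) * (?g j y)\<^sup>2)"
      using theta by (simp add: h)
    also have "\<dots> \<le> 1 / (1 - \<theta>) * (\<Sum>j<J. inverse (\<theta> ^ j) * (?g j y)\<^sup>2)"
      using theta by (intro mult_right_mono[OF geo] sum_nonneg) auto
    finally show ?thesis .
  qed
  have "Q (\<lambda>y. (tail J y)\<^sup>2) \<le>
      1 / (1 - \<theta>) * (\<Sum>j<J. inverse (\<theta> ^ j) * Q (\<lambda>y. (?g j y)\<^sup>2))"
    unfolding quad_scale[symmetric] quad_sum[symmetric] by (rule Q_mono[OF pw])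
  also have "\<dots> \<le> 1 / (1 - \<theta>) * (\<Sum>j<J. inverse (\<theta> ^ j) * (?K * \<theta> ^ j * ?L j))"
    using theta by (intro mult_left_mono sum_mono block_bound n) auto
  also have "(\<Sum>j<J. inverse (\<theta> ^ j) * (?K * \<theta> ^ j * ?L j)) = (\<Sum>j<J. ?K * ?L j)"
    by (intro sum.cong[OF refl] h2) (use theta in simp)
  also have "(\<Sum>j<J. ?K * ?L j) = ?K * (\<Sum>j<J. ?L j)" by (rule sum_distrib_left[symmetric])
  also have "(\<Sum>j<J. ?L j) = (\<Sum>l\<in>{n<..2 ^ J * n}. lam r l * energy cf l)"
    by (rule sum_dyadic_blocks)
  also have "1 / (1 - \<theta>) * (?K * (\<Sum>l\<in>{n<..2 ^ J * n}. lam r l * energy cf l)) \<le> 1 / (1 - \<theta>) * (?K * F\<^sup>2)"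
    using theta eta by (intro mult_left_mono sum_le_F) auto
  finally show ?thesis by (simp add: mult_ac)
qed

text \<open>Only finitely many nodes occur, so convergence of the partial sums at each node suffices
  for passing to the limit in the discrete norm.\<close>

lemma remainder_bound:
  assumes n: "n \<ge> 1"
  shows "Q (\<lambda>y. (g y)\<^sup>2) \<le> 16 / (1 - \<theta>) * (1 + \<eta>) * real n powr (- 2 * r) * F\<^sup>2"
proof (rule LIMSEQ_le_const2)
  have lim: "(\<lambda>J. tail J y) \<longlonglongrightarrow> g y" if y: "y \<in> S2" for y
  proof -
    have mono: "strict_mono (\<lambda>J. Suc (2 ^ J * n))"
      using n by (intro strict_monoI) simp
    have "(\<lambda>N. \<Sum>l<N. comp cf l y) \<longlonglongrightarrow> series cf y"
      using series_sums[OF hr_cf y] by (simp add: sums_def)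
    from LIMSEQ_subseq_LIMSEQ[OF this mono]
    have "(\<lambda>J. (\<Sum>l<Suc (2 ^ J * n). comp cf l y) - (\<Sum>l\<le>n. comp cf l y)) \<longlonglongrightarrow> g y"
      by (intro tendsto_diff) (simp_all only: o_def tendsto_const)
    moreover have "(\<Sum>l<Suc (2 ^ J * n). comp cf l y) - (\<Sum>l\<le>n. comp cf l y) = (tail J y)" for J
    proof -
      have "{..<Suc a} = {..n} \<union> {n<..a}" if "n \<le> a" for a using that by auto
      from this[of "2 ^ J * n"]
      have *: "{..<Suc (2 ^ J * n)} = {..n} \<union> {n<..2 ^ J * n}" by simp
      have "(\<Sum>l<Suc (2 ^ J * n). comp cf l y) = (\<Sum>l\<le>n. comp cf l y) + (tail J y)"
        unfolding * by (rule sum.union_disjoint) auto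
      then show ?thesis by (simp only: add_diff_cancel_left')
    qed
    ultimately show ?thesis by simp
  qed
  show "(\<lambda>J. Q (\<lambda>y. (tail J y)\<^sup>2)) \<longlonglongrightarrow> Q (\<lambda>y. (g y)\<^sup>2)"
    unfolding quad_def by (intro tendsto_intros lim node)
qed (use partial_remainder_bound[OF n] in blast)

text \<open>The residual splits as f - p = g + b, where b has degree at most \<open>n\<close> and is
  discretely orthogonal to the residual. Hence Q(b^2) <= Q(g^2), and the lower
  Marcinkiewicz--Zygmund bound turns the left side into energy at the price of 1 / (1 -
  \<eta>).\<close>

lemma projection_energy_bound:
  assumes n: "n \<ge> 1"
  shows "(\<Sum>l\<le>n. energy (\<lambda>l k. cf l k - cp l k) l) \<le>
    16 / (1 - \<theta>) * ((1 + \<eta>) / (1 - \<eta>)) * real n powr (- 2 * r) * F\<^sup>2"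
proof -
  let ?a = "\<lambda>l k. cf l k - cp l k" let ?b = "\<lambda>y. \<Sum>l\<le>n. comp ?a l y"
  let ?R = "16 / (1 - \<theta>) * (1 + \<eta>) * real n powr (- 2 * r) * F\<^sup>2"
  have b: "?b \<in> sph_poly n" by (intro sph_poly_sum) (auto intro: sph_poly_mono[OF comp_poly])
  have fp: "f y - p y = g y + ?b y" if y: "y \<in> S2" for y
  proof -
    have "p y = (\<Sum>l\<le>n. comp cp l y)"
      using series_coeffs[OF p_poly y] series_finite[of n cp y] coeffs_zero by simp
    then show ?thesis using sobolev_series[OF f y] by (simp add: comp_diff sum_subtractf)
  qed
  have "Q (\<lambda>y. (f y - p y) * ?b y) = 0" using p b by (simp add: normal_eq_def)
  then have z: "Q (\<lambda>y. (g y + ?b y) * ?b y) = 0"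
    using Q_cong[of "\<lambda>y. (f y - p y) * ?b y" "\<lambda>y. (g y + ?b y) * ?b y"] fp by simp
  have "Q (\<lambda>y. (g y)\<^sup>2) = Q (\<lambda>y. (g y + ?b y)\<^sup>2 + (?b y)\<^sup>2 - 2 * ((g y + ?b y) * ?b y))"
    by (rule Q_cong) (simp add: power2_eq_square algebra_simps)
  also have "\<dots> = Q (\<lambda>y. (g y + ?b y)\<^sup>2) + Q (\<lambda>y. (?b y)\<^sup>2)"
    unfolding quad_diff quad_add[of _ _ _ "\<lambda>y. (g y + ?b y)\<^sup>2"] quad_scale z by simp
  finally have "Q (\<lambda>y. (?b y)\<^sup>2) \<le> Q (\<lambda>y. (g y)\<^sup>2)"
    using Q_nonneg[of "\<lambda>y. (g y + ?b y)\<^sup>2"] by simp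
  then have "(1 - \<eta>) * ip ?b ?b \<le> ?R"
    using mz_sph_poly(1)[OF b] remainder_bound[OF n] by linarith
  then have "ip ?b ?b * (1 - \<eta>) \<le> ?R" by (subst mult.commute)
  then have "ip ?b ?b \<le> ?R / (1 - \<eta>)"
    by (rule mult_imp_le_div_pos[rotated]) (use eta in simp)
  also have "?R / (1 - \<eta>) = 16 / (1 - \<theta>) * ((1 + \<eta>) / (1 - \<eta>)) * real n powr (- 2 * r) * F\<^sup>2"
    by simp
  finally show ?thesis using ip_sum_comp[of "{..n}" ?a] by simp
qed

section \<open>The pointwise error bound\<close>

definition "err s q = (\<lambda>l k. \<mu> l ^ sloan_steps s q * res (\<lambda>l k. cf l k - cp l k) l k)"

lemma hr_err: "hr r (err s q)"
  unfolding err_def by (intro hr_mu_power hr_res hr_diff hr_cf hr_coeffs)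

lemma sloan_steps_real: "real (sloan_steps s q) = real q + scheme_eps s"
  by (cases s) (auto simp: sloan_steps_def)

text \<open>\<open>kap l\<close> contributes the power 1/2 of 1 + l, the factors of T the power
  -\<gamma>, and the resolvent 1 / \<delta>. The product of square roots is the form in which
  Cauchy--Schwarz over the degrees is applied.\<close>

lemma err_comp_bound:
  assumes y: "y \<in> S2" and \<gamma>: "\<gamma> = (real q + scheme_eps s) * \<beta>"
  shows "\<bar>comp (err s q) l y\<bar> \<le> C\<^sub>T ^ sloan_steps s q / \<delta> *
     (sqrt ((1 + real l) powr (1 - 2 * \<gamma>)) * sqrt (energy (\<lambda>l k. cf l k - cp l k) l))"
proof -
  let ?q = "sloan_steps s q" let ?a = "\<lambda>l k. cf l k - cp l k"
  let ?t = "\<mu> l ^ ?q * (1 / (1 - \<mu> l))"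
  have e: "err s q = (\<lambda>l k. (\<mu> l ^ ?q * (1 / (1 - \<mu> l))) * ?a l k)"
    by (simp add: err_def res_def mult.assoc)
  have t: "\<bar>?t\<bar> \<le> C\<^sub>T ^ ?q / \<delta> * (1 + real l) powr (- \<gamma>)"
  proof -
    have "\<bar>\<mu> l\<bar> ^ ?q \<le> (C\<^sub>T * (1 + real l) powr (- \<beta>)) ^ ?q"
      by (intro power_mono decay) simp
    also have "\<dots> = C\<^sub>T ^ ?q * (1 + real l) powr (- \<gamma>)"
      by (simp add: power_mult_distrib powr_power sloan_steps_real \<gamma> mult.commute)
    finally have 1: "\<bar>\<mu> l ^ ?q\<bar> \<le> C\<^sub>T ^ ?q * (1 + real l) powr (- \<gamma>)" by (simp add: power_abs)
    have 2: "\<bar>1 / (1 - \<mu> l)\<bar> \<le> 1 / \<delta>"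
      using gap[of l] pos one_minus_mu[of l] by (simp add: divide_simps)
    have "\<bar>?t\<bar> \<le> (C\<^sub>T ^ ?q * (1 + real l) powr (- \<gamma>)) * (1 / \<delta>)"
      unfolding abs_mult using 1 2 pos by (intro mult_mono) auto
    then show ?thesis by simp
  qed
  have "\<bar>comp (err s q) l y\<bar> \<le> sqrt (kap l * energy (err s q) l)"
    by (rule comp_bound[OF y])
  also have "\<dots> = sqrt (kap l) * \<bar>?t\<bar> * sqrt (energy ?a l)"
    unfolding e energy_scale by (simp add: real_sqrt_mult)
  also have "\<dots> \<le> sqrt (1 + real l) * (C\<^sub>T ^ ?q / \<delta> * (1 + real l) powr (- \<gamma>)) * sqrt (energy ?a l)"
    using t pos by (intro mult_mono real_sqrt_le_mono kap_le) (auto simp: energy_nonneg)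
  also have "sqrt (1 + real l) * (C\<^sub>T ^ ?q / \<delta> * (1 + real l) powr (- \<gamma>)) =
      C\<^sub>T ^ ?q / \<delta> * (sqrt (1 + real l) * (1 + real l) powr (- \<gamma>))" by simp
  also have "sqrt (1 + real l) * (1 + real l) powr (- \<gamma>) = sqrt ((1 + real l) powr (1 - 2 * \<gamma>))"
  proof -
    have "sqrt (1 + real l) = (1 + real l) powr (1 / 2)" by (rule powr_half_sqrt[symmetric]) simp
    then have "sqrt (1 + real l) * (1 + real l) powr (- \<gamma>) = (1 + real l) powr (1 / 2 + - \<gamma>)"
      by (simp only: powr_add)
    also have "1 / 2 + - \<gamma> = (1 - 2 * \<gamma>) * (1 / 2)" by (simp add: algebra_simps)
    also have "(1 + real l) powr ((1 - 2 * \<gamma>) * (1 / 2)) = ((1 + real l) powr (1 - 2 * \<gamma>)) powr (1 / 2)"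
      by (simp only: powr_powr)
    also have "\<dots> = sqrt ((1 + real l) powr (1 - 2 * \<gamma>))" by (rule powr_half_sqrt) simp
    finally show ?thesis .
  qed
  finally show ?thesis by (simp add: mult.assoc)
qed

text \<open>Degrees up to \<open>n\<close> rest on \<open>projection_energy_bound\<close> and give
  the \<open>rho\<close> term. Above \<open>n\<close> only coefficients of \<open>f\<close> remain,
  and Cauchy--Schwarz against the Sobolev weight gives the other term.\<close>

lemma err_bound:
  assumes y: "y \<in> S2" and n: "n \<ge> 1" and \<gamma>: "\<gamma> = (real q + scheme_eps s) * \<beta>"
    and C1: "C1 \<ge> 0" "(\<Sum>l\<le>n. (1 + real l) powr (1 - 2 * \<gamma>)) \<le> C1 * (rho \<gamma> n)\<^sup>2"
  shows "\<bar>series (err s q) y\<bar> \<le> C\<^sub>T ^ sloan_steps s q / \<delta> *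
    (sqrt (2 powr r / (2 * \<gamma> + 2 * r - 2)) * real n powr (- (r + \<gamma> - 1)) +
     sqrt (C1 * (16 / (1 - \<theta>))) * (rho \<gamma> n * sqrt ((1 + \<eta>) / (1 - \<eta>)) * real n powr (- r))) * F"
proof -
  let ?A = "C\<^sub>T ^ sloan_steps s q / \<delta>" let ?a = "\<lambda>l k. cf l k - cp l k"
  let ?t = "\<lambda>l. (1 + real l) powr (1 - 2 * \<gamma>)" let ?e = "\<lambda>l. sqrt (?t l) * sqrt (energy ?a l)"
  let ?H = "sqrt (2 powr r / (2 * \<gamma> + 2 * r - 2)) * real n powr (- (r + \<gamma> - 1)) * F"
  let ?L = "sqrt (C1 * (16 / (1 - \<theta>))) * (rho \<gamma> n * sqrt ((1 + \<eta>) / (1 - \<eta>)) * real n powr (- r)) * F"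
  have A: "?A \<ge> 0" using pos by simp
  have \<gamma>0: "\<gamma> \<ge> 0" using pos by (cases s) (auto simp: \<gamma>)
  have rho: "rho \<gamma> n \<ge> 0" by (simp add: rho_def)
  have low: "(\<Sum>l\<le>n. ?e l) \<le> ?L"
  proof -
    have "(\<Sum>l\<le>n. ?e l) \<le> sqrt (\<Sum>l\<le>n. ?t l) * sqrt (\<Sum>l\<le>n. energy ?a l)"
      by (rule sum_sqrt_cauchy_schwarz) (auto simp: energy_nonneg)
    also have "\<dots> \<le> sqrt (C1 * (rho \<gamma> n)\<^sup>2) * sqrt (16 / (1 - \<theta>) * ((1 + \<eta>) / (1 - \<eta>)) * real n powr (- 2 * r) * F\<^sup>2)"
      by (intro mult_mono real_sqrt_le_mono C1 projection_energy_bound n)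
         (auto intro!: sum_nonneg mult_nonneg_nonneg simp: C1 energy_nonneg)
    also have "real n powr (- 2 * r) = (real n powr (- r))\<^sup>2"
      by (simp add: power2_eq_square flip: powr_add)
    finally show ?thesis using rho F_nonneg
      by (simp only: real_sqrt_mult real_sqrt_abs abs_of_nonneg powr_ge_zero mult_ac)
  qed
  have high: "(\<Sum>l\<in>{n<..N}. ?e l) \<le> ?H" for N
  proof -
    let ?T = "\<Sum>l\<in>{n<..N}. ?t l / lam r l"
    \<comment> \<open>The exponent 2\<gamma> + 2r - 1 exceeds 1, so the tail sum is of order n^(2 -
      2\<gamma> - 2r), the square of the required power.\<close>
    let ?B = "2 powr r * (real n powr (1 - (2 * \<gamma> + 2 * r - 1)) / (2 * \<gamma> + 2 * r - 1 - 1))"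
    have "?e l = sqrt (?t l / lam r l) * sqrt (lam r l * energy cf l)" if "l \<in> {n<..N}" for l
    proof -
      have "energy ?a l = energy cf l" using that by (intro energy_cong) (simp add: coeffs_zero)
      then have "?t l * energy ?a l = ?t l / lam r l * (lam r l * energy cf l)" using lam_pos[of r l] by simp
      then show ?thesis by (simp only: flip: real_sqrt_mult)
    qed
    then have "(\<Sum>l\<in>{n<..N}. ?e l) =
       (\<Sum>l\<in>{n<..N}. sqrt (?t l / lam r l) * sqrt (lam r l * energy cf l))" by (rule sum.cong[OF refl])
    also have "\<dots> \<le> sqrt ?T * sqrt (\<Sum>l\<in>{n<..N}. lam r l * energy cf l)"
      by (rule sum_sqrt_cauchy_schwarz) (auto simp: energy_nonneg less_imp_le[OF lam_pos])
    also have "\<dots> \<le> sqrt ?B * sqrt (F\<^sup>2)"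
    proof (intro mult_mono real_sqrt_le_mono sum_le_F)
      have "?T \<le> (\<Sum>l\<in>{n<..N}. 2 powr r * real l powr (- (2 * \<gamma> + 2 * r - 1)))"
      proof (rule sum_mono)
        fix l assume l: "l \<in> {n<..N}"
        have "?t l / lam r l \<le> ?t l / ((1/2) powr r * (1 + real l) powr (2 * r))"
          using r lam_pos[of r l] by (intro divide_left_mono lam_ge) (auto intro!: mult_pos_pos)
        also have "\<dots> = 2 powr r * (1 + real l) powr (1 - 2 * \<gamma> - 2 * r)"
          by (simp add: powr_diff powr_divide)
        also have "\<dots> \<le> 2 powr r * real l powr (1 - 2 * \<gamma> - 2 * r)"
          using l \<gamma>0 r by (intro mult_left_mono powr_mono2') auto
        also have "1 - 2 * \<gamma> - 2 * r = - (2 * \<gamma> + 2 * r - 1)" by simp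
        finally show "?t l / lam r l \<le> 2 powr r * real l powr (- (2 * \<gamma> + 2 * r - 1))" .
      qed
      also have "\<dots> \<le> ?B"
        unfolding sum_distrib_left[symmetric]
        using \<gamma>0 r by (intro mult_left_mono sum_powr_tail n) auto
      finally show "?T \<le> ?B" .
    qed (use \<gamma>0 r in \<open>auto intro!: sum_nonneg simp: energy_nonneg less_imp_le[OF lam_pos]\<close>)
    also have "real n powr (1 - (2 * \<gamma> + 2 * r - 1)) = (real n powr (- (r + \<gamma> - 1)))\<^sup>2"
      by (simp add: power2_eq_square algebra_simps flip: powr_add)
    finally show ?thesis using F_nonneg by (simp add: real_sqrt_mult real_sqrt_divide)
  qed
  have part: "\<bar>\<Sum>l<N. comp (err s q) l y\<bar> \<le> ?A * (?L + ?H)" for N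
  proof -
    have "\<bar>\<Sum>l<N. comp (err s q) l y\<bar> \<le> (\<Sum>l<N. ?A * (?e l))"
      by (rule order.trans[OF sum_abs]) (intro sum_mono err_comp_bound y \<gamma>)
    also have "\<dots> \<le> (\<Sum>l\<in>{..n} \<union> {n<..N}. ?A * (?e l))"
      by (intro sum_mono2 mult_nonneg_nonneg A) (auto simp: energy_nonneg)
    also have "\<dots> = ?A * ((\<Sum>l\<le>n. ?e l) + (\<Sum>l\<in>{n<..N}. ?e l))"
      unfolding sum_distrib_left[symmetric] by (subst sum.union_disjoint) auto
    also have "\<dots> \<le> ?A * (?L + ?H)"
      by (intro mult_left_mono add_mono low high A)
    finally show ?thesis .
  qed
  have "(\<lambda>N. \<bar>\<Sum>l<N. comp (err s q) l y\<bar>) \<longlonglongrightarrow> \<bar>series (err s q) y\<bar>"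
    using series_sums[OF hr_err y] unfolding sums_def by (rule tendsto_rabs)
  then have "\<bar>series (err s q) y\<bar> \<le> ?A * (?L + ?H)"
    by (rule LIMSEQ_le_const2) (use part in blast)
  also have "\<dots> = ?A * (sqrt (2 powr r / (2 * \<gamma> + 2 * r - 2)) * real n powr (- (r + \<gamma> - 1)) +
     sqrt (C1 * (16 / (1 - \<theta>))) * (rho \<gamma> n * sqrt ((1 + \<eta>) / (1 - \<eta>)) * real n powr (- r))) * F"
    by (simp only: distrib_left distrib_right mult.assoc add.commute)
  finally show ?thesis .
qed

end


theorem theorem5p1:
  fixes Y :: "nat \<Rightarrow> nat \<Rightarrow> real ^ 3 \<Rightarrow> real"
    and \<Phi> :: "real \<Rightarrow> real"
    and \<beta> C\<^sub>T \<delta> r :: real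
    and q :: nat
    and s :: scheme
  defines "\<gamma> \<equiv> (real q + scheme_eps s) * \<beta>"
  assumes "harmonic_onb Y"
    and "set_integrable lborel {-1<..<1} \<Phi>"
    and "\<beta> > 0" and "C\<^sub>T > 0" and "\<delta> > 0"
    and "\<forall>l. \<bar>multiplier \<Phi> l\<bar> \<le> C\<^sub>T * (1 + real l) powr (- \<beta>)"
    and "\<forall>l. \<bar>1 - multiplier \<Phi> l\<bar> \<ge> \<delta>"
    and "r > 1"
  shows "\<exists>C. \<forall>(N :: nat \<Rightarrow> nat) (w :: nat \<Rightarrow> nat \<Rightarrow> real) (x :: nat \<Rightarrow> nat \<Rightarrow> real ^ 3) (\<eta> :: nat \<Rightarrow> real).
    (\<forall>n\<ge>1. positive_rule (N n) (w n) (x n) \<and> mz_condition Y n (N n) (w n) (x n) (\<eta> n)) \<longrightarrow>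
    (\<forall>n\<ge>1. \<forall>f\<in>sobolev_space Y r.
       linf_norm (\<lambda>y. exact_solution Y r \<Phi> f y
                      - sloan \<Phi> f q (scheme_solution s Y r \<Phi> n (N n) (w n) (x n) f) y)
       \<le> ereal (C * (real n powr (- (r + \<gamma> - 1))
                 + rho \<gamma> n * (1 + ((1 + \<eta> n) / (1 - \<eta> n))\<^sup>2) powr (1/2) * real n powr (- r))
              * sobolev_norm Y r f))"
proof -
  interpret zonal_equation Y r \<Phi> \<beta> "C\<^sub>T" \<delta>
    using assms(2-) by unfold_locales auto
  have \<gamma>0: "\<gamma> \<ge> 0" using pos by (cases s) (auto simp: \<gamma>_def)
  obtain C1 where C1: "C1 \<ge> 0"
    "\<And>n. n \<ge> 1 \<Longrightarrow> (\<Sum>l\<le>n. (1 + real l) powr (1 - 2 * \<gamma>)) \<le> C1 * (rho \<gamma> n)\<^sup>2"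
    using sum_powr_rho[OF \<gamma>0] by blast
  \<comment> \<open>These constants involve only the operator bounds, \<open>r\<close>,
    \<open>q\<close> and the scheme. They are fixed before any rule or \<open>f\<close> appears,
    which gives the claimed independence.\<close>
  define m where "m = (case s of Galerkin \<Rightarrow> q | Nystrom \<Rightarrow> Suc q)"
  define A where "A = C\<^sub>T ^ m / \<delta>"
  define H where "H = sqrt (2 powr r / (2 * \<gamma> + 2 * r - 2))"
  define L where "L = sqrt (C1 * (16 / (1 - 4 powr (1 - r))))"
  have A: "A \<ge> 0" and H: "H \<ge> 0" using pos \<gamma>0 r by (auto simp: A_def H_def)
  have L: "L \<ge> 0"
    using C1(1) r powr_less_mono[of "1 - r" 0 4] by (auto simp: L_def intro!: divide_nonneg_nonneg)
  show ?thesis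
  proof (intro exI[of _ "A * (H + L)"] allI impI ballI)
    fix N :: "nat \<Rightarrow> nat" and w :: "nat \<Rightarrow> nat \<Rightarrow> real" and x :: "nat \<Rightarrow> nat \<Rightarrow> real ^ 3" and \<eta> :: "nat \<Rightarrow> real"
      and n :: nat and f
    assume rules: "\<forall>n\<ge>1. positive_rule (N n) (w n) (x n) \<and> mz_condition Y n (N n) (w n) (x n) (\<eta> n)"
      and n: "1 \<le> n" and f: "f \<in> sobolev_space Y r"
    interpret quadrature Y n "N n" "w n" "x n" "\<eta> n"
      by unfold_locales (use rules n in auto)
    obtain p where p: "normal_eq f p" using normal_eq_exists by blast
    interpret discrete_scheme Y r \<Phi> \<beta> "C\<^sub>T" \<delta> n "N n" "w n" "x n" "\<eta> n" f p
      by unfold_locales (use f p in auto)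
    let ?X = "(1 + \<eta> n) / (1 - \<eta> n)"
    let ?h = "real n powr (- (r + \<gamma> - 1))"
    let ?l = "rho \<gamma> n * (1 + ?X\<^sup>2) powr (1/2) * real n powr (- r)"
    show "linf_norm (\<lambda>y. exact_solution Y r \<Phi> f y
          - sloan \<Phi> f q (scheme_solution s Y r \<Phi> n (N n) (w n) (x n) f) y)
       \<le> ereal (A * (H + L) * (?h + ?l) * sobolev_norm Y r f)"
    proof (rule linf_norm_le[OF series_continuous[OF hr_err]])
      fix y :: "real ^ 3" assume y: "y \<in> S2"
      show "exact_solution Y r \<Phi> f y - sloan \<Phi> f q (scheme_solution s Y r \<Phi> n (N n) (w n) (x n) f) y =
          series (err s q) y"
        unfolding err_def by (rule error_series[OF y])
      have rho: "rho \<gamma> n \<ge> 0" by (simp add: rho_def)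
      \<comment> \<open>The estimate yields the square root of the quotient X; since X <= 1 + X^2,
        the stated factor dominates it.\<close>
      have X: "sqrt ?X \<le> (1 + ?X\<^sup>2) powr (1/2)"
      proof -
        have "0 \<le> (?X - 1)\<^sup>2" by simp
        then have "2 * ?X \<le> 1 + ?X\<^sup>2" by (simp only: power2_diff) simp
        moreover have "0 \<le> ?X" using eta by simp
        ultimately have "?X \<le> 1 + ?X\<^sup>2" by linarith
        then have "sqrt ?X \<le> sqrt (1 + ?X\<^sup>2)" by (rule real_sqrt_le_mono)
        also have "\<dots> = (1 + ?X\<^sup>2) powr (1/2)" by (rule powr_half_sqrt[symmetric]) simp
        finally show ?thesis .
      qed
      have l: "rho \<gamma> n * sqrt ?X * real n powr (- r) \<le> ?l"
        by (intro mult_right_mono mult_left_mono X rho) simp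
      have l0: "?l \<ge> 0" using rho by simp
      have "\<bar>series (err s q) y\<bar> \<le> A * (H * ?h + L * (rho \<gamma> n * sqrt ?X * real n powr (- r))) * sobolev_norm Y r f"
        using err_bound[OF y n _ C1(1) C1(2)[OF n], of q s]
        unfolding A_def H_def L_def m_def F_def \<theta>_def sloan_steps_def by (simp add: \<gamma>_def)
      also have "\<dots> \<le> A * ((H + L) * (?h + ?l)) * sobolev_norm Y r f"
      proof (intro mult_right_mono mult_left_mono A)
        have "H * ?h + L * (rho \<gamma> n * sqrt ?X * real n powr (- r)) \<le> H * ?h + L * ?l"
          using l L by (intro add_left_mono mult_left_mono)
        also have "\<dots> \<le> (H + L) * (?h + ?l)"
          using mult_nonneg_nonneg[OF H l0] mult_nonneg_nonneg[OF L powr_ge_zero[of "real n" "- (r + \<gamma> - 1)"]]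
          by (simp only: distrib_left distrib_right)
        finally show "H * ?h + L * (rho \<gamma> n * sqrt ?X * real n powr (- r)) \<le> (H + L) * (?h + ?l)" .
        show "0 \<le> sobolev_norm Y r f" using F_nonneg by (simp add: F_def)
      qed
      finally show "\<bar>series (err s q) y\<bar> \<le> A * (H + L) * (?h + ?l) * sobolev_norm Y r f"
        by (simp only: mult.assoc)
    qed
  qed
qed

end
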